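(* Let $d\le 2$, $T>0$, and $b\in BV_{loc}(\mathbb{R}^d;\mathbb{R}^d)$. Let $(b_n)_n$ be smooth vector fields converging to $b$, bounded uniformly in $n$ in $L^\infty(\mathbb{R}^d)\cap W^{1,1}(\mathbb{R}^d)$, and suppose there is $B\in W^{1,\infty}(\mathbb{R}^d;\mathbb{R}^d)$ such that $\inf_{x\in K} b_n(x)\cdot B(x)>0$ for every compact $K\subset\mathbb{R}^d$. Let $X_n\in C^1([0,T]\times\mathbb{R}^d;\mathbb{R}^d)$ solve $$\partial_t X_n(t,x)=b_n(X_n(t,x)),\qquad X_n(0,x)=x,$$ and assume there is $C\ge1$ independent of $n$ with $\frac1C\le\det d_xX_n(t,x)\le C$ for all $n$, $t\in[0,T]$, $x\in\mathbb{R}^d$. Then $(X_n)_n$ is locally compact in $L^1([0,T]\times\mathbb{R}^d)$.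
   Context: $d_xX_n$ is the differential of $X_n$ in $x$ only. Locally compact in $L^1([0,T]\times\mathbb{R}^d)$ means relatively compact in $L^1([0,T]\times K)$ for each compact $K$. The convergence $b_n\to b$ is understood as strong convergence in $L^1_{loc}(\mathbb{R}^d)$. *)

theory Defs
  imports "HOL-Analysis.Analysis"
begin

fun Ck :: "nat \<Rightarrow> ('a::real_normed_vector \<Rightarrow> 'b::real_normed_vector) \<Rightarrow> bool" where
  "Ck 0 f = continuous_on UNIV f"
| "Ck (Suc k) f = (\<exists>f'. (\<forall>x. (f has_derivative f' x) (at x)) \<and> (\<forall>v. Ck k (\<lambda>x. f' x v)))"

definition smooth :: "('a::real_normed_vector \<Rightarrow> 'b::real_normed_vector) \<Rightarrow> bool" where
  "smooth f \<longleftrightarrow> (\<forall>k. Ck k f)"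

definition C1_on :: "'a::real_normed_vector set \<Rightarrow> ('a \<Rightarrow> 'b::real_normed_vector) \<Rightarrow> bool" where
  "C1_on S f \<longleftrightarrow> (\<exists>D. (\<forall>z\<in>S. (f has_derivative D z) (at z within S))
                      \<and> (\<forall>v. continuous_on S (\<lambda>z. D z v)))"

definition locally_L1 :: "('a::euclidean_space \<Rightarrow> 'b::euclidean_space) \<Rightarrow> bool" where
  "locally_L1 f \<longleftrightarrow> (\<forall>K. compact K \<longrightarrow> set_integrable lebesgue K f)"

definition pd :: "(real^'n \<Rightarrow> real) \<Rightarrow> 'n \<Rightarrow> real^'n \<Rightarrow> real" where
  "pd \<phi> j x = frechet_derivative \<phi> (at x) (axis j 1)"

text \<open>BV_loc(R^d;R^d): locally integrable and the distributional derivatives D_j b_i are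
  Radon measures, i.e. on every ball the total variation
  sup { int b_i d_j phi : phi in C^1_c(ball), |phi| <= 1 } is finite.\<close>
definition BV_loc :: "(real^'n \<Rightarrow> real^'n) \<Rightarrow> bool" where
  "BV_loc b \<longleftrightarrow> locally_L1 b \<and>
     (\<forall>r>0. \<exists>M. \<forall>i j \<phi>. Ck 1 \<phi> \<and> closure {x. \<phi> x \<noteq> 0} \<subseteq> ball 0 r \<and> (\<forall>x. \<bar>\<phi> x\<bar> \<le> 1)
          \<longrightarrow> \<bar>LINT x|lebesgue. (b x $ i) * pd \<phi> j x\<bar> \<le> M)"

text \<open>W^{1,infinity}(R^d;R^d), via its continuous representative: bounded and Lipschitz.\<close>
definition W1inf :: "(real^'n \<Rightarrow> real^'n) \<Rightarrow> bool" where
  "W1inf B \<longleftrightarrow> bounded (range B) \<and> (\<exists>L. L-lipschitz_on UNIV B)"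

end

theory Submission
  imports Defs "HOL-Complex_Analysis.Great_Picard" "HOL-Library.Diagonal_Subsequence"
begin

text \<open>
  In dimension one the trajectories are Lipschitz in \<open>x\<close>, since \<open>d\<^sub>xX\<^sub>n\<close> is its own determinant. In the
  plane, a shift modulus in \<open>L\<^sup>1\<close> that is uniform in \<open>n\<close> is obtained as follows. Since \<open>b\<^sub>n \<bullet> B > 0\<close>, the
  fields \<open>b\<^sub>0\<close> and \<open>b\<^sub>n\<close> can be glued to a nonvanishing field \<open>c\<close> that is \<open>b\<^sub>n\<close> on a large ball and \<open>b\<^sub>0\<close>
  far out. The accelerated field \<open>v = (1 + \<epsilon>\<^sup>2 / |c|\<^sup>2) c\<close> has the same orbits, and
  \<open>|Dv| \<le> |Dc| |v|\<^sup>2 / \<epsilon>\<^sup>2\<close>. Write the derivative of its flow \<open>\<Phi>\<close> as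
  \<open>\<partial>\<^sub>u \<Phi> = \<alpha> v + \<beta> v\<^sup>\<bottom> / |v|\<^sup>2\<close>; then \<open>\<beta>\<close> is the Jacobian of \<open>\<Phi>\<close> times \<open>v(x)\<^sup>\<bottom> \<bullet> u\<close>, and
  \<open>|\<alpha>'| \<le> 2 |\<beta>| |Dv| / |v|\<^sup>2\<close>, so changing variables bounds the \<open>L\<^sup>1\<close> norm of \<open>\<alpha>'\<close> by that of \<open>Dc\<close>.
  The term \<open>\<alpha> v\<close> is tangential, so integrating it by parts over a short time interval shows that the time
  average of \<open>\<Phi>\<close> over that interval has a derivative bounded in \<open>L\<^sup>1\<close>.

  The Jacobian bound on \<open>X\<^sub>n\<close> bounds the time integral of \<open>|Db\<^sub>n|\<close> along trajectories in \<open>L\<^sup>1\<close>, so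
  outside a small set of starting points the speed stays comparable to its initial value. Where it is not
  small, \<open>\<Phi>\<close> is a time change of \<open>X\<^sub>n\<close> close to the identity; where it is small, \<open>X\<^sub>n\<close> stays near \<open>x\<close>.
  Hence \<open>X\<^sub>n\<close> is uniformly close in \<open>L\<^sup>1\<close> to maps with bounded variation. Compactness follows by
  mollification in \<open>x\<close>, the theorem of Arzela and Ascoli, and a diagonal argument.
\<close>

subsection \<open>Solutions and flows of ordinary differential equations\<close>

text \<open>Derivatives bounded only in L^1 give no control of quantities exponential in them, nor
  of their maximal functions. What rescues the plane is that the linearized flow has one known
  solution, \<open>v\<close> along the trajectory: the transversal part of any other solution is a
  determinant, which a change of variables absorbs whatever its size, and the tangential part grows
  only linearly in the derivative. The price is a division by the squared speed, while
  \<open>bn n \<bullet> B\<close> has no lower bound uniform in \<open>n\<close>. Acceleration pays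
  it, since \<epsilon> is fixed before \<open>n\<close>. But it makes slow points fast: the
  transversal part carries the initial speed, hence a weight \<psi> that switches off slow starting
  points; and accelerated trajectories might run far away, hence the blending. On a compact shell
  the single field \<open>bn 0\<close> has a positive minimal speed, so there the accelerated speed
  is at most \<open>M + 1\<close> for all \<open>n\<close>, and trajectories stay in a fixed ball.
  The common direction \<open>B\<close> keeps convex combinations of \<open>bn 0\<close> and
  \<open>bn n\<close> from vanishing.\<close>

lemma gronwall_norm:
  fixes y :: "real \<Rightarrow> 'a::real_inner"
  assumes der: "\<And>t. t \<in> {0..S} \<Longrightarrow> (y has_vector_derivative y' t) (at t within {0..S})"
    and bnd: "\<And>t. t \<in> {0..S} \<Longrightarrow> norm (y' t) \<le> L * norm (y t) + \<eta>"
    and L: "0 \<le> L" and \<eta>: "0 \<le> \<eta>" and t: "t \<in> {0..S}"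
  shows "norm (y t) \<le> (norm (y 0) + \<eta> * t) * exp (L * t)"
proof -
  have *: "norm (y t) \<le> (norm (y 0) + s + \<eta> * t) * exp (L * t)" if s: "0 < s" for s
  proof -
    \<comment> \<open>\<open>norm\<close> is not differentiable where \<open>y\<close> vanishes;
      this regularization is, and \<open>s\<close> tends to \<open>0\<close> at the end.\<close>
    define q where "q t = sqrt (y t \<bullet> y t + s\<^sup>2)" for t
    define f where "f t = q t * exp (- L * t) - \<eta> * t" for t
    have pos: "y t \<bullet> y t + s\<^sup>2 > 0" for t using s by (simp add: add_nonneg_pos)
    have qpos: "q t > 0" for t using pos by (simp add: q_def)
    have qge: "norm (y t) \<le> q t" for t
      by (simp add: q_def norm_eq_sqrt_inner)
    have q0: "q 0 \<le> norm (y 0) + s"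
      unfolding q_def power2_norm_eq_inner[symmetric] using s by (simp add: sqrt_add_le_add_sqrt order_trans[OF sqrt_add_le_add_sqrt])
    have dq: "(q has_real_derivative (y r \<bullet> y' r) / q r) (at r within {0..S})" if r: "r \<in> {0..S}" for r
    proof -
      have "((\<lambda>t. y t \<bullet> y t + s\<^sup>2) has_real_derivative (y r \<bullet> y' r + y' r \<bullet> y r)) (at r within {0..S})"
        using der[OF r] unfolding has_vector_derivative_def has_field_derivative_def
        by (auto intro!: derivative_eq_intros simp: algebra_simps)
      from DERIV_chain'[OF this DERIV_real_sqrt[OF pos[of r]]] show ?thesis
        unfolding q_def by (simp add: inner_commute divide_simps)
    qed
    have df: "(f has_real_derivative (y r \<bullet> y' r) / q r * exp (- L * r) + q r * (exp (- L * r) * (- L)) - \<eta>) (at r within {0..S})"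
      if r: "r \<in> {0..S}" for r
      unfolding f_def by (auto intro!: derivative_eq_intros dq[OF r] simp: algebra_simps)
    have le0: "(y r \<bullet> y' r) / q r * exp (- L * r) + q r * (exp (- L * r) * (- L)) - \<eta> \<le> 0" if r: "r \<in> {0..S}" for r
    proof -
      have "y r \<bullet> y' r \<le> norm (y r) * norm (y' r)" by (rule norm_cauchy_schwarz)
      also have "\<dots> \<le> q r * norm (y' r)" by (intro mult_right_mono qge) auto
      finally have "(y r \<bullet> y' r) / q r \<le> norm (y' r)" using qpos[of r] by (simp add: divide_simps mult.commute)
      also have "\<dots> \<le> L * norm (y r) + \<eta>" by (rule bnd[OF r])
      also have "\<dots> \<le> L * q r + \<eta>" by (intro add_right_mono mult_left_mono qge L)
      finally have "(y r \<bullet> y' r) / q r * exp (- L * r) \<le> (L * q r + \<eta>) * exp (- L * r)"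
        by (intro mult_right_mono) auto
      moreover have "\<eta> * exp (- L * r) \<le> \<eta>"
        using \<eta> L r by (intro mult_left_le) auto
      ultimately show ?thesis by (simp add: algebra_simps)
    qed
    have "f t \<le> f 0"
    proof (rule DERIV_nonpos_imp_decreasing_open[of 0 t f])
      show "\<exists>d. DERIV f x :> d \<and> d \<le> 0" if "0 < x" "x < t" for x
      proof -
        have x: "x \<in> {0..S}" using that t by auto
        have "at x within {0..S} = at x" using that t by (intro at_within_Icc_at) auto
        then show ?thesis using df[OF x] le0[OF x] by auto
      qed
      show "continuous_on {0..t} f"
        using df t by (auto intro!: DERIV_continuous_on DERIV_subset[OF df])
    qed (use t in auto)
    then have "q t * exp (- L * t) \<le> norm (y 0) + s + \<eta> * t"
      using q0 by (simp add: f_def)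
    then have "q t * exp (- L * t) * exp (L * t) \<le> (norm (y 0) + s + \<eta> * t) * exp (L * t)"
      by (intro mult_right_mono) auto
    then have "q t \<le> (norm (y 0) + s + \<eta> * t) * exp (L * t)"
      by (simp add: mult.assoc flip: exp_add)
    with qge[of t] show ?thesis by linarith
  qed
  have "((\<lambda>s. (norm (y 0) + s + \<eta> * t) * exp (L * t)) \<longlongrightarrow> (norm (y 0) + 0 + \<eta> * t) * exp (L * t)) (at_right 0)"
    by (intro tendsto_intros)
  moreover have "eventually (\<lambda>s. norm (y t) \<le> (norm (y 0) + s + \<eta> * t) * exp (L * t)) (at_right (0::real))"
    using * by (auto simp: eventually_at_right_less eventually_at_filter intro!: always_eventually)
  ultimately show ?thesis
    using tendsto_lowerbound[of _ _ "at_right (0::real)" "norm (y t)"] by fastforce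
qed

text \<open>The weight \<open>exp (2 * L * s)\<close> makes the Picard operator a contraction with
  constant 1/2 on the whole interval, so that no local solutions have to be continued: the integral
  of \<open>L\<close> times the weight is at most half the weight. The fixed point \<open>g\<close>
  is the solution divided by the weight. It is sought among bounded continuous functions on the
  line, hence the clamping of time by \<tau>.\<close>

lemma picard_existence:
  fixes V :: "real \<Rightarrow> 'a::euclidean_space \<Rightarrow> 'a"
  assumes cont: "continuous_on ({0..S} \<times> UNIV) (\<lambda>(t, y). V t y)"
    and lip: "\<And>t y z. t \<in> {0..S} \<Longrightarrow> norm (V t y - V t z) \<le> L * norm (y - z)"
    and L: "0 < L" and S: "0 \<le> S"
  shows "\<exists>f. f 0 = x \<and> (\<forall>t\<in>{0..S}. (f has_vector_derivative V t (f t)) (at t within {0..S}))"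
proof -
  define \<tau> where "\<tau> t = max 0 (min t S)" for t :: real
  have \<tau>: "\<tau> t \<in> {0..S}" for t using S by (auto simp: \<tau>_def)
  have \<tau>id: "\<tau> t = t" if "t \<in> {0..S}" for t using that by (auto simp: \<tau>_def)
  have c\<tau>: "continuous_on UNIV \<tau>" unfolding \<tau>_def by (intro continuous_intros)
  define W where "W g s = V s (exp (2 * L * s) *\<^sub>R apply_bcontfun g s)" for g s
  have cW: "continuous_on {0..S} (W g)" for g
  proof -
    have "continuous_on {0..S} (\<lambda>s. (s, exp (2 * L * s) *\<^sub>R apply_bcontfun g s))"
      by (intro continuous_intros) auto
    from continuous_on_compose2[OF cont this] show ?thesis by (auto simp: W_def)
  qed
  have iW: "W g integrable_on {0..t}" if "t \<in> {0..S}" for g t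
    using that by (intro integrable_continuous_real continuous_on_subset[OF cW]) auto
  define h where "h g t = exp (- (2 * L * t)) *\<^sub>R (x + integral {0..t} (W g))" for g t
  have ch: "continuous_on {0..S} (h g)" for g
    unfolding h_def by (intro continuous_intros indefinite_integral_continuous_1 iW) (use S in auto)
  define T where "T g = Bcontfun (\<lambda>t. h g (\<tau> t))" for g
  have Tb: "(\<lambda>t. h g (\<tau> t)) \<in> bcontfun" for g
  proof -
    have "continuous_on UNIV (\<lambda>t. h g (\<tau> t))"
      by (rule continuous_on_compose2[OF ch c\<tau>]) (use \<tau> in auto)
    moreover have "bounded (range (\<lambda>t. h g (\<tau> t)))"
      using compact_imp_bounded[OF compact_continuous_image[OF ch[of g]]] \<tau>
      by (auto intro: bounded_subset)
    ultimately show ?thesis by (simp add: bcontfun_def)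
  qed
  have Tapp: "apply_bcontfun (T g) t = h g (\<tau> t)" for g t
    using Tb by (simp add: T_def Bcontfun_inverse)
  have contr: "dist (T g) (T k) \<le> (1/2) * dist g k" for g k
  proof (rule dist_bound)
    fix t
    let ?r = "\<tau> t"
    have wd: "norm (W g s - W k s) \<le> L * exp (2 * L * s) * dist g k" if "s \<in> {0..?r}" for s
    proof -
      have s: "s \<in> {0..S}" using that \<tau>[of t] by auto
      have "norm (W g s - W k s) \<le> L * norm (exp (2 * L * s) *\<^sub>R apply_bcontfun g s - exp (2 * L * s) *\<^sub>R apply_bcontfun k s)"
        unfolding W_def by (rule lip[OF s])
      also have "\<dots> = L * (exp (2 * L * s) * dist (apply_bcontfun g s) (apply_bcontfun k s))"
        by (simp add: dist_norm flip: scaleR_diff_right)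
      also have "\<dots> \<le> L * (exp (2 * L * s) * dist g k)"
        using L by (intro mult_left_mono dist_bounded) auto
      finally show ?thesis by (simp add: mult.assoc)
    qed
    have I: "((\<lambda>s. L * exp (2 * L * s) * dist g k) has_integral ((exp (2 * L * ?r) / 2 * dist g k) - (exp (2 * L * 0) / 2 * dist g k))) {0..?r}"
      using \<tau>[of t]
      by (intro fundamental_theorem_of_calculus)
         (auto intro!: derivative_eq_intros simp flip: has_real_derivative_iff_has_vector_derivative)
    have "norm (integral {0..?r} (W g) - integral {0..?r} (W k)) = norm (integral {0..?r} (\<lambda>s. W g s - W k s))"
      using \<tau> by (subst integral_diff) (auto intro!: iW)
    also have "\<dots> \<le> integral {0..?r} (\<lambda>s. L * exp (2 * L * s) * dist g k)"
      using \<tau> I wd by (intro integral_norm_bound_integral integrable_diff iW) auto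
    also have "\<dots> = (exp (2 * L * ?r) - 1) / 2 * dist g k"
      unfolding integral_unique[OF I] by (simp add: field_simps)
    finally have *: "norm (integral {0..?r} (W g) - integral {0..?r} (W k)) \<le> (exp (2 * L * ?r) - 1) / 2 * dist g k" .
    have "dist (apply_bcontfun (T g) t) (apply_bcontfun (T k) t) = exp (- (2 * L * ?r)) * norm (integral {0..?r} (W g) - integral {0..?r} (W k))"
      by (simp add: Tapp h_def dist_norm flip: scaleR_diff_right)
    also have "\<dots> \<le> exp (- (2 * L * ?r)) * ((exp (2 * L * ?r) - 1) / 2 * dist g k)"
      by (intro mult_left_mono *) auto
    also have "\<dots> = (1 - exp (- (2 * L * ?r))) / 2 * dist g k"
      by (simp add: exp_minus field_simps)
    also have "\<dots> \<le> 1/2 * dist g k"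
      by (intro mult_right_mono) auto
    finally show "dist (apply_bcontfun (T g) t) (apply_bcontfun (T k) t) \<le> (1/2) * dist g k" .
  qed
  have "\<exists>!g. g \<in> UNIV \<and> T g = g"
    using Banach_fix[of UNIV "1/2" T] contr complete_UNIV by auto
  then obtain g where g: "T g = g" by auto
  define f where "f t = exp (2 * L * t) *\<^sub>R apply_bcontfun g t" for t
  have fW: "W g s = V s (f s)" for s by (simp add: W_def f_def)
  have feq: "f t = x + integral {0..t} (W g)" if "t \<in> {0..S}" for t
  proof -
    have "apply_bcontfun g t = h g t" using Tapp[of g t] g \<tau>id[OF that] by simp
    then show ?thesis by (simp add: f_def h_def flip: exp_add)
  qed
  show ?thesis
  proof (intro exI[of _ f] conjI ballI)
    show "f 0 = x" using feq[of 0] S by simp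
    fix t assume t: "t \<in> {0..S}"
    have "((\<lambda>t. x + integral {0..t} (W g)) has_vector_derivative 0 + W g t) (at t within {0..S})"
      by (intro has_vector_derivative_add has_vector_derivative_const integral_has_vector_derivative cW t)
    then have "((\<lambda>t. x + integral {0..t} (W g)) has_vector_derivative V t (f t)) (at t within {0..S})"
      by (simp add: fW)
    then show "(f has_vector_derivative V t (f t)) (at t within {0..S})"
      by (rule has_vector_derivative_transform[rotated 2]) (use t feq in auto)
  qed
qed

text \<open>Only the stretch after the last time \<open>s0\<close> in the ball of radius
  \<open>r\<close> counts, and there the mean value inequality applies. The field may be arbitrarily
  fast inside, as the accelerated one is near slow points.\<close>

lemma norm_bound_of_speed_outside:
  fixes f :: "real \<Rightarrow> 'a::real_inner"
  assumes der: "\<And>t. t \<in> {0..S} \<Longrightarrow> (f has_vector_derivative f' t) (at t within {0..S})"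
    and f0: "norm (f 0) \<le> r" and A: "0 \<le> A"
    and speed: "\<And>t. t \<in> {0..S} \<Longrightarrow> r \<le> norm (f t) \<Longrightarrow> norm (f' t) \<le> A"
    and t: "t \<in> {0..S}"
  shows "norm (f t) \<le> r + A * t"
proof (cases "norm (f t) \<le> r")
  case True then show ?thesis using A t by (smt (verit) atLeastAtMost_iff mult_nonneg_nonneg)
next
  case False
  have cf: "continuous_on {0..S} f"
    using der by (meson continuous_on_eq_continuous_within has_vector_derivative_continuous)
  define C where "C = {s \<in> {0..t}. norm (f s) \<le> r}"
  have "closed ({0..t} \<inter> f -` cball 0 r)"
    using t by (intro continuous_closed_preimage continuous_on_subset[OF cf]) auto
  also have "{0..t} \<inter> f -` cball 0 r = C" by (auto simp: C_def)
  finally have "closed C" .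
  then have "compact C" by (auto simp: C_def compact_eq_bounded_closed intro: bounded_subset[of "{0..t}"])
  moreover have "0 \<in> C" using f0 t by (auto simp: C_def)
  ultimately obtain s0 where s0: "s0 \<in> C" "\<And>s. s \<in> C \<Longrightarrow> s \<le> s0"
    using compact_attains_sup[of C] by auto
  have lt: "s0 < t" using s0(1) False by (auto simp: C_def order_le_less)
  have "\<exists>s\<in>{s0<..<t}. norm (f t - f s0) \<le> norm ((\<lambda>h. h *\<^sub>R f' s) (t - s0))"
  proof (rule mvt_general[OF lt, where f' = "\<lambda>s h. h *\<^sub>R f' s"])
    show "continuous_on {s0..t} f"
      using s0(1) t by (intro continuous_on_subset[OF cf]) (auto simp: C_def)
    fix s assume s: "s0 < s" "s < t"
    then have "at s within {0..S} = at s" using s0(1) t by (intro at_within_Icc_at) (auto simp: C_def)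
    then show "(f has_derivative (\<lambda>h. h *\<^sub>R f' s)) (at s)"
      using der[of s] s s0(1) t by (auto simp: C_def has_vector_derivative_def)
  qed
  then obtain s where s: "s \<in> {s0<..<t}" "norm (f t - f s0) \<le> (t - s0) * norm (f' s)"
    using lt by auto
  have sS: "s \<in> {0..S}" using s(1) s0(1) t by (auto simp: C_def)
  have "r < norm (f s)" using s0(2)[of s] s(1) s0(1) by (force simp: C_def)
  then have "norm (f' s) \<le> A" using speed[OF sS] by simp
  then have "norm (f t - f s0) \<le> (t - s0) * A"
    using s(2) lt by (smt (verit) mult_left_mono)
  also have "\<dots> \<le> A * t" using s0(1) A by (simp add: C_def algebra_simps)
  finally have "norm (f t - f s0) \<le> A * t" .
  then show ?thesis using s0(1) norm_triangle_sub[of "f t" "f s0"] by (simp add: C_def)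
qed

lemma flow_lipschitz:
  fixes V :: "'a::real_inner \<Rightarrow> 'a"
  assumes flow: "\<And>x t. t \<in> {0..S} \<Longrightarrow> ((\<lambda>t. \<Phi> t x) has_vector_derivative V (\<Phi> t x)) (at t within {0..S})"
    and init: "\<And>x. \<Phi> 0 x = x"
    and lip: "\<And>y z. norm (V y - V z) \<le> L * norm (y - z)" and L: "0 \<le> L"
    and t: "t \<in> {0..S}"
  shows "norm (\<Phi> t x - \<Phi> t y) \<le> norm (x - y) * exp (L * t)"
proof -
  have "norm (\<Phi> t x - \<Phi> t y) \<le> (norm (\<Phi> 0 x - \<Phi> 0 y) + 0 * t) * exp (L * t)"
    using L lip by (intro gronwall_norm[of S _ "\<lambda>t. V (\<Phi> t x) - V (\<Phi> t y)"] has_vector_derivative_diff flow t) auto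
  then show ?thesis by (simp add: init)
qed

lemma flow_continuous:
  fixes V :: "'a::euclidean_space \<Rightarrow> 'a"
  assumes flow: "\<And>x t. t \<in> {0..S} \<Longrightarrow> ((\<lambda>t. \<Phi> t x) has_vector_derivative V (\<Phi> t x)) (at t within {0..S})"
    and init: "\<And>x. \<Phi> 0 x = x"
    and lip: "\<And>y z. norm (V y - V z) \<le> L * norm (y - z)" and L: "0 \<le> L"
  shows "continuous_on ({0..S} \<times> UNIV) (\<lambda>(t, x). \<Phi> t x)"
  unfolding continuous_on_def split_beta
proof
  fix q :: "real \<times> 'a" assume q: "q \<in> {0..S} \<times> UNIV"
  obtain t x where tx: "q = (t, x)" by (cases q)
  have t: "t \<in> {0..S}" using q tx by auto
  let ?F = "at (t, x) within {0..S} \<times> UNIV"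
  have c: "continuous_on {0..S} (\<lambda>t. \<Phi> t x)"
    using flow by (meson continuous_on_eq_continuous_within has_vector_derivative_continuous)
  have "((\<lambda>t. \<Phi> t x) \<longlongrightarrow> \<Phi> t x) (at t within {0..S})" using c t by (auto simp: continuous_on_def)
  moreover have "continuous_on ({0..S} \<times> UNIV) (\<lambda>z::real\<times>'a. \<Phi> (fst z) x)"
    by (rule continuous_on_compose2[OF c]) (auto intro!: continuous_intros)
  ultimately have A: "((\<lambda>z. \<Phi> (fst z) x) \<longlongrightarrow> \<Phi> t x) ?F"
    using t by (auto simp: continuous_on_def)
  have B: "((\<lambda>z. \<Phi> (fst z) (snd z) - \<Phi> (fst z) x) \<longlongrightarrow> 0) ?F"
  proof (rule Lim_null_comparison)
    show "\<forall>\<^sub>F z in ?F. norm (\<Phi> (fst z) (snd z) - \<Phi> (fst z) x) \<le> norm (snd z - x) * exp (L * S)"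
      unfolding eventually_at_filter
    proof (intro always_eventually allI impI)
      fix z :: "real \<times> 'a" assume z: "z \<noteq> (t, x)" "z \<in> {0..S} \<times> UNIV"
      have "norm (\<Phi> (fst z) (snd z) - \<Phi> (fst z) x) \<le> norm (snd z - x) * exp (L * fst z)"
        using z by (intro flow_lipschitz[OF flow init lip L]) auto
      also have "\<dots> \<le> norm (snd z - x) * exp (L * S)"
        using z L by (intro mult_left_mono) (auto intro: mult_left_mono)
      finally show "norm (\<Phi> (fst z) (snd z) - \<Phi> (fst z) x) \<le> norm (snd z - x) * exp (L * S)" .
    qed
    have "((\<lambda>z::real\<times>'a. norm (snd z - x) * exp (L * S)) \<longlongrightarrow> norm (snd (t, x) - x) * exp (L * S)) ?F"
      by (intro tendsto_intros)
    then show "((\<lambda>z::real\<times>'a. norm (snd z - x) * exp (L * S)) \<longlongrightarrow> 0) ?F" by simp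
  qed
  show "((\<lambda>z. \<Phi> (fst z) (snd z)) \<longlongrightarrow> \<Phi> (fst q) (snd q)) (at q within {0..S} \<times> UNIV)"
    using tendsto_add[OF A B] by (simp add: tx)
qed

text \<open>The candidate \<open>p\<close> solves the linearized equation, and Gronwall's inequality
  bounds the remainder by the modulus of continuity \<omega> of \<open>DV\<close>, uniformly in
  \<open>x\<close> and \<open>t\<close>. Differentiability is asked only relative to
  \<open>K\<close>, because \<open>V\<close> will be a field composed with the projection onto a
  ball. Convexity of \<open>K\<close> keeps the segments between two trajectories inside.\<close>

lemma flow_derivative:
  fixes V :: "'a::euclidean_space \<Rightarrow> 'a" and DV :: "'a \<Rightarrow> 'a \<Rightarrow>\<^sub>L 'a"
  assumes flow: "\<And>x t. t \<in> {0..S} \<Longrightarrow> ((\<lambda>t. \<Phi> t x) has_vector_derivative V (\<Phi> t x)) (at t within {0..S})"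
    and init: "\<And>x. \<Phi> 0 x = x"
    and lip: "\<And>y z. norm (V y - V z) \<le> L * norm (y - z)" and L: "0 < L" and S: "0 \<le> S"
    and K: "compact K" "convex K" and U: "open U"
    and DV: "\<And>x. x \<in> K \<Longrightarrow> (V has_derivative blinfun_apply (DV x)) (at x within K)"
    and cDV: "continuous_on K DV" and DVL: "\<And>x. x \<in> K \<Longrightarrow> norm (DV x) \<le> L"
    and UK: "\<And>x t. x \<in> U \<Longrightarrow> t \<in> {0..S} \<Longrightarrow> \<Phi> t x \<in> K"
  obtains p :: "real \<Rightarrow> 'a \<Rightarrow> 'a \<Rightarrow> 'a" where
    "\<And>x t. x \<in> U \<Longrightarrow> t \<in> {0..S} \<Longrightarrow> (\<Phi> t has_derivative p t x) (at x)"
    "\<And>x u. x \<in> U \<Longrightarrow> p 0 x u = u"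
    "\<And>x u t. x \<in> U \<Longrightarrow> t \<in> {0..S} \<Longrightarrow>
        ((\<lambda>t. p t x u) has_vector_derivative DV (\<Phi> t x) (p t x u)) (at t within {0..S})"
    "\<And>u C. compact C \<Longrightarrow> C \<subseteq> U \<Longrightarrow> continuous_on ({0..S} \<times> C) (\<lambda>(t, x). p t x u)"
proof -
  have c\<Phi>: "continuous_on {0..S} (\<lambda>t. \<Phi> t x)" for x
    using flow by (meson continuous_on_eq_continuous_within has_vector_derivative_continuous)
  have lip\<Phi>: "norm (\<Phi> t x - \<Phi> t y) \<le> norm (x - y) * exp (L * S)" if t: "t \<in> {0..S}" for t x y
  proof -
    have "norm (\<Phi> t x - \<Phi> t y) \<le> norm (x - y) * exp (L * t)"
      using L by (intro flow_lipschitz[OF flow init lip _ t]) auto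
    also have "\<dots> \<le> norm (x - y) * exp (L * S)" using t L by (intro mult_left_mono) auto
    finally show ?thesis .
  qed
  have "\<exists>f. f 0 = u \<and> (\<forall>t\<in>{0..S}. (f has_vector_derivative DV (\<Phi> t x) (f t)) (at t within {0..S}))"
    if x: "x \<in> U" for x u
  proof (rule picard_existence[OF _ _ L S])
    have "continuous_on ({0..S} \<times> UNIV) (\<lambda>z::real\<times>'a. DV (\<Phi> (fst z) x))"
      by (rule continuous_on_compose2[OF continuous_on_compose2[OF cDV c\<Phi>]])
         (use UK x in \<open>auto intro!: continuous_intros\<close>)
    then show "continuous_on ({0..S} \<times> UNIV) (\<lambda>(t, y). blinfun_apply (DV (\<Phi> t x)) y)"
      unfolding split_beta by (intro continuous_intros) auto
    show "norm (blinfun_apply (DV (\<Phi> t x)) y - blinfun_apply (DV (\<Phi> t x)) z) \<le> L * norm (y - z)" if "t \<in> {0..S}" for t y z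
      unfolding blinfun.diff_right[symmetric]
      by (rule order_trans[OF norm_blinfun]) (intro mult_right_mono DVL UK x that, simp)
  qed
  then obtain p' where p': "\<And>x u. x \<in> U \<Longrightarrow> p' x u 0 = u"
    "\<And>x u t. x \<in> U \<Longrightarrow> t \<in> {0..S} \<Longrightarrow> (p' x u has_vector_derivative DV (\<Phi> t x) (p' x u t)) (at t within {0..S})"
    by metis
  define p where "p t x u = p' x u t" for t x u
  have p0: "p 0 x u = u" if "x \<in> U" for x u using p' that by (simp add: p_def)
  have dp: "((\<lambda>t. p t x u) has_vector_derivative DV (\<Phi> t x) (p t x u)) (at t within {0..S})"
    if "x \<in> U" "t \<in> {0..S}" for x u t using p'(2)[OF that] by (simp add: p_def)
  have DVb: "norm (DV (\<Phi> t x) w) \<le> L * norm w" if "x \<in> U" "t \<in> {0..S}" for x t w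
    by (rule order_trans[OF norm_blinfun]) (intro mult_right_mono DVL UK that, simp)
  have lin: "linear (p t x)" if x: "x \<in> U" and t: "t \<in> {0..S}" for t x
  proof (rule linearI)
    fix u w and c :: real
    have "norm (p t x (u + w) - (p t x u + p t x w)) \<le> (norm (p 0 x (u + w) - (p 0 x u + p 0 x w)) + 0 * t) * exp (L * t)"
      using L DVb[OF x]
      by (intro gronwall_norm[of S _ "\<lambda>t. DV (\<Phi> t x) (p t x (u + w)) - (DV (\<Phi> t x) (p t x u) + DV (\<Phi> t x) (p t x w))"]
           has_vector_derivative_diff has_vector_derivative_add dp x t)
         (auto simp flip: blinfun.add_right blinfun.diff_right)
    then show "p t x (u + w) = p t x u + p t x w" by (simp add: p0 x)
    have "norm (p t x (c *\<^sub>R u) - c *\<^sub>R p t x u) \<le> (norm (p 0 x (c *\<^sub>R u) - c *\<^sub>R p 0 x u) + 0 * t) * exp (L * t)"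
      using L DVb[OF x]
      by (intro gronwall_norm[of S _ "\<lambda>t. DV (\<Phi> t x) (p t x (c *\<^sub>R u)) - c *\<^sub>R DV (\<Phi> t x) (p t x u)"]
           has_vector_derivative_diff bounded_linear.has_vector_derivative[OF bounded_linear_scaleR_right] dp x t)
         (auto simp flip: blinfun.scaleR_right blinfun.diff_right)
    then show "p t x (c *\<^sub>R u) = c *\<^sub>R p t x u" by (simp add: p0 x)
  qed
  define E where "E = exp (L * S)"
  have E: "E \<ge> 1" "E > 0" using L S by (auto simp: E_def)
  have key: "norm (\<Phi> t (x + u) - \<Phi> t x - p t x u) \<le> \<omega> * (S * E * E) * norm u"
    if x: "x \<in> U" "x + u \<in> U" and t: "t \<in> {0..S}" and \<omega>: "0 \<le> \<omega>"
      and mod: "\<And>y z. y \<in> K \<Longrightarrow> z \<in> K \<Longrightarrow> norm (y - z) \<le> E * norm u \<Longrightarrow> norm (DV y - DV z) \<le> \<omega>"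
    for t x u \<omega>
  proof -
    have b: "norm (V (\<Phi> t (x + u)) - V (\<Phi> t x) - DV (\<Phi> t x) (p t x u))
        \<le> L * norm (\<Phi> t (x + u) - \<Phi> t x - p t x u) + \<omega> * (E * norm u)" if t: "t \<in> {0..S}" for t
    proof -
      let ?a = "\<Phi> t x" and ?b = "\<Phi> t (x + u)"
      have ab: "?a \<in> K" "?b \<in> K" using UK x t by auto
      have dab: "norm (?b - ?a) \<le> E * norm u" using lip\<Phi>[OF t, of "x + u" x] by (simp add: E_def mult.commute)
      have seg: "closed_segment ?a ?b \<subseteq> K" using ab K(2) by (rule closed_segment_subset)
      have "norm (V ?b - V ?a - DV ?a (?b - ?a)) \<le> norm (?b - ?a) * \<omega>"
      proof (rule differentiable_bound_linearization[of _ _ "closed_segment ?a ?b" V "\<lambda>x. blinfun_apply (DV x)"])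
        show "?a + s *\<^sub>R (?b - ?a) \<in> closed_segment ?a ?b" if "s \<in> {0..1}" for s
          using that by (auto simp: closed_segment_def algebra_simps intro!: exI[of _ s])
        show "(V has_derivative blinfun_apply (DV y)) (at y within closed_segment ?a ?b)" if "y \<in> closed_segment ?a ?b" for y
          using DV[of y] seg that by (auto intro: has_derivative_subset)
        show "onorm (blinfun_apply (DV y) - blinfun_apply (DV ?a)) \<le> \<omega>" if "y \<in> closed_segment ?a ?b" for y
        proof -
          have "norm (y - ?a) \<le> norm (?b - ?a)" using segment_bound1[OF that] by (simp add: norm_minus_commute)
          then have "norm (DV y - DV ?a) \<le> \<omega>" using mod[of y ?a] that seg ab dab by auto
          then show ?thesis by (simp add: norm_blinfun.rep_eq minus_blinfun.rep_eq fun_diff_def)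
        qed
      qed auto
      also have "\<dots> \<le> \<omega> * (E * norm u)" using dab \<omega> by (simp add: mult.commute mult_left_mono)
      finally have 1: "norm (V ?b - V ?a - DV ?a (?b - ?a)) \<le> \<omega> * (E * norm u)" .
      have "V ?b - V ?a - DV ?a (p t x u) = (V ?b - V ?a - DV ?a (?b - ?a)) + DV ?a (?b - ?a - p t x u)"
        by (simp add: blinfun.diff_right)
      then show ?thesis
        using 1 DVb[OF x(1) t, of "?b - ?a - p t x u"]
        by (metis add.commute add_mono norm_triangle_le)
    qed
    have "norm (\<Phi> t (x + u) - \<Phi> t x - p t x u) \<le> (norm (\<Phi> 0 (x + u) - \<Phi> 0 x - p 0 x u) + \<omega> * (E * norm u) * t) * exp (L * t)"
      using L \<omega> E
      by (intro gronwall_norm[of S _ "\<lambda>t. V (\<Phi> t (x + u)) - V (\<Phi> t x) - DV (\<Phi> t x) (p t x u)"]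
           has_vector_derivative_diff flow dp x b t) auto
    also have "\<dots> = \<omega> * E * norm u * (t * exp (L * t))" by (simp add: init p0 x)
    also have "\<dots> \<le> \<omega> * E * norm u * (S * E)"
      using t L \<omega> E unfolding E_def by (intro mult_left_mono mult_mono) auto
    finally show ?thesis by (simp add: mult_ac)
  qed
  have unif: "\<exists>d>0. \<forall>y\<in>K. \<forall>z\<in>K. norm (y - z) \<le> E * d \<longrightarrow> norm (DV y - DV z) \<le> \<omega>" if "0 < \<omega>" for \<omega>
  proof -
    have "uniformly_continuous_on K DV" using cDV K(1) by (rule compact_uniformly_continuous)
    then obtain d where d: "0 < d" "\<And>y z. y \<in> K \<Longrightarrow> z \<in> K \<Longrightarrow> dist z y < d \<Longrightarrow> dist (DV z) (DV y) < \<omega>"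
      unfolding uniformly_continuous_on_def using \<open>0 < \<omega>\<close> by meson
    show ?thesis
      by (rule exI[of _ "d / (2 * E)"]) (use d E in \<open>fastforce simp: dist_norm norm_minus_commute\<close>)
  qed
  have keyE: "\<exists>d>0. \<forall>x u t. x \<in> U \<longrightarrow> x + u \<in> U \<longrightarrow> t \<in> {0..S} \<longrightarrow> norm u \<le> d \<longrightarrow>
      norm (\<Phi> t (x + u) - \<Phi> t x - p t x u) \<le> e * norm u" if e: "0 < e" for e
  proof -
    define \<omega> where "\<omega> = e / (S * E * E + 1)"
    have SE: "0 \<le> S * E * E" using S E by auto
    have \<omega>: "0 < \<omega>" using e SE by (auto simp: \<omega>_def)
    have le: "\<omega> * (S * E * E) \<le> e" using e SE by (simp add: \<omega>_def divide_simps)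
    obtain d where d: "0 < d" "\<And>y z. y \<in> K \<Longrightarrow> z \<in> K \<Longrightarrow> norm (y - z) \<le> E * d \<Longrightarrow> norm (DV y - DV z) \<le> \<omega>"
      using unif[OF \<omega>] by blast
    have "norm (\<Phi> t (x + u) - \<Phi> t x - p t x u) \<le> e * norm u"
      if "x \<in> U" "x + u \<in> U" "t \<in> {0..S}" "norm u \<le> d" for x u t
    proof -
      have "E * norm u \<le> E * d" using that E by (intro mult_left_mono) auto
      then have "norm (\<Phi> t (x + u) - \<Phi> t x - p t x u) \<le> \<omega> * (S * E * E) * norm u"
        using that \<omega> d(2) by (intro key) (auto intro: order_trans)
      also have "\<dots> \<le> e * norm u" by (intro mult_right_mono le) auto
      finally show ?thesis .
    qed
    then show ?thesis using d(1) by blast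
  qed
  show ?thesis
  proof
    fix x t assume x: "x \<in> U" and t: "t \<in> {0..S}"
    obtain r where r: "r > 0" "ball x r \<subseteq> U" using U x open_contains_ball by blast
    show "(\<Phi> t has_derivative p t x) (at x)"
      unfolding has_derivative_at_alt
    proof (intro conjI allI impI)
      show "bounded_linear (p t x)" using lin[OF x t] by (rule linear_conv_bounded_linear[THEN iffD1])
      fix e :: real assume "e > 0"
      from keyE[OF this] obtain d where d: "0 < d" "\<And>x u t. x \<in> U \<Longrightarrow> x + u \<in> U \<Longrightarrow> t \<in> {0..S} \<Longrightarrow> norm u \<le> d \<Longrightarrow>
        norm (\<Phi> t (x + u) - \<Phi> t x - p t x u) \<le> e * norm u" by blast
      show "\<exists>d>0. \<forall>y. norm (y - x) < d \<longrightarrow> norm (\<Phi> t y - \<Phi> t x - p t x (y - x)) \<le> e * norm (y - x)"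
      proof (intro exI[of _ "min d r"] conjI allI impI)
        fix y assume y: "norm (y - x) < min d r"
        then have "y \<in> U" using r(2) by (auto simp: dist_norm norm_minus_commute subset_iff)
        then show "norm (\<Phi> t y - \<Phi> t x - p t x (y - x)) \<le> e * norm (y - x)"
          using d(2)[of x "y - x" t] x t y by simp
      qed (use d r in auto)
    qed
  next
    fix u and C :: "'a set" assume C: "compact C" "C \<subseteq> U"
    have "C \<inter> - U = {}" using C by auto
    obtain r where r: "r > 0" "\<And>x y. x \<in> C \<Longrightarrow> norm (y - x) < r \<Longrightarrow> y \<in> U"
    proof (cases "- U = {}")
      case True then show ?thesis using that[of 1] by auto
    next
      case False
      have "\<exists>d>0. \<forall>x\<in>C. \<forall>y\<in>- U. d \<le> dist x y"
        using C U by (intro separate_compact_closed) auto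
      then obtain d where "d > 0" "\<And>x y. x \<in> C \<Longrightarrow> y \<in> - U \<Longrightarrow> d \<le> dist x y" by blast
      then show ?thesis using that[of d] by (force simp: dist_norm norm_minus_commute)
    qed
    \<comment> \<open>Difference quotients with increment \<open>u\<close> divided by
      \<open>Suc m\<close>. The uniform remainder makes them converge uniformly on
      \<open>{0..S} \<times> C\<close>, so \<open>p\<close> inherits the joint continuity of the
      flow.\<close>
    define f where "f m z = (case z of (t, x) \<Rightarrow> real (Suc m) *\<^sub>R (\<Phi> t (x + u /\<^sub>R real (Suc m)) - \<Phi> t x))" for m :: nat and z
    have cf: "continuous_on ({0..S} \<times> C) (f m)" for m
    proof -
      have c: "continuous_on ({0..S} \<times> UNIV) (\<lambda>(t, x). \<Phi> t x)"
        using L by (intro flow_continuous[OF flow init lip]) auto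
      have 1: "continuous_on ({0..S} \<times> C) (\<lambda>z. \<Phi> (fst z) (snd z + u /\<^sub>R real (Suc m)))"
        using continuous_on_compose2[OF c, of "{0..S} \<times> C" "\<lambda>z. (fst z, snd z + u /\<^sub>R real (Suc m))"]
        by (force intro!: continuous_intros simp: split_beta)
      have 2: "continuous_on ({0..S} \<times> C) (\<lambda>z. \<Phi> (fst z) (snd z))"
        using continuous_on_compose2[OF c, of "{0..S} \<times> C" "\<lambda>z. (fst z, snd z)"]
        by (force intro!: continuous_intros simp: split_beta)
      show ?thesis unfolding f_def split_beta by (intro continuous_intros 1 2)
    qed
    have "uniform_limit ({0..S} \<times> C) f (\<lambda>(t, x). p t x u) sequentially"
    proof (rule uniform_limitI)
      fix e :: real assume e: "e > 0"
      define e' where "e' = e / (norm u + 1) / 2"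
      have e': "e' > 0" using e by (simp add: e'_def add_nonneg_pos)
      from keyE[OF this] obtain d where d: "0 < d" "\<And>x u t. x \<in> U \<Longrightarrow> x + u \<in> U \<Longrightarrow> t \<in> {0..S} \<Longrightarrow> norm u \<le> d \<Longrightarrow>
        norm (\<Phi> t (x + u) - \<Phi> t x - p t x u) \<le> e' * norm u" by blast
      obtain N where N: "norm u / min d r < real (Suc N)" using reals_Archimedean2 less_Suc_eq
        by (meson lessI less_trans of_nat_less_iff)
      show "\<forall>\<^sub>F m in sequentially. \<forall>z\<in>{0..S} \<times> C. dist (f m z) (case z of (t, x) \<Rightarrow> p t x u) < e"
      proof (rule eventually_sequentiallyI[of N], safe)
        fix m t x assume m: "N \<le> m" and t: "t \<in> {0..S}" and x: "x \<in> C"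
        let ?k = "real (Suc m)"
        let ?w = "u /\<^sub>R ?k"
        have k: "?k > 0" by simp
        have "norm u / min d r < ?k" using N m by simp
        then have "norm u < ?k * min d r" using d r by (simp add: divide_simps)
        then have "norm u / ?k < min d r" using k by (simp only: pos_divide_less_eq mult.commute)
        moreover have nw: "norm ?w = norm u / ?k" by (simp add: divide_inverse mult.commute)
        ultimately have w: "norm ?w \<le> d" "norm ?w < r" using r by auto
        have xU: "x \<in> U" "x + ?w \<in> U" using x C w r(2)[of x "x + ?w"] by auto
        have "f m (t, x) - p t x u = ?k *\<^sub>R (\<Phi> t (x + ?w) - \<Phi> t x - p t x ?w)"
          using linear_scale[OF lin[OF xU(1) t], of "inverse ?k" u] k
          by (simp add: f_def scaleR_diff_right)
        then have "norm (f m (t, x) - p t x u) \<le> ?k * (e' * norm ?w)"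
          using d(2)[OF xU t w(1)] k by (simp del: of_nat_Suc)
        also have "\<dots> = e' * norm u" using k by (simp add: nw del: of_nat_Suc)
        also have "\<dots> < e" using e by (simp add: e'_def divide_simps) (smt (verit) mult_nonneg_nonneg norm_ge_zero)
        finally show "dist (f m (t, x)) (p t x u) < e" by (simp add: dist_norm)
      qed
    qed
    then show "continuous_on ({0..S} \<times> C) (\<lambda>(t, x). p t x u)"
      by (rule uniform_limit_theorem[rotated]) (use cf in auto)
  qed (use p0 dp in auto)
qed

subsection \<open>The linearized flow of a plane field\<close>

text \<open>A dimension given by an index type cannot be fixed to \<open>2\<close> within a proof. The locale collects what is
  used of the plane: \<open>perp\<close> is the rotation by a right angle and \<open>dt\<close> the determinant.\<close>

locale plane =
  fixes perp :: "'a::euclidean_space \<Rightarrow> 'a" and dt :: "('a \<Rightarrow> 'a) \<Rightarrow> real"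
  assumes perp_linear: "linear perp"
    and norm_perp: "norm (perp x) = norm x"
    and perp_decomp: "(x \<bullet> x) *\<^sub>R p = (x \<bullet> p) *\<^sub>R x + (perp x \<bullet> p) *\<^sub>R perp x"
    and dt_wedge: "linear P \<Longrightarrow> perp (P x) \<bullet> P y = dt P * (perp x \<bullet> y)"
    and change_of_variables: "\<lbrakk>compact S; inj_on g S; \<And>x. x \<in> S \<Longrightarrow> (g has_derivative g' x) (at x within S);
        continuous_on UNIV H; \<And>y. 0 \<le> H y\<rbrakk> \<Longrightarrow>
      (\<integral>\<^sup>+x\<in>S. ennreal (\<bar>dt (g' x)\<bar> * H (g x)) \<partial>lborel) \<le> (\<integral>\<^sup>+y\<in>g ` S. ennreal (H y) \<partial>lborel)"
begin

text \<open>A solution parallel to \<open>w\<close> stays a constant multiple of \<open>w\<close>,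
  since both solve the same linear equation. So the tangential contributions cancel in the quotient
  rule, and only the component of \<open>p\<close> along \<open>perp (w t)\<close> changes the
  ratio.\<close>

lemma tangential_component_derivative:
  assumes w: "(w has_vector_derivative A (w t)) (at t within I)"
    and p: "(p has_vector_derivative A (p t)) (at t within I)"
    and A: "linear A" and nz: "w t \<noteq> 0"
  shows "((\<lambda>t. (w t \<bullet> p t) / (w t \<bullet> w t)) has_real_derivative
     (perp (w t) \<bullet> p t) * (A (w t) \<bullet> perp (w t) + w t \<bullet> A (perp (w t))) / (w t \<bullet> w t)\<^sup>2) (at t within I)"
proof -
  let ?w = "w t" and ?p = "p t"
  have nz': "?w \<bullet> ?w \<noteq> 0" using nz by simp
  have d1: "((\<lambda>t. w t \<bullet> p t) has_real_derivative ?w \<bullet> A ?p + A ?w \<bullet> ?p) (at t within I)"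
    and d2: "((\<lambda>t. w t \<bullet> w t) has_real_derivative ?w \<bullet> A ?w + A ?w \<bullet> ?w) (at t within I)"
    using w p unfolding has_vector_derivative_def has_field_derivative_def
    by (auto intro!: derivative_eq_intros simp: algebra_simps)
  have dec: "(?w \<bullet> ?w) *\<^sub>R ?p = (?w \<bullet> ?p) *\<^sub>R ?w + (perp ?w \<bullet> ?p) *\<^sub>R perp ?w" by (rule perp_decomp)
  have 1: "(A ?w \<bullet> ?p) * (?w \<bullet> ?w) = (?w \<bullet> ?p) * (A ?w \<bullet> ?w) + (perp ?w \<bullet> ?p) * (A ?w \<bullet> perp ?w)"
    using arg_cong[OF dec, of "\<lambda>z. A ?w \<bullet> z"] by (simp add: inner_add_right algebra_simps)
  have 2: "(?w \<bullet> A ?p) * (?w \<bullet> ?w) = (?w \<bullet> ?p) * (?w \<bullet> A ?w) + (perp ?w \<bullet> ?p) * (?w \<bullet> A (perp ?w))"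
    using arg_cong[OF dec, of "\<lambda>z. ?w \<bullet> A z"]
    by (simp add: linear_add[OF A] linear_scale[OF A] inner_add_right algebra_simps)
  have "(?w \<bullet> A ?p + A ?w \<bullet> ?p) * (?w \<bullet> ?w) - (?w \<bullet> ?p) * (?w \<bullet> A ?w + A ?w \<bullet> ?w)
     = (perp ?w \<bullet> ?p) * (A ?w \<bullet> perp ?w + ?w \<bullet> A (perp ?w))"
    unfolding distrib_right 1 2 by (simp add: algebra_simps inner_commute)
  then show ?thesis
    using DERIV_quotient[OF d1 d2 nz'] by (simp add: power2_eq_square mult.commute)
qed

lemma perp_component_identity:
  assumes "w \<noteq> 0"
  shows "p = ((w \<bullet> p) / (w \<bullet> w)) *\<^sub>R w + ((perp w \<bullet> p) / (w \<bullet> w)) *\<^sub>R perp w"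
proof -
  have nz: "w \<bullet> w \<noteq> 0" using assms by simp
  have "p = inverse (w \<bullet> w) *\<^sub>R ((w \<bullet> w) *\<^sub>R p)" using nz by simp
  also have "\<dots> = ((w \<bullet> p) / (w \<bullet> w)) *\<^sub>R w + ((perp w \<bullet> p) / (w \<bullet> w)) *\<^sub>R perp w"
    unfolding perp_decomp by (simp add: scaleR_add_right divide_inverse mult.commute)
  finally show ?thesis .
qed

text \<open>As \<open>w\<close> is the derivative of \<open>y\<close>, the tangential part
  \<open>\<alpha> w\<close> of \<open>p\<close> is the derivative of \<open>\<alpha> y\<close> minus
  \<open>\<alpha>' y\<close>. Its integral involves only the bounded curve \<open>y\<close>, however
  large \<open>w\<close> is. The factor 3 counts two boundary terms and the integral of
  \<open>\<alpha>' y\<close>. Hypothesis \<open>Ah\<close> is shaped so that all powers of the speed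
  in \<open>\<alpha>'\<close> cancel.\<close>

lemma norm_integral_variation_le:
  fixes y w p :: "real \<Rightarrow> 'a" and A :: "real \<Rightarrow> 'a \<Rightarrow>\<^sub>L 'a"
  assumes y: "\<And>t. t \<in> {0..S} \<Longrightarrow> (y has_vector_derivative w t) (at t within {0..S})"
    and w: "\<And>t. t \<in> {0..S} \<Longrightarrow> (w has_vector_derivative A t (w t)) (at t within {0..S})"
    and p: "\<And>t. t \<in> {0..S} \<Longrightarrow> (p has_vector_derivative A t (p t)) (at t within {0..S})"
    and nz: "\<And>t. t \<in> {0..S} \<Longrightarrow> w t \<noteq> 0"
    and Ah: "\<And>t. t \<in> {0..S} \<Longrightarrow> norm (A t) \<le> h t * (norm (w t))\<^sup>2"
    and cA: "continuous_on {0..S} A" and ch: "continuous_on {0..S} h"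
    and R: "\<And>t. t \<in> {0..S} \<Longrightarrow> norm (y t) \<le> R"
    and t01: "0 \<le> t0" "t0 \<le> t1" "t1 \<le> S"
  shows "norm (integral {t0..t1} p) \<le>
     3 * R * (norm (p 0) / norm (w 0) + integral {0..S} (\<lambda>t. 2 * \<bar>perp (w t) \<bullet> p t\<bar> * h t))
     + integral {0..S} (\<lambda>t. \<bar>perp (w t) \<bullet> p t\<bar> / norm (w t))"
proof -
  have S: "0 \<le> S" using t01 by auto
  define \<alpha> where "\<alpha> t = (w t \<bullet> p t) / (w t \<bullet> w t)" for t
  define \<beta> where "\<beta> t = perp (w t) \<bullet> p t" for t
  define \<alpha>' where "\<alpha>' t = \<beta> t * (A t (w t) \<bullet> perp (w t) + w t \<bullet> A t (perp (w t))) / (w t \<bullet> w t)\<^sup>2" for t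
  have d\<alpha>: "(\<alpha> has_real_derivative \<alpha>' t) (at t within {0..S})" if "t \<in> {0..S}" for t
    unfolding \<alpha>_def \<alpha>'_def \<beta>_def
    by (intro tangential_component_derivative w p nz that linearI) (simp_all add: blinfun.add_right blinfun.scaleR_right)
  have cy: "continuous_on {0..S} y" and cw: "continuous_on {0..S} w" and cp: "continuous_on {0..S} p"
    using y w p by (meson continuous_on_eq_continuous_within has_vector_derivative_continuous)+
  have cperp: "continuous_on {0..S} (\<lambda>t. perp (w t))"
    using linear_continuous_on_compose[OF cw perp_linear] .
  have c\<beta>: "continuous_on {0..S} \<beta>" unfolding \<beta>_def by (intro continuous_intros cperp cp)
  have c\<alpha>': "continuous_on {0..S} \<alpha>'"
    unfolding \<alpha>'_def by (intro continuous_intros c\<beta> cperp cw cA) (use nz in auto)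
  have c\<alpha>: "continuous_on {0..S} \<alpha>" by (rule DERIV_continuous_on[OF d\<alpha>])
  have h0: "0 \<le> h t" if "t \<in> {0..S}" for t
    using order_trans[OF norm_ge_zero Ah[OF that]] nz[OF that] by (simp add: zero_le_mult_iff)
  have \<alpha>'b: "\<bar>\<alpha>' t\<bar> \<le> 2 * \<bar>\<beta> t\<bar> * h t" if t: "t \<in> {0..S}" for t
  proof -
    let ?n = "norm (w t)"
    have n: "?n > 0" using nz[OF t] by simp
    have a: "\<bar>A t (w t) \<bullet> perp (w t)\<bar> \<le> norm (A t) * ?n * ?n"
      by (rule order_trans[OF Cauchy_Schwarz_ineq2]) (simp add: norm_perp mult_right_mono norm_blinfun)
    have b: "\<bar>w t \<bullet> A t (perp (w t))\<bar> \<le> norm (A t) * ?n * ?n"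
      using norm_blinfun[of "A t" "perp (w t)"]
      by (intro order_trans[OF Cauchy_Schwarz_ineq2]) (simp add: norm_perp mult.commute mult_left_mono)
    have "\<bar>A t (w t) \<bullet> perp (w t) + w t \<bullet> A t (perp (w t))\<bar> \<le> 2 * (norm (A t) * ?n\<^sup>2)"
      using a b by (simp add: power2_eq_square mult.assoc)
    also have "\<dots> \<le> 2 * (h t * ?n\<^sup>2 * ?n\<^sup>2)" using Ah[OF t] by (intro mult_left_mono mult_right_mono) auto
    finally have "\<bar>A t (w t) \<bullet> perp (w t) + w t \<bullet> A t (perp (w t))\<bar> / (?n\<^sup>2)\<^sup>2 \<le> 2 * h t"
      using n by (simp add: divide_simps power2_eq_square mult_ac)
    then have "\<bar>\<beta> t\<bar> * (\<bar>A t (w t) \<bullet> perp (w t) + w t \<bullet> A t (perp (w t))\<bar> / (?n\<^sup>2)\<^sup>2) \<le> \<bar>\<beta> t\<bar> * (2 * h t)"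
      by (rule mult_left_mono) simp
    then show ?thesis by (simp add: \<alpha>'_def abs_mult power2_norm_eq_inner mult_ac)
  qed
  define I where "I = integral {0..S} (\<lambda>t. 2 * \<bar>\<beta> t\<bar> * h t)"
  have iI: "(\<lambda>t. 2 * \<bar>\<beta> t\<bar> * h t) integrable_on {0..S}"
    by (intro integrable_continuous_real continuous_intros c\<beta> ch)
  have \<alpha>b: "\<bar>\<alpha> t\<bar> \<le> norm (p 0) / norm (w 0) + I" if t: "t \<in> {0..S}" for t
  proof -
    have "(\<alpha>' has_integral (\<alpha> t - \<alpha> 0)) {0..t}"
      using t by (intro fundamental_theorem_of_calculus)
        (auto intro: has_vector_derivative_within_subset d\<alpha> simp flip: has_real_derivative_iff_has_vector_derivative intro!: DERIV_subset[OF d\<alpha>])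
    then have "\<bar>\<alpha> t - \<alpha> 0\<bar> \<le> integral {0..t} (\<lambda>t. 2 * \<bar>\<beta> t\<bar> * h t)"
      using t \<alpha>'b integral_norm_bound_integral[of \<alpha>' "{0..t}" "\<lambda>t. 2 * \<bar>\<beta> t\<bar> * h t"] integrable_on_subinterval[OF iI, of 0 t]
      by (force simp: has_integral_iff)
    also have "\<dots> \<le> I"
      unfolding I_def using t h0 by (intro integral_subset_le integrable_on_subinterval[OF iI]) auto
    finally have "\<bar>\<alpha> t\<bar> \<le> \<bar>\<alpha> 0\<bar> + I" by linarith
    moreover have "\<bar>\<alpha> 0\<bar> \<le> norm (p 0) / norm (w 0)"
    proof -
      have "norm (w 0) > 0" using nz[of 0] S by simp
      moreover have "\<bar>w 0 \<bullet> p 0\<bar> \<le> norm (w 0) * norm (p 0)" by (rule Cauchy_Schwarz_ineq2)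
      ultimately show ?thesis
        unfolding \<alpha>_def by (simp add: divide_simps power2_eq_square mult.commute flip: power2_norm_eq_inner)
    qed
    ultimately show ?thesis by linarith
  qed
  define E' where "E' t = \<alpha> t *\<^sub>R w t + \<alpha>' t *\<^sub>R y t" for t
  have cE': "continuous_on {0..S} E'" unfolding E'_def by (intro continuous_intros c\<alpha> c\<alpha>' cw cy)
  have sub: "{t0..t1} \<subseteq> {0..S}" using t01 by auto
  have dE: "((\<lambda>t. \<alpha> t *\<^sub>R y t) has_vector_derivative E' t) (at t within {t0..t1})" if "t \<in> {t0..t1}" for t
    unfolding E'_def using that sub
    by (intro has_vector_derivative_scaleR has_vector_derivative_within_subset[OF y] DERIV_subset[OF d\<alpha>]) auto
  have intE: "(E' has_integral (\<alpha> t1 *\<^sub>R y t1 - \<alpha> t0 *\<^sub>R y t0)) {t0..t1}"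
    using t01 dE by (intro fundamental_theorem_of_calculus) auto
  let ?Q = "norm (p 0) / norm (w 0) + I"
  have Q: "0 \<le> ?Q" using \<alpha>b[of 0] S by (simp add: order_trans[OF abs_ge_zero])
  have R0: "0 \<le> R" using R[of 0] S order_trans[OF norm_ge_zero] by auto
  have b1: "norm (\<alpha> t *\<^sub>R y t) \<le> ?Q * R" if "t \<in> {0..S}" for t
    unfolding norm_scaleR using \<alpha>b[OF that] R[OF that] Q by (intro mult_mono) auto
  have b2: "norm (p t - E' t) \<le> 2 * \<bar>\<beta> t\<bar> * h t * R + \<bar>\<beta> t\<bar> / norm (w t)" if t: "t \<in> {0..S}" for t
  proof -
    have "p t - E' t = (\<beta> t / (w t \<bullet> w t)) *\<^sub>R perp (w t) - \<alpha>' t *\<^sub>R y t"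
      unfolding E'_def \<alpha>_def \<beta>_def diff_diff_eq[symmetric]
      by (subst perp_component_identity[OF nz[OF t], of "p t"], simp only: add_diff_cancel_left')
    also have "norm \<dots> \<le> norm ((\<beta> t / (w t \<bullet> w t)) *\<^sub>R perp (w t)) + norm (\<alpha>' t *\<^sub>R y t)"
      by (rule norm_triangle_ineq4)
    also have "norm ((\<beta> t / (w t \<bullet> w t)) *\<^sub>R perp (w t)) = \<bar>\<beta> t\<bar> / norm (w t)"
      using nz[OF t] by (simp add: norm_perp abs_mult divide_simps power2_eq_square flip: power2_norm_eq_inner)
    also have "norm (\<alpha>' t *\<^sub>R y t) \<le> 2 * \<bar>\<beta> t\<bar> * h t * R"
      unfolding norm_scaleR using \<alpha>'b[OF t] R[OF t] h0[OF t] by (intro mult_mono) auto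
    finally show ?thesis by simp
  qed
  have iw: "(\<lambda>t. \<bar>\<beta> t\<bar> / norm (w t)) integrable_on {0..S}"
    by (intro integrable_continuous_real continuous_intros c\<beta> cw) (use nz in auto)
  have iB: "(\<lambda>t. 2 * \<bar>\<beta> t\<bar> * h t * R + \<bar>\<beta> t\<bar> / norm (w t)) integrable_on {0..S}"
    by (intro integrable_add iw integrable_on_mult_left iI)
  have ip: "p integrable_on {t0..t1}" "E' integrable_on {t0..t1}"
    by (auto intro!: integrable_continuous_real continuous_on_subset[OF _ sub] cp cE')
  have "norm (integral {t0..t1} (\<lambda>t. p t - E' t)) \<le> integral {t0..t1} (\<lambda>t. 2 * \<bar>\<beta> t\<bar> * h t * R + \<bar>\<beta> t\<bar> / norm (w t))"
    using sub b2 by (intro integral_norm_bound_integral integrable_diff ip integrable_on_subinterval[OF iB]) auto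
  also have "\<dots> \<le> integral {0..S} (\<lambda>t. 2 * \<bar>\<beta> t\<bar> * h t * R + \<bar>\<beta> t\<bar> / norm (w t))"
    using h0 R0 by (intro integral_subset_le sub integrable_on_subinterval[OF iB] iB) auto
  also have "\<dots> = I * R + integral {0..S} (\<lambda>t. \<bar>\<beta> t\<bar> / norm (w t))"
    unfolding I_def by (subst integral_add) (auto intro!: iw integrable_on_mult_left iI)
  finally have c1: "norm (integral {t0..t1} p - (\<alpha> t1 *\<^sub>R y t1 - \<alpha> t0 *\<^sub>R y t0)) \<le> I * R + integral {0..S} (\<lambda>t. \<bar>\<beta> t\<bar> / norm (w t))"
    using ip integral_unique[OF intE] by (simp add: integral_diff)
  have c2: "norm (\<alpha> t1 *\<^sub>R y t1 - \<alpha> t0 *\<^sub>R y t0) \<le> ?Q * R + ?Q * R"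
    using t01 by (intro order_trans[OF norm_triangle_ineq4] add_mono b1) auto
  have c3: "I * R \<le> ?Q * R" using R0 by (intro mult_right_mono) auto
  have add: "a \<le> 3 * q + j" if "a \<le> b + c" "c \<le> i + j" "b \<le> q + q" "i \<le> q" for a b c i j q :: real
    using that by linarith
  have "norm (integral {t0..t1} p) \<le> 3 * (?Q * R) + integral {0..S} (\<lambda>t. \<bar>\<beta> t\<bar> / norm (w t))"
    by (rule add[OF norm_triangle_sub c1 c2 c3])
  also have "3 * (?Q * R) = 3 * R * ?Q" by (simp only: mult_ac)
  finally show ?thesis by (simp add: I_def \<beta>_def)
qed

end

section \<open>Flows of continuously differentiable fields, confined to a ball\<close>

lemma C1_imp_lipschitz_on_cball:
  fixes v :: "'a::euclidean_space \<Rightarrow> 'b::real_normed_vector"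
  assumes dv: "\<And>x. (v has_derivative blinfun_apply (Dv x)) (at x)" and cD: "continuous_on UNIV Dv"
  obtains L where "0 < L" "\<And>x. x \<in> cball 0 R \<Longrightarrow> norm (Dv x) \<le> L"
    "\<And>y z. y \<in> cball 0 R \<Longrightarrow> z \<in> cball 0 R \<Longrightarrow> norm (v y - v z) \<le> L * norm (y - z)"
proof -
  have "compact (Dv ` cball 0 R)" by (intro compact_continuous_image continuous_on_subset[OF cD]) auto
  then obtain L where L: "0 < L" "\<And>x. x \<in> cball 0 R \<Longrightarrow> norm (Dv x) \<le> L"
    using bounded_pos[THEN iffD1, OF compact_imp_bounded] by (metis imageI)
  have "norm (v y - v z) \<le> L * norm (y - z)" if "y \<in> cball 0 R" "z \<in> cball 0 R" for y z
  proof (rule differentiable_bound[of "cball 0 R" v "\<lambda>x. blinfun_apply (Dv x)"])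
    show "(v has_derivative blinfun_apply (Dv x)) (at x within cball 0 R)" for x
      by (rule has_derivative_at_withinI[OF dv])
    show "onorm (blinfun_apply (Dv x)) \<le> L" if "x \<in> cball 0 R" for x
      using L(2)[OF that] by (simp add: norm_blinfun.rep_eq)
  qed (use that in auto)
  then show ?thesis using L that by blast
qed

text \<open>The scalar factor \<open>c\<close> serves two purposes: the value \<open>-1\<close> runs
  time backwards, and the reciprocal of a speed ratio turns a reparametrized trajectory into a
  solution of the same nonautonomous equation as the trajectory it is compared with.\<close>

lemma solution_distance:
  fixes v :: "'a::real_inner \<Rightarrow> 'a"
  assumes f: "\<And>t. t \<in> {0..S} \<Longrightarrow> (f has_vector_derivative c t *\<^sub>R v (f t)) (at t within {0..S})"
    and g: "\<And>t. t \<in> {0..S} \<Longrightarrow> (g has_vector_derivative c t *\<^sub>R v (g t)) (at t within {0..S})"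
    and K: "\<And>t. t \<in> {0..S} \<Longrightarrow> f t \<in> K \<and> g t \<in> K"
    and lip: "\<And>y z. y \<in> K \<Longrightarrow> z \<in> K \<Longrightarrow> norm (v y - v z) \<le> L * norm (y - z)"
    and c: "\<And>t. t \<in> {0..S} \<Longrightarrow> \<bar>c t\<bar> \<le> 1" and L: "0 \<le> L" and t: "t \<in> {0..S}"
  shows "norm (f t - g t) \<le> norm (f 0 - g 0) * exp (L * t)"
proof -
  have "norm (f t - g t) \<le> (norm (f 0 - g 0) + 0 * t) * exp (L * t)"
  proof (rule gronwall_norm[of S "\<lambda>t. f t - g t" "\<lambda>t. c t *\<^sub>R v (f t) - c t *\<^sub>R v (g t)"])
    fix t assume t: "t \<in> {0..S}"
    show "((\<lambda>t. f t - g t) has_vector_derivative c t *\<^sub>R v (f t) - c t *\<^sub>R v (g t)) (at t within {0..S})"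
      by (intro has_vector_derivative_diff f g t)
    have "norm (c t *\<^sub>R v (f t) - c t *\<^sub>R v (g t)) \<le> 1 * norm (v (f t) - v (g t))"
      unfolding scaleR_diff_right[symmetric] norm_scaleR using c[OF t] by (intro mult_right_mono) auto
    also have "\<dots> \<le> L * norm (f t - g t)" using lip K[OF t] by simp
    finally show "norm (c t *\<^sub>R v (f t) - c t *\<^sub>R v (g t)) \<le> L * norm (f t - g t) + 0" by simp
  qed (use L t in auto)
  then show ?thesis by simp
qed

lemma solution_backward_unique:
  fixes v :: "'a::real_inner \<Rightarrow> 'a"
  assumes f: "\<And>t. t \<in> {0..S} \<Longrightarrow> (f has_vector_derivative v (f t)) (at t within {0..S})"
    and g: "\<And>t. t \<in> {0..S} \<Longrightarrow> (g has_vector_derivative v (g t)) (at t within {0..S})"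
    and K: "\<And>t. t \<in> {0..S} \<Longrightarrow> f t \<in> K \<and> g t \<in> K"
    and lip: "\<And>y z. y \<in> K \<Longrightarrow> z \<in> K \<Longrightarrow> norm (v y - v z) \<le> L * norm (y - z)"
    and L: "0 \<le> L" and t: "t \<in> {0..S}" and eq: "f t = g t"
  shows "f 0 = g 0"
proof -
  have rev: "((\<lambda>s. h (t - s)) has_vector_derivative (- 1) *\<^sub>R v (h (t - s))) (at s within {0..t})"
    if h: "\<And>t. t \<in> {0..S} \<Longrightarrow> (h has_vector_derivative v (h t)) (at t within {0..S})" and s: "s \<in> {0..t}" for h s
  proof -
    have "((\<lambda>s. t - s) has_vector_derivative - 1) (at s within {0..t})"
      by (auto intro!: derivative_eq_intros)
    moreover have "(h has_vector_derivative v (h (t - s))) (at (t - s) within (\<lambda>s. t - s) ` {0..t})"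
      using s t by (intro has_vector_derivative_within_subset[OF h]) auto
    ultimately show ?thesis
      using vector_diff_chain_within[of "\<lambda>s. t - s" "- 1" s "{0..t}" h "v (h (t - s))"] by (simp add: o_def)
  qed
  have "norm (f (t - t) - g (t - t)) \<le> norm (f (t - 0) - g (t - 0)) * exp (L * t)"
  proof (rule solution_distance[where S = t and f = "\<lambda>s. f (t - s)" and g = "\<lambda>s. g (t - s)" and v = v and c = "\<lambda>_. - 1" and K = K])
    show "f (t - s) \<in> K \<and> g (t - s) \<in> K" if "s \<in> {0..t}" for s using K[of "t - s"] that t by auto
  qed (use rev[OF f] rev[OF g] lip L t in auto)
  then show ?thesis using eq by simp
qed

text \<open>For a field composed with the projection onto a ball: a speed bound on a shell then
  holds at every point beyond the inner radius.\<close>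

lemma norm_closest_point_cball_ge:
  fixes x :: "'a::euclidean_space"
  assumes "0 \<le> R" "r \<le> R" "r \<le> norm x"
  shows "r \<le> norm (closest_point (cball 0 R) x)"
proof (cases "norm x \<le> R")
  case True
  then have "closest_point (cball 0 R) x = x" by (intro closest_point_self) auto
  then show ?thesis using assms by simp
next
  case False
  let ?c = "closest_point (cball 0 R) x"
  have x: "norm x > 0" using False assms(1) by linarith
  have "dist x ?c \<le> dist x ((R / norm x) *\<^sub>R x)"
    using assms x by (intro closest_point_le) auto
  also have "\<dots> = norm ((1 - R / norm x) *\<^sub>R x)" by (simp add: dist_norm algebra_simps)
  also have "\<dots> = norm x - R"
    using False x by (simp add: abs_if divide_simps)
  finally have "norm (x - ?c) \<le> norm x - R" by (simp add: dist_norm)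
  then show ?thesis using norm_triangle_sub[of x ?c] assms by linarith
qed

text \<open>The field is only locally Lipschitz, and its speed is bounded only on the shell between
  \<open>R2\<close> and \<open>R3\<close>. Composed with the projection onto the larger ball it
  becomes globally Lipschitz, and within time \<open>S\<close> no trajectory from the smaller ball
  crosses the shell, so none notices the change. The last conclusion says that the flow carries
  \<open>v\<close> along; this is the known solution of the linearized equation, and it turns
  transversal components into determinants.\<close>

lemma C1_flow_on_ball:
  fixes v :: "'a::euclidean_space \<Rightarrow> 'a" and Dv :: "'a \<Rightarrow> 'a \<Rightarrow>\<^sub>L 'a"
  assumes dv: "\<And>x. (v has_derivative blinfun_apply (Dv x)) (at x)" and cD: "continuous_on UNIV Dv"
    and speed: "\<And>x. R2 \<le> norm x \<Longrightarrow> norm x \<le> R3 \<Longrightarrow> norm (v x) \<le> A"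
    and A: "0 \<le> A" and S: "0 \<le> S" and R: "0 < R2" "R2 + A * S \<le> R3"
  obtains \<Phi> :: "real \<Rightarrow> 'a \<Rightarrow> 'a" and p :: "real \<Rightarrow> 'a \<Rightarrow> 'a \<Rightarrow> 'a" where
    "\<And>x. \<Phi> 0 x = x"
    "\<And>x t. x \<in> ball 0 R2 \<Longrightarrow> t \<in> {0..S} \<Longrightarrow> norm (\<Phi> t x) \<le> R3"
    "\<And>x t. x \<in> ball 0 R2 \<Longrightarrow> t \<in> {0..S} \<Longrightarrow> ((\<lambda>t. \<Phi> t x) has_vector_derivative v (\<Phi> t x)) (at t within {0..S})"
    "continuous_on ({0..S} \<times> UNIV) (\<lambda>(t, x). \<Phi> t x)"
    "\<And>x t. x \<in> ball 0 R2 \<Longrightarrow> t \<in> {0..S} \<Longrightarrow> (\<Phi> t has_derivative p t x) (at x)"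
    "\<And>x u. x \<in> ball 0 R2 \<Longrightarrow> p 0 x u = u"
    "\<And>x u t. x \<in> ball 0 R2 \<Longrightarrow> t \<in> {0..S} \<Longrightarrow>
        ((\<lambda>t. p t x u) has_vector_derivative Dv (\<Phi> t x) (p t x u)) (at t within {0..S})"
    "\<And>u C. compact C \<Longrightarrow> C \<subseteq> ball 0 R2 \<Longrightarrow> continuous_on ({0..S} \<times> C) (\<lambda>(t, x). p t x u)"
    "\<And>t. t \<in> {0..S} \<Longrightarrow> inj_on (\<Phi> t) (ball 0 R2)"
    "\<And>x t. x \<in> ball 0 R2 \<Longrightarrow> t \<in> {0..S} \<Longrightarrow> p t x (v x) = v (\<Phi> t x)"
proof -
  have "0 \<le> A * S" using A S by simp
  then have R23: "R2 \<le> R3" "0 < R3" using R by linarith+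
  obtain L where L: "0 < L" and DL: "\<And>x. x \<in> cball 0 R3 \<Longrightarrow> norm (Dv x) \<le> L"
    and lipv: "\<And>y z. y \<in> cball 0 R3 \<Longrightarrow> z \<in> cball 0 R3 \<Longrightarrow> norm (v y - v z) \<le> L * norm (y - z)"
    using C1_imp_lipschitz_on_cball[OF dv cD] by blast
  let ?K = "cball 0 R3 :: 'a set"
  define \<pi> where "\<pi> = closest_point ?K"
  have \<pi>K: "\<pi> x \<in> ?K" for x unfolding \<pi>_def using R23 by (intro closest_point_in_set) auto
  have \<pi>id: "\<pi> x = x" if "x \<in> ?K" for x unfolding \<pi>_def using that by (rule closest_point_self)
  have \<pi>lip: "norm (\<pi> y - \<pi> z) \<le> norm (y - z)" for y z
    unfolding \<pi>_def dist_norm[symmetric] using R23 by (intro closest_point_lipschitz) auto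
  define V where "V x = v (\<pi> x)" for x
  have Vlip: "norm (V y - V z) \<le> L * norm (y - z)" for y z
    unfolding V_def using lipv[OF \<pi>K \<pi>K, of y z] \<pi>lip[of y z] L by (smt (verit) mult_left_mono)
  have "\<exists>f. f 0 = x \<and> (\<forall>t\<in>{0..S}. (f has_vector_derivative V (f t)) (at t within {0..S}))" for x
  proof (rule picard_existence[OF _ _ L S])
    have "L-lipschitz_on UNIV V" using Vlip L by (auto simp: lipschitz_on_def dist_norm)
    then have "continuous_on UNIV V" by (rule lipschitz_on_continuous_on)
    then show "continuous_on ({0..S} \<times> UNIV) (\<lambda>(t, y). V y)"
      unfolding split_beta by (rule continuous_on_compose2) (auto intro!: continuous_intros)
  qed (rule Vlip)
  then obtain \<phi> where \<phi>: "\<And>x. \<phi> x 0 = x" "\<And>x t. t \<in> {0..S} \<Longrightarrow> (\<phi> x has_vector_derivative V (\<phi> x t)) (at t within {0..S})"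
    by metis
  define \<Phi> where "\<Phi> t x = \<phi> x t" for t x
  have init: "\<Phi> 0 x = x" for x by (simp add: \<Phi>_def \<phi>)
  have flow: "((\<lambda>t. \<Phi> t x) has_vector_derivative V (\<Phi> t x)) (at t within {0..S})" if "t \<in> {0..S}" for t x
    using \<phi>(2)[OF that] by (simp add: \<Phi>_def)
  have inK: "norm (\<Phi> t x) \<le> R3" if x: "x \<in> ball 0 R2" and t: "t \<in> {0..S}" for t x
  proof -
    have "norm (\<Phi> t x) \<le> R2 + A * t"
    proof (rule norm_bound_of_speed_outside[of S _ "\<lambda>t. V (\<Phi> t x)"])
      show "norm (V (\<Phi> t x)) \<le> A" if "t \<in> {0..S}" "R2 \<le> norm (\<Phi> t x)" for t
        unfolding V_def using \<pi>K[of "\<Phi> t x"] norm_closest_point_cball_ge[OF less_imp_le[OF R23(2)] R23(1) that(2)]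
        by (intro speed) (auto simp: \<pi>_def)
    qed (use flow x t A init in auto)
    also have "\<dots> \<le> R2 + A * S" using t A by (simp add: mult_left_mono)
    finally show ?thesis using R by simp
  qed
  have Vv: "V y = v y" if "norm y \<le> R3" for y using \<pi>id[of y] that by (simp add: V_def)
  have flowv: "((\<lambda>t. \<Phi> t x) has_vector_derivative v (\<Phi> t x)) (at t within {0..S})" if "x \<in> ball 0 R2" "t \<in> {0..S}" for x t
    using flow[OF that(2), of x] Vv[OF inK[OF that]] by simp
  have DV: "(V has_derivative blinfun_apply (Dv x)) (at x within ?K)" if "x \<in> ?K" for x
    using has_derivative_at_withinI[OF dv[of x], of ?K]
    by (rule has_derivative_transform[rotated 2]) (use that Vv in auto)
  obtain p :: "real \<Rightarrow> 'a \<Rightarrow> 'a \<Rightarrow> 'a" where p: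
    "\<And>x t. x \<in> ball 0 R2 \<Longrightarrow> t \<in> {0..S} \<Longrightarrow> (\<Phi> t has_derivative p t x) (at x)"
    "\<And>x u. x \<in> ball 0 R2 \<Longrightarrow> p 0 x u = u"
    "\<And>x u t. x \<in> ball 0 R2 \<Longrightarrow> t \<in> {0..S} \<Longrightarrow>
        ((\<lambda>t. p t x u) has_vector_derivative Dv (\<Phi> t x) (p t x u)) (at t within {0..S})"
    "\<And>u C. compact C \<Longrightarrow> C \<subseteq> ball 0 R2 \<Longrightarrow> continuous_on ({0..S} \<times> C) (\<lambda>(t, x). p t x u)"
  proof (rule flow_derivative[where \<Phi> = \<Phi> and V = V and DV = Dv and K = ?K and U = "ball 0 R2" and L = L and S = S])
    show "continuous_on ?K Dv" by (rule continuous_on_subset[OF cD]) simp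
  qed (use flow init Vlip L S DV DL inK in auto)
  have c: "continuous_on ({0..S} \<times> UNIV) (\<lambda>(t, x). \<Phi> t x)"
    using L by (intro flow_continuous[OF flow init Vlip]) auto
  have inj: "inj_on (\<Phi> t) (ball 0 R2)" if t: "t \<in> {0..S}" for t
  proof (rule inj_onI)
    fix x y assume xy: "x \<in> ball 0 R2" "y \<in> ball 0 R2" "\<Phi> t x = \<Phi> t y"
    have "\<Phi> 0 x = \<Phi> 0 y"
      by (rule solution_backward_unique[where v = v and S = S and t = t and L = L and K = ?K])
         (use flowv xy inK t L lipv in auto)
    then show "x = y" by (simp add: init)
  qed
  have pv: "p t x (v x) = v (\<Phi> t x)" if x: "x \<in> ball 0 R2" and t: "t \<in> {0..S}" for x t
  proof -
    \<comment> \<open>Both \<open>p t x (v x)\<close> and \<open>v (\<Phi> t x)\<close> solve the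
      linearized equation, and both start at \<open>v x\<close>.\<close>
    have "norm (p t x (v x) - v (\<Phi> t x)) \<le> (norm (p 0 x (v x) - v (\<Phi> 0 x)) + 0 * t) * exp (L * t)"
    proof (rule gronwall_norm[of S "\<lambda>t. p t x (v x) - v (\<Phi> t x)" "\<lambda>t. Dv (\<Phi> t x) (p t x (v x)) - Dv (\<Phi> t x) (v (\<Phi> t x))"])
      fix t assume t: "t \<in> {0..S}"
      have "((v \<circ> (\<lambda>t. \<Phi> t x)) has_derivative (blinfun_apply (Dv (\<Phi> t x)) \<circ> (\<lambda>h. h *\<^sub>R v (\<Phi> t x)))) (at t within {0..S})"
        using flowv[OF x t] unfolding has_vector_derivative_def
        by (intro diff_chain_within has_derivative_at_withinI[OF dv])
      then have "((\<lambda>t. v (\<Phi> t x)) has_vector_derivative Dv (\<Phi> t x) (v (\<Phi> t x))) (at t within {0..S})"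
        by (simp add: has_vector_derivative_def o_def blinfun.scaleR_right)
      then show "((\<lambda>t. p t x (v x) - v (\<Phi> t x)) has_vector_derivative Dv (\<Phi> t x) (p t x (v x)) - Dv (\<Phi> t x) (v (\<Phi> t x))) (at t within {0..S})"
        by (intro has_vector_derivative_diff p x t)
      have "norm (Dv (\<Phi> t x) (p t x (v x) - v (\<Phi> t x))) \<le> norm (Dv (\<Phi> t x)) * norm (p t x (v x) - v (\<Phi> t x))"
        by (rule norm_blinfun)
      also have "\<dots> \<le> L * norm (p t x (v x) - v (\<Phi> t x))" using DL inK[OF x t] by (intro mult_right_mono) auto
      finally show "norm (Dv (\<Phi> t x) (p t x (v x)) - Dv (\<Phi> t x) (v (\<Phi> t x))) \<le> L * norm (p t x (v x) - v (\<Phi> t x)) + 0"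
        by (simp add: blinfun.diff_right)
    qed (use L t in auto)
    then show ?thesis by (simp add: p(2)[OF x] init)
  qed
  show ?thesis by (rule that[OF init inK flowv c p inj pv])
qed

section \<open>Tonelli's theorem for continuous integrands\<close>

lemma ennreal_integral_eq_nn_integral:
  fixes f :: "real \<Rightarrow> real"
  assumes f: "continuous_on {a..b} f" and nn: "\<And>t. t \<in> {a..b} \<Longrightarrow> 0 \<le> f t"
  shows "ennreal (integral {a..b} f) = (\<integral>\<^sup>+t\<in>{a..b}. ennreal (f t) \<partial>lborel)"
proof -
  have "((\<lambda>t. indicator {a..b} t *\<^sub>R f t) has_integral integral {a..b} f) UNIV"
    using integrable_integral[OF integrable_continuous_real[OF f]]
    by (subst (asm) has_integral_restrict_UNIV[symmetric]) (simp add: indicator_def of_bool_def if_distrib if_distribR cong: if_cong)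
  moreover have "(\<lambda>t. indicator {a..b} t *\<^sub>R f t) \<in> borel_measurable borel"
    by (intro borel_measurable_continuous_on_indicator f) auto
  ultimately have "(\<integral>\<^sup>+t. ennreal (indicator {a..b} t *\<^sub>R f t) \<partial>lborel) = ennreal (integral {a..b} f)"
    using nn by (intro nn_integral_has_integral_lborel) (auto simp: indicator_def)
  moreover have "(\<integral>\<^sup>+t. ennreal (indicator {a..b} t *\<^sub>R f t) \<partial>lborel) = (\<integral>\<^sup>+t\<in>{a..b}. ennreal (f t) \<partial>lborel)"
    by (intro nn_integral_cong) (auto simp: indicator_def)
  ultimately show ?thesis by simp
qed

lemma borel_measurable_continuous_on_Times:
  fixes F :: "'a::euclidean_space \<Rightarrow> 'b::euclidean_space \<Rightarrow> real"
  assumes F: "continuous_on (A \<times> B) (\<lambda>(t, x). F t x)" and A: "A \<in> sets borel" and B: "B \<in> sets borel"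
  shows "(\<lambda>(t, x). ennreal (F t x) * indicator A t * indicator B x) \<in> borel_measurable (lborel \<Otimes>\<^sub>M lborel)"
proof -
  have AB: "A \<times> B \<in> sets borel" unfolding borel_prod[symmetric] using A B by (intro pair_measureI)
  have "(\<lambda>z. indicator (A \<times> B) z *\<^sub>R (case z of (t, x) \<Rightarrow> F t x)) \<in> borel_measurable borel"
    by (rule borel_measurable_continuous_on_indicator[OF AB F])
  then have "(\<lambda>z. ennreal (indicator (A \<times> B) z *\<^sub>R (case z of (t, x) \<Rightarrow> F t x))) \<in> borel_measurable (lborel \<Otimes>\<^sub>M lborel)"
    by (simp add: lborel_prod)
  also have "(\<lambda>z. ennreal (indicator (A \<times> B) z *\<^sub>R (case z of (t, x) \<Rightarrow> F t x)))
      = (\<lambda>(t, x). ennreal (F t x) * indicator A t * indicator B x)"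
    by (auto simp: fun_eq_iff indicator_def)
  finally show ?thesis .
qed

lemma nn_integral_swap_continuous_on:
  fixes F :: "'a::euclidean_space \<Rightarrow> 'b::euclidean_space \<Rightarrow> real"
  assumes F: "continuous_on (A \<times> B) (\<lambda>(t, x). F t x)" and A: "A \<in> sets borel" and B: "B \<in> sets borel"
  shows "(\<integral>\<^sup>+x\<in>B. (\<integral>\<^sup>+t\<in>A. ennreal (F t x) \<partial>lborel) \<partial>lborel)
       = (\<integral>\<^sup>+t\<in>A. (\<integral>\<^sup>+x\<in>B. ennreal (F t x) \<partial>lborel) \<partial>lborel)"
    and "(\<lambda>x. (\<integral>\<^sup>+t\<in>A. ennreal (F t x) \<partial>lborel) * indicator B x) \<in> borel_measurable lborel"
proof -
  note M = borel_measurable_continuous_on_Times[OF assms]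
  have B': "(\<integral>\<^sup>+t\<in>A. ennreal (F t x) \<partial>lborel) * indicator B x = (\<integral>\<^sup>+t. ennreal (F t x) * indicator A t * indicator B x \<partial>lborel)" for x
    by (auto simp: indicator_def)
  have "(\<integral>\<^sup>+x\<in>B. (\<integral>\<^sup>+t\<in>A. ennreal (F t x) \<partial>lborel) \<partial>lborel)
      = (\<integral>\<^sup>+t. (\<integral>\<^sup>+x. ennreal (F t x) * indicator A t * indicator B x \<partial>lborel) \<partial>lborel)"
    unfolding B' by (rule lborel_pair.Fubini'[OF M])
  also have "\<dots> = (\<integral>\<^sup>+t\<in>A. (\<integral>\<^sup>+x\<in>B. ennreal (F t x) \<partial>lborel) \<partial>lborel)"
    by (intro nn_integral_cong) (auto simp: indicator_def)
  finally show "(\<integral>\<^sup>+x\<in>B. (\<integral>\<^sup>+t\<in>A. ennreal (F t x) \<partial>lborel) \<partial>lborel)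
       = (\<integral>\<^sup>+t\<in>A. (\<integral>\<^sup>+x\<in>B. ennreal (F t x) \<partial>lborel) \<partial>lborel)" .
  have "(\<lambda>(x, t). ennreal (F t x) * indicator A t * indicator B x) \<in> borel_measurable (lborel \<Otimes>\<^sub>M lborel)"
    using measurable_pair_swap[OF M] by simp
  then show "(\<lambda>x. (\<integral>\<^sup>+t\<in>A. ennreal (F t x) \<partial>lborel) * indicator B x) \<in> borel_measurable lborel"
    unfolding B' by (rule lborel.borel_measurable_nn_integral)
qed

section \<open>Integration of the linearized flow over the starting points\<close>

context plane
begin

text \<open>By \<open>pv\<close> and \<open>dt_wedge\<close>, the transversal component at time
  \<open>t\<close> is the Jacobian times \<open>perp (v x) \<bullet> u\<close>. The change of
  variables \<open>y = \<Phi> t x\<close> uses up the Jacobian, so its size never matters. What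
  remains is the initial speed \<open>norm (v x)\<close>, which may be large; the weight \<psi>
  keeps the product below \<open>M\<close>.\<close>

lemma flow_average_variation:
  fixes v :: "'a \<Rightarrow> 'a" and Dv :: "'a \<Rightarrow> 'a \<Rightarrow>\<^sub>L 'a"
    and \<Phi> :: "real \<Rightarrow> 'a \<Rightarrow> 'a" and p :: "real \<Rightarrow> 'a \<Rightarrow> 'a \<Rightarrow> 'a"
  assumes dv: "\<And>x. (v has_derivative blinfun_apply (Dv x)) (at x)" and cD: "continuous_on UNIV Dv"
    and nz: "\<And>x. v x \<noteq> 0"
    and cN: "continuous_on UNIV N" and N0: "\<And>x. 0 \<le> N x"
    and DvN: "\<And>x. norm (Dv x) \<le> N x * (norm (v x))\<^sup>2"
    and c: "0 < c" "\<And>x. x \<in> cball 0 R3 \<Longrightarrow> c \<le> norm (v x)"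
    and S: "0 \<le> S" and R: "R1 < R2" "R2 \<le> R3" "0 \<le> R1"
    and init: "\<And>x. \<Phi> 0 x = x"
    and inR3: "\<And>x t. x \<in> ball 0 R2 \<Longrightarrow> t \<in> {0..S} \<Longrightarrow> norm (\<Phi> t x) \<le> R3"
    and flow: "\<And>x t. x \<in> ball 0 R2 \<Longrightarrow> t \<in> {0..S} \<Longrightarrow> ((\<lambda>t. \<Phi> t x) has_vector_derivative v (\<Phi> t x)) (at t within {0..S})"
    and c\<Phi>: "continuous_on ({0..S} \<times> UNIV) (\<lambda>(t, x). \<Phi> t x)"
    and d\<Phi>: "\<And>x t. x \<in> ball 0 R2 \<Longrightarrow> t \<in> {0..S} \<Longrightarrow> (\<Phi> t has_derivative p t x) (at x)"
    and p0: "\<And>x u. x \<in> ball 0 R2 \<Longrightarrow> p 0 x u = u"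
    and dp: "\<And>x u t. x \<in> ball 0 R2 \<Longrightarrow> t \<in> {0..S} \<Longrightarrow>
        ((\<lambda>t. p t x u) has_vector_derivative Dv (\<Phi> t x) (p t x u)) (at t within {0..S})"
    and cp: "\<And>u C. compact C \<Longrightarrow> C \<subseteq> ball 0 R2 \<Longrightarrow> continuous_on ({0..S} \<times> C) (\<lambda>(t, x). p t x u)"
    and inj: "\<And>t. t \<in> {0..S} \<Longrightarrow> inj_on (\<Phi> t) (ball 0 R2)"
    and pv: "\<And>x t. x \<in> ball 0 R2 \<Longrightarrow> t \<in> {0..S} \<Longrightarrow> p t x (v x) = v (\<Phi> t x)"
    and c\<psi>: "continuous_on UNIV \<psi>" and \<psi>: "\<And>x. 0 \<le> \<psi> x" "\<And>x. \<psi> x \<le> 1"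
    and \<psi>v: "\<And>x. x \<in> cball 0 R1 \<Longrightarrow> \<psi> x * norm (v x) \<le> M"
    and t01: "0 \<le> t0" "t0 \<le> t1" "t1 \<le> S"
  shows "(\<integral>\<^sup>+x\<in>cball 0 R1. ennreal (\<psi> x * norm (integral {t0..t1} (\<lambda>t. p t x u))) \<partial>lborel)
    \<le> ennreal (norm u) * (ennreal (3 * R3 / c) * emeasure lborel (cball (0::'a) R1)
       + ennreal (S * M) * (\<integral>\<^sup>+y\<in>cball 0 R3. ennreal (6 * R3 * N y + 1 / norm (v y)) \<partial>lborel))"
proof -
  have R3: "0 \<le> R3" using R by linarith
  have sub: "cball 0 R1 \<subseteq> ball (0::'a) R2" using R by auto
  define \<beta> where "\<beta> t x = \<bar>perp (v (\<Phi> t x)) \<bullet> p t x u\<bar>" for t x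
  \<comment> \<open>Collects what multiplies \<beta> in \<open>norm_integral_variation_le\<close>
    with radius \<open>R3\<close>: \<open>3 * R3\<close> times \<open>2 * N\<close> from the change
    of the tangential coefficient, and the reciprocal speed from the transversal part.\<close>
  define H where "H y = 6 * R3 * N y + 1 / norm (v y)" for y
  have cv: "continuous_on UNIV v" using dv by (meson continuous_at_imp_continuous_on has_derivative_continuous)
  have cH: "continuous_on UNIV H" unfolding H_def by (intro continuous_intros cN cv) (use nz in auto)
  have H0: "0 \<le> H y" for y using N0 R3 by (simp add: H_def)
  have c\<Phi>': "continuous_on ({0..S} \<times> cball 0 R1) (\<lambda>(t, x). \<Phi> t x)"
    by (rule continuous_on_subset[OF c\<Phi>]) auto
  have cv\<Phi>: "continuous_on ({0..S} \<times> cball 0 R1) (\<lambda>z. v (\<Phi> (fst z) (snd z)))"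
    using continuous_on_compose2[OF cv c\<Phi>'] by (auto simp: split_beta)
  have c\<beta>: "continuous_on ({0..S} \<times> cball 0 R1) (\<lambda>(t, x). \<beta> t x)"
    using cp[OF _ sub, of u] linear_continuous_on_compose[OF cv\<Phi> perp_linear]
    unfolding \<beta>_def split_beta by (intro continuous_intros) auto
  have cH\<Phi>: "continuous_on ({0..S} \<times> cball 0 R1) (\<lambda>(t, x). H (\<Phi> t x))"
    using continuous_on_compose2[OF cH c\<Phi>'] by (auto simp: split_beta)
  define K where "K t x = \<psi> x * \<beta> t x * H (\<Phi> t x)" for t x
  have K0: "0 \<le> K t x" for t x using H0 \<psi> by (simp add: K_def \<beta>_def)
  have c\<psi>': "continuous_on ({0..S} \<times> cball 0 R1) (\<lambda>z. \<psi> (snd z))"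
    by (rule continuous_on_compose2[OF c\<psi>]) (auto intro!: continuous_intros)
  have cK: "continuous_on ({0..S} \<times> cball 0 R1) (\<lambda>(t, x). K t x)"
    using c\<psi>' c\<beta> cH\<Phi> unfolding K_def split_beta by (intro continuous_intros)
  have slice: "continuous_on {0..S} (\<lambda>t. g t x)"
    if "continuous_on ({0..S} \<times> cball 0 R1) (\<lambda>(t, x). g t x)" "x \<in> cball 0 R1" for g :: "real \<Rightarrow> 'a \<Rightarrow> 'c::topological_space" and x
    using continuous_on_compose2[OF that(1), of "{0..S}" "\<lambda>t. (t, x)"] that(2) by (force intro!: continuous_intros)
  have pt: "ennreal (\<psi> x * norm (integral {t0..t1} (\<lambda>t. p t x u)))
      \<le> ennreal (3 * R3 / c * norm u) + (\<integral>\<^sup>+t\<in>{0..S}. ennreal (K t x) \<partial>lborel)" if x: "x \<in> cball 0 R1" for x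
  proof -
    have xb: "x \<in> ball 0 R2" using x sub by auto
    let ?w = "\<lambda>t. v (\<Phi> t x)"
    have c\<Phi>x: "continuous_on {0..S} (\<lambda>t. \<Phi> t x)" by (rule slice[OF c\<Phi>' x])
    have c1: "continuous_on {0..S} (\<lambda>t. N (\<Phi> t x))" by (rule continuous_on_compose2[OF cN c\<Phi>x]) auto
    have c2: "continuous_on {0..S} (\<lambda>t. Dv (\<Phi> t x))" by (rule continuous_on_compose2[OF cD c\<Phi>x]) auto
    have c3: "continuous_on {0..S} (\<lambda>t. \<beta> t x)" by (rule slice[OF c\<beta> x])
    have c4: "continuous_on {0..S} ?w" by (rule continuous_on_compose2[OF cv c\<Phi>x]) auto
    have "norm (integral {t0..t1} (\<lambda>t. p t x u)) \<le>
       3 * R3 * (norm (p 0 x u) / norm (?w 0) + integral {0..S} (\<lambda>t. 2 * \<bar>perp (?w t) \<bullet> p t x u\<bar> * N (\<Phi> t x)))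
       + integral {0..S} (\<lambda>t. \<bar>perp (?w t) \<bullet> p t x u\<bar> / norm (?w t))"
    proof (rule norm_integral_variation_le[where A = "\<lambda>t. Dv (\<Phi> t x)"])
      show "(?w has_vector_derivative Dv (\<Phi> t x) (?w t)) (at t within {0..S})" if t: "t \<in> {0..S}" for t
      proof -
        have "((\<lambda>t. p t x (v x)) has_vector_derivative Dv (\<Phi> t x) (?w t)) (at t within {0..S})"
          using dp[OF xb t, of "v x"] pv[OF xb t] by simp
        then show ?thesis
          by (rule has_vector_derivative_transform[rotated 2]) (use t pv xb in auto)
      qed
    qed (use flow[OF xb] dp[OF xb] nz DvN c1 c2 inR3[OF xb] t01 in auto)
    also have "\<dots> = 3 * R3 * (norm u / norm (v x)) + integral {0..S} (\<lambda>t. \<beta> t x * H (\<Phi> t x))"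
    proof -
      have "integral {0..S} (\<lambda>t. \<beta> t x * H (\<Phi> t x))
          = integral {0..S} (\<lambda>t. 3 * R3 * (2 * \<beta> t x * N (\<Phi> t x)) + \<beta> t x / norm (?w t))"
        by (intro integral_cong) (simp add: H_def algebra_simps)
      also have "\<dots> = integral {0..S} (\<lambda>t. 3 * R3 * (2 * \<beta> t x * N (\<Phi> t x))) + integral {0..S} (\<lambda>t. \<beta> t x / norm (?w t))"
        by (intro integral_add integrable_continuous_real continuous_intros c1 c3 c4) (use nz in auto)
      finally have "integral {0..S} (\<lambda>t. \<beta> t x * H (\<Phi> t x))
          = 3 * R3 * integral {0..S} (\<lambda>t. 2 * \<beta> t x * N (\<Phi> t x)) + integral {0..S} (\<lambda>t. \<beta> t x / norm (?w t))"
        unfolding integral_mult_right .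
      then show ?thesis by (simp only: \<beta>_def p0[OF xb] init distrib_left add.assoc)
    qed
    also have "3 * R3 * (norm u / norm (v x)) \<le> 3 * R3 * (norm u / c)"
      using c(2)[of x] x R R3 c(1) by (intro mult_left_mono divide_left_mono) (auto intro!: mult_pos_pos simp: nz)
    finally have b: "norm (integral {t0..t1} (\<lambda>t. p t x u)) \<le> 3 * R3 * (norm u / c) + integral {0..S} (\<lambda>t. \<beta> t x * H (\<Phi> t x))"
      by simp
    have "\<psi> x * norm (integral {t0..t1} (\<lambda>t. p t x u)) \<le> \<psi> x * (3 * R3 * (norm u / c)) + \<psi> x * integral {0..S} (\<lambda>t. \<beta> t x * H (\<Phi> t x))"
      using mult_left_mono[OF b \<psi>(1)[of x]] by (simp add: distrib_left)
    also have "\<psi> x * (3 * R3 * (norm u / c)) \<le> 1 * (3 * R3 * (norm u / c))"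
      using \<psi>(2) R3 c(1) by (intro mult_right_mono) auto
    also have "\<psi> x * integral {0..S} (\<lambda>t. \<beta> t x * H (\<Phi> t x)) = integral {0..S} (\<lambda>t. K t x)"
      by (simp add: K_def mult.assoc)
    finally have "ennreal (\<psi> x * norm (integral {t0..t1} (\<lambda>t. p t x u))) \<le> ennreal (3 * R3 / c * norm u + integral {0..S} (\<lambda>t. K t x))"
      by (intro ennreal_leI) simp
    also have "\<dots> = ennreal (3 * R3 / c * norm u) + ennreal (integral {0..S} (\<lambda>t. K t x))"
      using R3 c(1) K0 by (intro ennreal_plus integral_nonneg integrable_continuous_real slice[OF cK x]) auto
    also have "ennreal (integral {0..S} (\<lambda>t. K t x)) = (\<integral>\<^sup>+t\<in>{0..S}. ennreal (K t x) \<partial>lborel)"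
      by (intro ennreal_integral_eq_nn_integral slice[OF cK x] K0)
    finally show ?thesis .
  qed
  have time_slice: "(\<integral>\<^sup>+x\<in>cball 0 R1. ennreal (K t x) \<partial>lborel) \<le> ennreal (M * norm u) * (\<integral>\<^sup>+y\<in>cball 0 R3. ennreal (H y) \<partial>lborel)"
    if t: "t \<in> {0..S}" for t
  proof -
    have M0: "0 \<le> M" using \<psi>v[of 0] \<psi>(1)[of 0] R by (auto intro: order_trans[rotated])
    have "(\<integral>\<^sup>+x\<in>cball 0 R1. ennreal (K t x) \<partial>lborel) \<le> (\<integral>\<^sup>+x\<in>cball 0 R1. ennreal (\<bar>dt (p t x)\<bar> * (M * norm u * H (\<Phi> t x))) \<partial>lborel)"
    proof (intro nn_integral_mono)
      fix x
      have "ennreal (K t x) \<le> ennreal (\<bar>dt (p t x)\<bar> * (M * norm u * H (\<Phi> t x)))" if x: "x \<in> cball 0 R1"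
      proof -
        have xb: "x \<in> ball 0 R2" using x sub by auto
        have "linear (p t x)" using d\<Phi>[OF xb t] by (rule has_derivative_linear)
        then have "\<beta> t x = \<bar>dt (p t x)\<bar> * \<bar>perp (v x) \<bullet> u\<bar>"
          unfolding \<beta>_def pv[OF xb t, symmetric] by (simp add: dt_wedge abs_mult)
        also have "\<dots> \<le> \<bar>dt (p t x)\<bar> * (norm (v x) * norm u)"
          using Cauchy_Schwarz_ineq2[of "perp (v x)" u] by (intro mult_left_mono) (auto simp: norm_perp)
        finally have "\<psi> x * \<beta> t x \<le> \<psi> x * (\<bar>dt (p t x)\<bar> * (norm (v x) * norm u))" using \<psi> by (intro mult_left_mono)
        also have "\<dots> = (\<psi> x * norm (v x)) * norm u * \<bar>dt (p t x)\<bar>" by (simp only: mult_ac)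
        also have "\<dots> \<le> M * norm u * \<bar>dt (p t x)\<bar>" using \<psi>v[OF x] by (intro mult_right_mono) auto
        finally have "K t x \<le> M * norm u * \<bar>dt (p t x)\<bar> * H (\<Phi> t x)" unfolding K_def using H0 by (intro mult_right_mono)
        then show ?thesis by (intro ennreal_leI) (simp only: mult_ac)
      qed
      then show "ennreal (K t x) * indicator (cball 0 R1) x \<le> ennreal (\<bar>dt (p t x)\<bar> * (M * norm u * H (\<Phi> t x))) * indicator (cball 0 R1) x"
        by (cases "x \<in> cball 0 R1") (auto simp: indicator_def)
    qed
    also have "\<dots> \<le> (\<integral>\<^sup>+y\<in>\<Phi> t ` cball 0 R1. ennreal (M * norm u * H y) \<partial>lborel)"
    proof (rule change_of_variables)
      show "inj_on (\<Phi> t) (cball 0 R1)" using inj[OF t] sub by (rule inj_on_subset)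
      show "(\<Phi> t has_derivative p t x) (at x within cball 0 R1)" if "x \<in> cball 0 R1" for x
        by (rule has_derivative_at_withinI[OF d\<Phi>[OF subsetD[OF sub that] t]])
    qed (use cH H0 M0 in \<open>auto intro!: continuous_intros\<close>)
    also have "\<dots> \<le> (\<integral>\<^sup>+y\<in>cball 0 R3. ennreal (M * norm u * H y) \<partial>lborel)"
      using inR3[OF _ t] sub by (intro nn_integral_mono) (auto simp: indicator_def subset_iff)
    also have "\<dots> = ennreal (M * norm u) * (\<integral>\<^sup>+y\<in>cball 0 R3. ennreal (H y) \<partial>lborel)"
    proof -
      have "(\<lambda>y. ennreal (H y) * indicator (cball 0 R3) y) \<in> borel_measurable lborel"
        using borel_measurable_continuous_onI[OF cH]
        by (intro borel_measurable_times_ennreal borel_measurable_indicator) auto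
      from nn_integral_cmult[OF this, of "ennreal (M * norm u)"] show ?thesis
        using M0 H0 by (simp add: ennreal_mult mult.assoc)
    qed
    finally show ?thesis .
  qed
  have mI: "(\<lambda>x. (\<integral>\<^sup>+t\<in>{0..S}. ennreal (K t x) \<partial>lborel) * indicator (cball 0 R1) x) \<in> borel_measurable lborel"
    by (intro nn_integral_swap_continuous_on(2) cK) auto
  have "(\<integral>\<^sup>+x\<in>cball 0 R1. ennreal (\<psi> x * norm (integral {t0..t1} (\<lambda>t. p t x u))) \<partial>lborel)
     \<le> (\<integral>\<^sup>+x\<in>cball 0 R1. (ennreal (3 * R3 / c * norm u) + (\<integral>\<^sup>+t\<in>{0..S}. ennreal (K t x) \<partial>lborel)) \<partial>lborel)"
    using pt by (intro nn_integral_mono) (auto simp: indicator_def)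
  also have "\<dots> = ennreal (3 * R3 / c * norm u) * emeasure lborel (cball (0::'a) R1) + (\<integral>\<^sup>+x\<in>cball 0 R1. (\<integral>\<^sup>+t\<in>{0..S}. ennreal (K t x) \<partial>lborel) \<partial>lborel)"
    unfolding distrib_right using mI by (subst nn_integral_add) (auto simp: nn_integral_cmult_indicator intro!: borel_measurable_times_ennreal borel_measurable_indicator)
  also have "(\<integral>\<^sup>+x\<in>cball 0 R1. (\<integral>\<^sup>+t\<in>{0..S}. ennreal (K t x) \<partial>lborel) \<partial>lborel)
      = (\<integral>\<^sup>+t\<in>{0..S}. (\<integral>\<^sup>+x\<in>cball 0 R1. ennreal (K t x) \<partial>lborel) \<partial>lborel)"
    by (intro nn_integral_swap_continuous_on(1) cK) auto
  also have "\<dots> \<le> (\<integral>\<^sup>+t\<in>{0..S}. (ennreal (M * norm u) * (\<integral>\<^sup>+y\<in>cball 0 R3. ennreal (H y) \<partial>lborel)) \<partial>lborel)"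
    using time_slice by (intro nn_integral_mono) (auto simp: indicator_def)
  also have "\<dots> = ennreal (M * norm u) * (\<integral>\<^sup>+y\<in>cball 0 R3. ennreal (H y) \<partial>lborel) * ennreal S"
    using S by (subst nn_integral_cmult_indicator) auto
  finally have fin: "(\<integral>\<^sup>+x\<in>cball 0 R1. ennreal (\<psi> x * norm (integral {t0..t1} (\<lambda>t. p t x u))) \<partial>lborel)
    \<le> ennreal (3 * R3 / c * norm u) * emeasure lborel (cball (0::'a) R1) + ennreal (M * norm u) * (\<integral>\<^sup>+y\<in>cball 0 R3. ennreal (H y) \<partial>lborel) * ennreal S"
    by (simp add: add_left_mono)
  have M0: "0 \<le> M" using \<psi>v[of 0] \<psi>(1)[of 0] R by (auto intro: order_trans[rotated])
  have e1: "ennreal (3 * R3 / c * norm u) = ennreal (norm u) * ennreal (3 * R3 / c)"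
    using R3 c(1) by (simp add: mult.commute flip: ennreal_mult)
  have e2: "ennreal (M * norm u) * x * ennreal S = ennreal (norm u) * (ennreal (S * M) * x)" for x
    using M0 S by (simp add: ennreal_mult mult_ac)
  show ?thesis using fin unfolding e1 e2 by (simp add: H_def distrib_left mult.assoc)
qed

end

subsection \<open>The accelerated field\<close>

lemma DERIV_max_0_power2: "((\<lambda>s::real. (max 0 s)\<^sup>2) has_real_derivative 2 * max 0 s) (at s)"
proof -
  consider "s < 0" | "s = 0" | "s > 0" by linarith
  then show ?thesis
  proof cases
    case 1
    have "((\<lambda>s::real. 0) has_real_derivative 0) (at s)" by simp
    then have "((\<lambda>s::real. (max 0 s)\<^sup>2) has_real_derivative 0) (at s)"
      by (rule has_field_derivative_transform_within_open[where S = "{..<0}"]) (use 1 in auto)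
    then show ?thesis using 1 by simp
  next
    case 3
    have "((\<lambda>s::real. s\<^sup>2) has_real_derivative 2 * s) (at s)" by (auto intro!: derivative_eq_intros)
    then have "((\<lambda>s::real. (max 0 s)\<^sup>2) has_real_derivative 2 * s) (at s)"
      by (rule has_field_derivative_transform_within_open[where S = "{0<..}"]) (use 3 in auto)
    then show ?thesis using 3 by simp
  next
    case 2
    have "((\<lambda>h. ((max 0 h)\<^sup>2 - (max 0 0)\<^sup>2) / (h - 0)) \<longlongrightarrow> 0) (at (0::real))"
    proof (rule Lim_null_comparison)
      show "\<forall>\<^sub>F h in at (0::real). norm (((max 0 h)\<^sup>2 - (max 0 0)\<^sup>2) / (h - 0)) \<le> norm h"
        by (auto simp: eventually_at_filter max_def power2_eq_square)
      show "((\<lambda>h::real. norm h) \<longlongrightarrow> 0) (at 0)" by (intro tendsto_eq_intros refl) auto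
    qed
    then show ?thesis using 2 by (simp add: has_field_derivative_iff)
  qed
qed

text \<open>Squared positive parts are continuously differentiable. Nesting two of them gives an
  explicit transition from \<open>1\<close> on \<open>s \<le> 1\<close> to \<open>0\<close> on
  \<open>s \<ge> 2\<close> with an elementary derivative bound.\<close>

definition cutoff :: "real \<Rightarrow> real" where
  "cutoff s = (max 0 (1 - (max 0 (s - 1))\<^sup>2))\<^sup>2"

definition cutoff' :: "real \<Rightarrow> real" where
  "cutoff' s = - 4 * max 0 (1 - (max 0 (s - 1))\<^sup>2) * max 0 (s - 1)"

lemma DERIV_cutoff: "(cutoff has_real_derivative cutoff' s) (at s)"
proof -
  have 1: "((\<lambda>s. s - 1) has_real_derivative 1) (at s)" by (auto intro!: derivative_eq_intros)
  have 2: "((\<lambda>s. (max 0 (s - 1))\<^sup>2) has_real_derivative 2 * max 0 (s - 1)) (at s)"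
    using DERIV_chain'[OF 1 DERIV_max_0_power2] by simp
  have 3: "((\<lambda>s. 1 - (max 0 (s - 1))\<^sup>2) has_real_derivative - (2 * max 0 (s - 1))) (at s)"
    using DERIV_diff[OF DERIV_const 2] by simp
  show ?thesis
    using DERIV_chain'[OF 3 DERIV_max_0_power2] unfolding cutoff_def[abs_def] cutoff'_def by (simp add: mult_ac)
qed

lemma continuous_cutoff': "continuous_on UNIV cutoff'"
  unfolding cutoff'_def by (intro continuous_intros)

lemma cutoff_bounds: "0 \<le> cutoff s" "cutoff s \<le> 1"
  by (auto simp: cutoff_def power_le_one)

lemma cutoff_eq_1: "s \<le> 1 \<Longrightarrow> cutoff s = 1"
  by (simp add: cutoff_def)

lemma cutoff_eq_0: assumes "2 \<le> s" shows "cutoff s = 0"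
proof -
  have "1 \<le> (s - 1)\<^sup>2" using assms by (simp add: one_le_power)
  then show ?thesis using assms by (simp add: cutoff_def)
qed

lemma cutoff'_bound: "\<bar>cutoff' s\<bar> \<le> 4"
proof (cases "1 \<le> s \<and> s \<le> 2")
  case True
  then have "(s - 1)\<^sup>2 \<le> 1" by (simp add: power_le_one)
  then have "(1 - (s - 1)\<^sup>2) * (s - 1) \<le> 1 * 1" using True by (intro mult_mono) auto
  moreover have "0 \<le> (1 - (s - 1)\<^sup>2) * (s - 1)" using True \<open>(s - 1)\<^sup>2 \<le> 1\<close> by (intro mult_nonneg_nonneg) auto
  moreover have "cutoff' s = - (4 * ((1 - (s - 1)\<^sup>2) * (s - 1)))"
    using True \<open>(s - 1)\<^sup>2 \<le> 1\<close> by (simp add: cutoff'_def) (simp add: algebra_simps)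
  ultimately show ?thesis by linarith
next
  case False
  show ?thesis
  proof (cases "s < 1")
    case True then show ?thesis by (simp add: cutoff'_def)
  next
    case False
    with \<open>\<not> (1 \<le> s \<and> s \<le> 2)\<close> have "1 \<le> (s - 1)\<^sup>2" by (simp add: one_le_power)
    then show ?thesis using False by (simp add: cutoff'_def)
  qed
qed

text \<open>\<open>b / |b|\<^sup>2\<close> is \<open>b\<close> followed by the inversion in the unit sphere, which is conformal with factor
  \<open>1 / |b|\<^sup>2\<close>. This is why the derivative of the accelerated field is controlled by that of \<open>b\<close> relative to
  the square of its speed, down to speed \<open>0\<close>.\<close>

lemma accelerated_field:
  fixes b :: "'a::euclidean_space \<Rightarrow> 'a" and Db :: "'a \<Rightarrow> 'a \<Rightarrow>\<^sub>L 'a"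
  assumes db: "\<And>x. (b has_derivative blinfun_apply (Db x)) (at x)" and cD: "continuous_on UNIV Db"
    and nz: "\<And>x. b x \<noteq> 0" and \<epsilon>: "0 < \<epsilon>"
  defines "v \<equiv> \<lambda>x. (1 + \<epsilon>\<^sup>2 / (norm (b x))\<^sup>2) *\<^sub>R b x"
  obtains Dv :: "'a \<Rightarrow> 'a \<Rightarrow>\<^sub>L 'a" where
    "\<And>x. (v has_derivative blinfun_apply (Dv x)) (at x)"
    "continuous_on UNIV Dv"
    "\<And>x. norm (Dv x) \<le> norm (Db x) / \<epsilon>\<^sup>2 * (norm (v x))\<^sup>2"
    "\<And>x. norm (v x) = norm (b x) + \<epsilon>\<^sup>2 / norm (b x)"
    "\<And>x. 2 * \<epsilon> \<le> norm (v x)"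
proof -
  define l where "l x = 1 + \<epsilon>\<^sup>2 / (b x \<bullet> b x)" for x
  have vl: "v x = l x *\<^sub>R b x" for x by (simp add: v_def l_def power2_norm_eq_inner)
  have bb: "0 < b x \<bullet> b x" for x using nz by simp
  have l0: "1 \<le> l x" for x using bb[of x] by (simp add: l_def)
  define Dv :: "'a \<Rightarrow> 'a \<Rightarrow>\<^sub>L 'a" where
    "Dv x = l x *\<^sub>R Db x - (2 * \<epsilon>\<^sup>2 / (b x \<bullet> b x)\<^sup>2) *\<^sub>R (blinfun_scaleR_left (b x) o\<^sub>L (blinfun_inner_right (b x) o\<^sub>L Db x))" for x
  have Dv: "blinfun_apply (Dv x) u = l x *\<^sub>R Db x u - (2 * \<epsilon>\<^sup>2 * (b x \<bullet> Db x u) / (b x \<bullet> b x)\<^sup>2) *\<^sub>R b x" for x u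
    by (simp add: Dv_def blinfun.diff_left blinfun.scaleR_left)
  have cb: "continuous_on UNIV b" using db by (meson continuous_at_imp_continuous_on has_derivative_continuous)
  have cl: "continuous_on UNIV l" unfolding l_def by (intro continuous_intros cb) (use nz in auto)
  have "continuous_on UNIV (\<lambda>x. blinfun_scaleR_left (b x))" "continuous_on UNIV (\<lambda>x. blinfun_inner_right (b x))"
    by (intro bounded_linear.continuous_on[OF bounded_linear_blinfun_scaleR_left] bounded_linear.continuous_on[OF bounded_linear_blinfun_inner_right] cb)+
  then have cDv: "continuous_on UNIV Dv"
    unfolding Dv_def
    by (intro continuous_intros cl cb cD bounded_bilinear.continuous_on[OF bounded_bilinear_blinfun_compose]) (use nz in auto)
  have dv: "(v has_derivative blinfun_apply (Dv x)) (at x)" for x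
  proof -
    have d1: "((\<lambda>x. b x \<bullet> b x) has_derivative (\<lambda>u. 2 * (b x \<bullet> Db x u))) (at x)"
      using has_derivative_inner[OF db db, of x] by (simp add: inner_commute)
    have d2: "(l has_derivative (\<lambda>u. - (2 * \<epsilon>\<^sup>2 * (b x \<bullet> Db x u) / (b x \<bullet> b x)\<^sup>2))) (at x)"
      unfolding l_def
      by (rule has_derivative_eq_rhs[OF has_derivative_add[OF has_derivative_const has_derivative_divide'[OF has_derivative_const d1]]])
         (use bb[of x] in \<open>auto simp: fun_eq_iff power2_eq_square\<close>)
    have "((\<lambda>x. l x *\<^sub>R b x) has_derivative (\<lambda>u. l x *\<^sub>R Db x u + (- (2 * \<epsilon>\<^sup>2 * (b x \<bullet> Db x u) / (b x \<bullet> b x)\<^sup>2)) *\<^sub>R b x)) (at x)"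
      by (rule has_derivative_scaleR[OF d2 db])
    moreover have "v = (\<lambda>x. l x *\<^sub>R b x)" by (simp add: fun_eq_iff vl)
    moreover have "blinfun_apply (Dv x) = (\<lambda>u. l x *\<^sub>R Db x u + (- (2 * \<epsilon>\<^sup>2 * (b x \<bullet> Db x u) / (b x \<bullet> b x)\<^sup>2)) *\<^sub>R b x)"
      by (simp add: fun_eq_iff Dv)
    ultimately show ?thesis by simp
  qed
  have nv: "norm (v x) = l x * norm (b x)" for x using l0[of x] by (simp add: vl)
  have nv': "norm (v x) = norm (b x) + \<epsilon>\<^sup>2 / norm (b x)" for x
    using nz[of x] by (simp add: nv l_def distrib_right power2_eq_square flip: power2_norm_eq_inner)
  have lower: "2 * \<epsilon> \<le> norm (v x)" for x
  proof -
    have n: "norm (b x) > 0" using nz by simp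
    have "0 \<le> (norm (b x) - \<epsilon>)\<^sup>2" by simp
    then have "2 * \<epsilon> * norm (b x) \<le> (norm (b x))\<^sup>2 + \<epsilon>\<^sup>2" by (simp add: power2_diff mult_ac)
    then show ?thesis unfolding nv' using n by (simp add: field_simps power2_eq_square)
  qed
  have bound: "norm (Dv x) \<le> norm (Db x) / \<epsilon>\<^sup>2 * (norm (v x))\<^sup>2" for x
  proof (rule norm_blinfun_bound)
    fix u
    let ?w = "Db x u" and ?y = "b x"
    \<comment> \<open>This is the reflection of \<open>?w\<close> in the hyperplane orthogonal to
      \<open>?y\<close>. The derivative of the accelerated field is thus \<open>?w\<close> plus a
      multiple of an isometric image of \<open>?w\<close>, and its norm is at most
      \<open>l x\<close> times that of \<open>?w\<close>.\<close>
    have refl: "norm (?w - (2 * (?y \<bullet> ?w) / (?y \<bullet> ?y)) *\<^sub>R ?y) = norm ?w"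
    proof -
      have "(norm (?w - (2 * (?y \<bullet> ?w) / (?y \<bullet> ?y)) *\<^sub>R ?y))\<^sup>2 = (norm ?w)\<^sup>2"
        unfolding power2_norm_eq_inner using bb[of x]
        by (simp add: inner_diff_left inner_diff_right inner_commute field_simps power2_eq_square)
      then show ?thesis by simp
    qed
    have "Dv x u = ?w + (\<epsilon>\<^sup>2 / (?y \<bullet> ?y)) *\<^sub>R (?w - (2 * (?y \<bullet> ?w) / (?y \<bullet> ?y)) *\<^sub>R ?y)"
      using bb[of x] by (simp add: Dv l_def algebra_simps power2_eq_square)
    also have "norm \<dots> \<le> norm ?w + \<epsilon>\<^sup>2 / (?y \<bullet> ?y) * norm ?w"
      using bb[of x] by (intro norm_triangle_le) (simp add: refl)
    also have "\<dots> = l x * norm ?w" by (simp add: l_def algebra_simps)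
    also have "\<dots> \<le> (norm (v x))\<^sup>2 / \<epsilon>\<^sup>2 * norm ?w"
    proof (rule mult_right_mono)
      \<comment> \<open>\<open>l x * (?y \<bullet> ?y)\<close> is the squared speed plus the square
        of \<epsilon>, hence at least the latter even at slow points.\<close>
      have "l x * \<epsilon>\<^sup>2 \<le> l x * (l x * (?y \<bullet> ?y))"
        using l0[of x] bb[of x] by (intro mult_left_mono) (simp_all add: l_def distrib_right)
      also have "\<dots> = (norm (v x))\<^sup>2" by (simp add: nv power_mult_distrib power2_norm_eq_inner) (simp add: power2_eq_square mult_ac)
      finally show "l x \<le> (norm (v x))\<^sup>2 / \<epsilon>\<^sup>2" using \<epsilon> by (simp add: divide_simps)
    qed simp
    also have "\<dots> \<le> (norm (v x))\<^sup>2 / \<epsilon>\<^sup>2 * (norm (Db x) * norm u)"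
      by (intro mult_left_mono norm_blinfun) simp
    finally show "norm (Dv x u) \<le> norm (Db x) / \<epsilon>\<^sup>2 * (norm (v x))\<^sup>2 * norm u" by (simp add: mult_ac)
  qed simp
  show ?thesis by (rule that[OF dv cDv bound nv' lower])
qed

section \<open>Increments in L^1 and comparison of trajectories\<close>

lemma add_mem_cball_0:
  fixes x :: "'a::real_normed_vector"
  assumes "x \<in> cball 0 R0" "s \<in> {0..1}" "R0 + norm h \<le> R1"
  shows "x + s *\<^sub>R h \<in> cball 0 R1"
proof -
  have "norm (x + s *\<^sub>R h) \<le> norm x + \<bar>s\<bar> * norm h" using norm_triangle_ineq[of x "s *\<^sub>R h"] by simp
  also have "\<dots> \<le> norm x + 1 * norm h" using assms by (intro add_left_mono mult_right_mono) auto
  finally show ?thesis using assms by simp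
qed

lemma borel_measurable_ennreal_indicator:
  fixes G :: "'a::euclidean_space \<Rightarrow> real"
  assumes "continuous_on A G" "A \<in> sets borel"
  shows "(\<lambda>x. ennreal (G x) * indicator A x) \<in> borel_measurable borel"
proof -
  have "(\<lambda>x. ennreal (indicator A x *\<^sub>R G x)) \<in> borel_measurable borel"
    using borel_measurable_continuous_on_indicator[OF assms(2,1)] by simp
  also have "(\<lambda>x. ennreal (indicator A x *\<^sub>R G x)) = (\<lambda>x. ennreal (G x) * indicator A x)"
    by (auto simp: indicator_def fun_eq_iff)
  finally show ?thesis .
qed

lemma nn_integral_translate_le:
  fixes G :: "'a::euclidean_space \<Rightarrow> real"
  assumes G: "continuous_on (cball 0 R1) G" and s: "s \<in> {0..1}" and R: "R0 + norm h \<le> R1"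
  shows "(\<integral>\<^sup>+x\<in>cball 0 R0. ennreal (G (x + s *\<^sub>R h)) \<partial>lborel) \<le> (\<integral>\<^sup>+x\<in>cball 0 R1. ennreal (G x) \<partial>lborel)"
proof -
  have "(\<integral>\<^sup>+x\<in>cball 0 R0. ennreal (G (x + s *\<^sub>R h)) \<partial>lborel) \<le> (\<integral>\<^sup>+x. ennreal (G (s *\<^sub>R h + x)) * indicator (cball 0 R1) (s *\<^sub>R h + x) \<partial>lborel)"
    using add_mem_cball_0[OF _ s R] by (intro nn_integral_mono) (auto simp: indicator_def add.commute)
  also have "\<dots> = (\<integral>\<^sup>+x. ennreal (G x) * indicator (cball 0 R1) x \<partial>distr lborel borel (\<lambda>x. s *\<^sub>R h + x))"
    by (subst nn_integral_distr) (auto intro: borel_measurable_ennreal_indicator[OF G])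
  also have "\<dots> = (\<integral>\<^sup>+x\<in>cball 0 R1. ennreal (G x) \<partial>lborel)" by (simp add: lborel_distr_plus)
  finally show ?thesis .
qed

text \<open>The fundamental theorem of calculus along the segment from \<open>x\<close> to
  \<open>x + h\<close>, then Tonelli and translation; enlarging the ball by \<open>norm h\<close>
  keeps the segments inside. \<open>DZ\<close> is the derivative in direction \<open>h\<close> and
  already carries the size of \<open>h\<close>.\<close>

lemma nn_integral_increment_le:
  fixes Z :: "'a::euclidean_space \<Rightarrow> 'b::euclidean_space"
  assumes d: "\<And>x s. x \<in> cball 0 R0 \<Longrightarrow> s \<in> {0..1} \<Longrightarrow>
       ((\<lambda>s. Z (x + s *\<^sub>R h)) has_vector_derivative DZ (x + s *\<^sub>R h)) (at s within {0..1})"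
    and G: "continuous_on (cball 0 R1) G" "\<And>x. x \<in> cball 0 R1 \<Longrightarrow> norm (DZ x) \<le> G x"
    and R: "R0 + norm h \<le> R1"
  shows "(\<integral>\<^sup>+x\<in>cball 0 R0. ennreal (norm (Z (x + h) - Z x)) \<partial>lborel) \<le> (\<integral>\<^sup>+x\<in>cball 0 R1. ennreal (G x) \<partial>lborel)"
proof -
  note inR1 = add_mem_cball_0[OF _ _ R]
  have G0: "0 \<le> G x" if "x \<in> cball 0 R1" for x using G(2)[OF that] norm_ge_zero order_trans by blast
  have cG: "continuous_on ({0..1} \<times> cball 0 R0) (\<lambda>(s, x). G (x + s *\<^sub>R h))"
    unfolding split_beta by (rule continuous_on_compose2[OF G(1)]) (use inR1 in \<open>auto intro!: continuous_intros\<close>)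
  have pt: "ennreal (norm (Z (x + h) - Z x)) \<le> (\<integral>\<^sup>+s\<in>{0..1}. ennreal (G (x + s *\<^sub>R h)) \<partial>lborel)" if x: "x \<in> cball 0 R0" for x
  proof -
    have cs: "continuous_on {0..1} (\<lambda>s. G (x + s *\<^sub>R h))"
      by (rule continuous_on_compose2[OF G(1)]) (use inR1 x in \<open>auto intro!: continuous_intros\<close>)
    have I: "((\<lambda>s. DZ (x + s *\<^sub>R h)) has_integral (Z (x + 1 *\<^sub>R h) - Z (x + 0 *\<^sub>R h))) {0..1}"
      by (intro fundamental_theorem_of_calculus d x) auto
    have "norm (Z (x + h) - Z x) = norm (integral {0..1} (\<lambda>s. DZ (x + s *\<^sub>R h)))"
      using integral_unique[OF I] by simp
    also have "\<dots> \<le> integral {0..1} (\<lambda>s. G (x + s *\<^sub>R h))"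
      using G(2)[OF inR1[OF x]]
      by (intro integral_norm_bound_integral[OF has_integral_integrable[OF I] integrable_continuous_real[OF cs]]) auto
    finally have "ennreal (norm (Z (x + h) - Z x)) \<le> ennreal (integral {0..1} (\<lambda>s. G (x + s *\<^sub>R h)))" by (rule ennreal_leI)
    also have "\<dots> = (\<integral>\<^sup>+s\<in>{0..1}. ennreal (G (x + s *\<^sub>R h)) \<partial>lborel)"
      by (rule ennreal_integral_eq_nn_integral[OF cs]) (use G0 inR1 x in auto)
    finally show ?thesis .
  qed
  have "(\<integral>\<^sup>+x\<in>cball 0 R0. ennreal (norm (Z (x + h) - Z x)) \<partial>lborel)
      \<le> (\<integral>\<^sup>+x\<in>cball 0 R0. (\<integral>\<^sup>+s\<in>{0..1}. ennreal (G (x + s *\<^sub>R h)) \<partial>lborel) \<partial>lborel)"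
    using pt by (intro nn_integral_mono) (auto simp: indicator_def)
  also have "\<dots> = (\<integral>\<^sup>+s\<in>{0..1}. (\<integral>\<^sup>+x\<in>cball 0 R0. ennreal (G (x + s *\<^sub>R h)) \<partial>lborel) \<partial>lborel)"
    by (rule nn_integral_swap_continuous_on(1)[OF cG]) auto
  also have "\<dots> \<le> (\<integral>\<^sup>+s\<in>{0..1::real}. (\<integral>\<^sup>+x\<in>cball 0 R1. ennreal (G x) \<partial>lborel) \<partial>lborel)"
    using nn_integral_translate_le[OF G(1) _ R] by (intro nn_integral_mono) (auto simp: indicator_def)
  also have "\<dots> = (\<integral>\<^sup>+x\<in>cball 0 R1. ennreal (G x) \<partial>lborel)"
    by (subst nn_integral_cmult_indicator) auto
  finally show ?thesis .
qed

text \<open>The logarithm of \<open>norm (w t)\<close> has a derivative bounded by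
  \<open>h t\<close>. It is meant for \<open>w t = b (X t)\<close>, which solves the equation
  linearized along \<open>X\<close>: the speed is then controlled from both sides by the time
  integral of the derivative of \<open>b\<close>.\<close>

lemma norm_along_linear_flow:
  fixes w :: "real \<Rightarrow> 'a::real_inner"
  assumes w: "\<And>t. t \<in> {0..T} \<Longrightarrow> (w has_vector_derivative A t (w t)) (at t within {0..T})"
    and Ah: "\<And>t. t \<in> {0..T} \<Longrightarrow> norm (A t (w t)) \<le> h t * norm (w t)"
    and nz: "\<And>t. t \<in> {0..T} \<Longrightarrow> w t \<noteq> 0"
    and ch: "continuous_on {0..T} h" and h0: "\<And>t. t \<in> {0..T} \<Longrightarrow> 0 \<le> h t"
    and q: "integral {0..T} h \<le> q" and t: "t \<in> {0..T}"
  shows "norm (w 0) * exp (- q) \<le> norm (w t)" "norm (w t) \<le> norm (w 0) * exp q"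
proof -
  define f where "f t = ln (w t \<bullet> w t)" for t
  define f' where "f' t = 2 * (w t \<bullet> A t (w t)) / (w t \<bullet> w t)" for t
  have df: "(f has_real_derivative f' s) (at s within {0..T})" if s: "s \<in> {0..T}" for s
  proof -
    have d: "((\<lambda>t. w t \<bullet> w t) has_real_derivative 2 * (w s \<bullet> A s (w s))) (at s within {0..T})"
      using w[OF s] unfolding has_vector_derivative_def has_field_derivative_def
      by (auto intro!: derivative_eq_intros simp: inner_commute mult_ac)
    have "0 < w s \<bullet> w s" using nz[OF s] by simp
    from DERIV_chain'[OF d DERIV_ln_divide[OF this]] show ?thesis
      unfolding f_def f'_def by (simp add: divide_inverse mult_ac)
  qed
  have b: "\<bar>f' s\<bar> \<le> 2 * h s" if s: "s \<in> {0..T}" for s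
  proof -
    have n: "norm (w s) > 0" using nz[OF s] by simp
    have "\<bar>w s \<bullet> A s (w s)\<bar> \<le> norm (w s) * (h s * norm (w s))"
      by (rule order_trans[OF Cauchy_Schwarz_ineq2]) (intro mult_left_mono Ah s, simp)
    then show ?thesis
      unfolding f'_def using n by (simp add: abs_mult divide_simps power2_eq_square mult_ac flip: power2_norm_eq_inner)
  qed
  have I: "(f' has_integral (f t - f 0)) {0..t}"
    using t by (intro fundamental_theorem_of_calculus)
      (auto simp flip: has_real_derivative_iff_has_vector_derivative intro!: DERIV_subset[OF df])
  have ih: "(\<lambda>s. 2 * h s) integrable_on {0..T}" by (intro integrable_continuous_real continuous_intros ch)
  have "\<bar>f t - f 0\<bar> \<le> integral {0..t} (\<lambda>s. 2 * h s)"
    unfolding integral_unique[OF I, symmetric] real_norm_def[symmetric]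
    using I t b by (intro integral_norm_bound_integral integrable_on_subinterval[OF ih]) auto
  also have "\<dots> \<le> integral {0..T} (\<lambda>s. 2 * h s)"
    using t h0 by (intro integral_subset_le integrable_on_subinterval[OF ih] ih) auto
  also have "\<dots> \<le> 2 * q" using q by simp
  finally have *: "\<bar>f t - f 0\<bar> \<le> 2 * q" .
  have fn: "f s = 2 * ln (norm (w s))" if "s \<in> {0..T}" for s
    using nz[OF that] by (simp add: f_def ln_realpow flip: power2_norm_eq_inner)
  have z: "0 \<in> {0..T}" using t by auto
  have p: "norm (w 0) > 0" "norm (w t) > 0" using nz[OF t] nz[OF z] by auto
  have l: "ln (norm (w 0)) - q \<le> ln (norm (w t))" "ln (norm (w t)) \<le> ln (norm (w 0)) + q"
    using * unfolding fn[OF t] fn[OF z] by auto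
  show "norm (w 0) * exp (- q) \<le> norm (w t)"
    using exp_le_cancel_iff[THEN iffD2, OF l(1)] p by (simp add: exp_diff exp_minus divide_inverse)
  show "norm (w t) \<le> norm (w 0) * exp q"
    using exp_le_cancel_iff[THEN iffD2, OF l(2)] p by (simp add: exp_add)
qed

text \<open>With \<open>l\<close> the ratio of the two speeds along \<open>X\<close>, the clock
  \<sigma> running at rate \<open>1 / l\<close> makes \<open>y (\<sigma> s)\<close> a solution of
  \<open>z' = v z / l\<close>, which \<open>X\<close> solves as well; hence
  \<open>y (\<sigma> s) = X s\<close>. As long as the speed is at least \<kappa>, the clock lags
  behind by at most \<omega>. The restriction \<open>t \<le> T - \<omega>\<close> ensures that it
  reaches \<open>t\<close> within time \<open>T\<close>.\<close>

lemma time_change_comparison: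
  fixes b v :: "'a::euclidean_space \<Rightarrow> 'a"
  assumes v: "\<And>x. v x = (1 + \<epsilon>\<^sup>2 / (norm (b x))\<^sup>2) *\<^sub>R b x"
    and X: "\<And>t. t \<in> {0..T} \<Longrightarrow> (X has_vector_derivative b (X t)) (at t within {0..T})"
    and y: "\<And>t. t \<in> {0..T} \<Longrightarrow> (y has_vector_derivative v (y t)) (at t within {0..T})"
    and init: "X 0 = y 0"
    and K: "\<And>t. t \<in> {0..T} \<Longrightarrow> X t \<in> K \<and> y t \<in> K"
    and lip: "\<And>x z. x \<in> K \<Longrightarrow> z \<in> K \<Longrightarrow> norm (v x - v z) \<le> L * norm (x - z)" and L: "0 \<le> L"
    and cb: "continuous_on UNIV b"
    and bM: "\<And>x. norm (b x) \<le> M"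
    and \<kappa>: "0 < \<kappa>" "\<And>t. t \<in> {0..T} \<Longrightarrow> \<kappa> \<le> norm (b (X t))"
    and \<omega>: "T * (\<epsilon>\<^sup>2 / \<kappa>\<^sup>2) \<le> \<omega>" and T: "0 \<le> T" and t: "0 \<le> t" "t \<le> T - \<omega>"
  shows "norm (y t - X t) \<le> M * \<omega>"
proof -
  define l where "l s = 1 + \<epsilon>\<^sup>2 / (norm (b (X s)))\<^sup>2" for s
  define \<sigma> where "\<sigma> s = integral {0..s} (\<lambda>r. inverse (l r))" for s
  have "0 \<le> \<epsilon>\<^sup>2 / \<kappa>\<^sup>2" by simp
  have \<omega>0: "0 \<le> \<omega>" using order_trans[OF mult_nonneg_nonneg[OF T \<open>0 \<le> \<epsilon>\<^sup>2 / \<kappa>\<^sup>2\<close>] \<omega>] .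
  have cX: "continuous_on {0..T} X" using X by (meson continuous_on_eq_continuous_within has_vector_derivative_continuous)
  have nzb: "norm (b (X s)) > 0" if "s \<in> {0..T}" for s using \<kappa>(2)[OF that] \<kappa>(1) by linarith
  have l1: "1 \<le> l s" for s by (simp add: l_def)
  have l2: "l s \<le> 1 + \<epsilon>\<^sup>2 / \<kappa>\<^sup>2" if s: "s \<in> {0..T}" for s
    unfolding l_def using \<kappa>(2)[OF s] \<kappa>(1) nzb[OF s] by (intro add_left_mono divide_left_mono power_mono mult_pos_pos) auto
  have cbX: "continuous_on {0..T} (\<lambda>s. b (X s))" by (rule continuous_on_compose2[OF cb cX]) auto
  have cl: "continuous_on {0..T} (\<lambda>r. inverse (l r))"
  proof (rule continuous_on_inverse)
    show "continuous_on {0..T} l" unfolding l_def by (intro continuous_intros cbX) (use nzb in force)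
    show "\<forall>r\<in>{0..T}. l r \<noteq> 0" using l1 by (metis not_one_le_zero)
  qed
  have il: "(\<lambda>r. inverse (l r)) integrable_on {0..s}" if "s \<in> {0..T}" for s
    using that by (intro integrable_continuous_real continuous_on_subset[OF cl]) auto
  have d\<sigma>: "(\<sigma> has_vector_derivative inverse (l s)) (at s within {0..T})" if "s \<in> {0..T}" for s
    unfolding \<sigma>_def by (intro integral_has_vector_derivative cl that)
  have inv_le: "inverse (l r) \<le> 1" for r using l1[of r] by (simp add: inverse_le_1_iff)
  have inv_ge: "1 - \<epsilon>\<^sup>2 / \<kappa>\<^sup>2 \<le> inverse (l r)" if r: "r \<in> {0..T}" for r
  proof -
    have "(1 - \<epsilon>\<^sup>2 / \<kappa>\<^sup>2) * l r \<le> 1"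
    proof (cases "1 - \<epsilon>\<^sup>2 / \<kappa>\<^sup>2 \<le> 0")
      case True then have "(1 - \<epsilon>\<^sup>2 / \<kappa>\<^sup>2) * l r \<le> 0" using l1[of r] by (intro mult_nonpos_nonneg) auto
      then show ?thesis by simp
    next
      case False
      then have "(1 - \<epsilon>\<^sup>2 / \<kappa>\<^sup>2) * l r \<le> (1 - \<epsilon>\<^sup>2 / \<kappa>\<^sup>2) * (1 + \<epsilon>\<^sup>2 / \<kappa>\<^sup>2)" using l2[OF r] by (intro mult_left_mono) auto
      also have "\<dots> \<le> 1" by (simp add: algebra_simps)
      finally show ?thesis .
    qed
    then show ?thesis using l1[of r] by (simp add: divide_simps inverse_eq_divide)
  qed
  have \<sigma>_le: "\<sigma> s \<le> s" if s: "s \<in> {0..T}" for s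
  proof -
    have "\<sigma> s \<le> integral {0..s} (\<lambda>_. 1)" unfolding \<sigma>_def by (intro integral_le il s inv_le) auto
    then show ?thesis using s by simp
  qed
  have \<sigma>_ge: "s - \<omega> \<le> \<sigma> s" if s: "s \<in> {0..T}" for s
  proof -
    have "integral {0..s} (\<lambda>_. 1 - \<epsilon>\<^sup>2 / \<kappa>\<^sup>2) \<le> \<sigma> s" unfolding \<sigma>_def using s by (intro integral_le il inv_ge) auto
    moreover have "s * (\<epsilon>\<^sup>2 / \<kappa>\<^sup>2) \<le> \<omega>"
      using s by (intro order_trans[OF mult_right_mono[OF _ \<open>0 \<le> \<epsilon>\<^sup>2 / \<kappa>\<^sup>2\<close>] \<omega>]) auto
    ultimately show ?thesis using s by (simp add: algebra_simps)
  qed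
  have \<sigma>0: "\<sigma> 0 = 0" by (simp add: \<sigma>_def)
  have \<sigma>_nn: "0 \<le> \<sigma> s" if "s \<in> {0..T}" for s
    unfolding \<sigma>_def using order_trans[OF zero_le_one l1] by (intro integral_nonneg il that) simp
  have \<sigma>_in: "\<sigma> s \<in> {0..T}" if s: "s \<in> {0..T}" for s using \<sigma>_nn[OF s] \<sigma>_le[OF s] s by auto
  have eq: "y (\<sigma> s) = X s" if s: "s \<in> {0..T}" for s
  proof -
    have "norm (y (\<sigma> s) - X s) \<le> norm (y (\<sigma> 0) - X 0) * exp (L * s)"
    proof (rule solution_distance[where S = T and f = "\<lambda>s. y (\<sigma> s)" and g = X and v = v and c = "\<lambda>s. inverse (l s)" and K = K])
      fix r assume r: "r \<in> {0..T}"
      have "(y has_vector_derivative v (y (\<sigma> r))) (at (\<sigma> r) within \<sigma> ` {0..T})"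
        using \<sigma>_in by (intro has_vector_derivative_within_subset[OF y[OF \<sigma>_in[OF r]]]) auto
      from vector_diff_chain_within[OF d\<sigma>[OF r] this]
      show "((\<lambda>s. y (\<sigma> s)) has_vector_derivative inverse (l r) *\<^sub>R v (y (\<sigma> r))) (at r within {0..T})" by (simp add: o_def)
      have "inverse (l r) *\<^sub>R v (X r) = b (X r)"
        using l1[of r] by (simp add: v l_def[symmetric])
      then show "(X has_vector_derivative inverse (l r) *\<^sub>R v (X r)) (at r within {0..T})" using X[OF r] by simp
      show "y (\<sigma> r) \<in> K \<and> X r \<in> K" using K[OF r] K[OF \<sigma>_in[OF r]] by simp
      show "\<bar>inverse (l r)\<bar> \<le> 1" using inv_le[of r] l1[of r] by simp
    qed (use lip L s in auto)
    then show ?thesis by (simp add: \<sigma>0 init)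
  qed
  have c\<sigma>: "continuous_on {0..T} \<sigma>" using d\<sigma> by (meson continuous_on_eq_continuous_within has_vector_derivative_continuous)
  have "\<exists>s\<ge>0. s \<le> T \<and> \<sigma> s = t"
    using \<sigma>0 \<sigma>_ge[of T] T t c\<sigma> by (intro IVT') auto
  then obtain s where s: "s \<in> {0..T}" "\<sigma> s = t" by auto
  have tT: "t \<in> {0..T}" using t \<omega>0 by auto
  have "norm (X s - X t) \<le> M * norm (s - t)"
  proof (rule differentiable_bound[of "{0..T}" X "\<lambda>r h. h *\<^sub>R b (X r)"])
    show "(X has_derivative (\<lambda>h. h *\<^sub>R b (X r))) (at r within {0..T})" if "r \<in> {0..T}" for r
      using X[OF that] by (simp add: has_vector_derivative_def)
    show "onorm (\<lambda>h. h *\<^sub>R b (X r)) \<le> M" for r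
      using bM[of "X r"] by (intro onorm_le) (simp add: mult.commute[of M] mult_left_mono)
  qed (use s tT in auto)
  also have "\<dots> \<le> M * \<omega>"
    using \<sigma>_le[OF s(1)] \<sigma>_ge[OF s(1)] s(2) order_trans[OF norm_ge_zero bM]
    by (intro mult_left_mono) auto
  finally show ?thesis using eq[OF s(1)] s(2) by simp
qed

lemma interval_average_norm_le:
  fixes f :: "real \<Rightarrow> 'a::euclidean_space"
  assumes c: "continuous_on {t0..t1} f" and t: "t0 < t1"
    and b: "\<And>t. t \<in> {t0..t1} \<Longrightarrow> norm (f t - a) \<le> d"
  shows "norm ((1 / (t1 - t0)) *\<^sub>R integral {t0..t1} f - a) \<le> d"
proof -
  have "integral {t0..t1} (\<lambda>t. f t - a) = integral {t0..t1} f - (t1 - t0) *\<^sub>R a"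
    using t by (subst integral_diff) (auto intro!: integrable_continuous_real c)
  then have "(1 / (t1 - t0)) *\<^sub>R integral {t0..t1} f - a = (1 / (t1 - t0)) *\<^sub>R integral {t0..t1} (\<lambda>t. f t - a)"
    using t by (simp add: scaleR_diff_right)
  also have "norm \<dots> = norm (integral {t0..t1} (\<lambda>t. f t - a)) / (t1 - t0)" using t by simp
  also have "norm (integral {t0..t1} (\<lambda>t. f t - a)) \<le> integral {t0..t1} (\<lambda>_. d)"
    by (intro integral_norm_bound_integral integrable_continuous_real continuous_intros c b)
  also have "\<dots> = d * (t1 - t0)" using t by simp
  finally show ?thesis using t by (simp add: divide_right_mono)
qed

lemma nn_integral_affine:
  fixes f g :: "'a \<Rightarrow> ennreal"
  assumes [measurable]: "f \<in> borel_measurable M" "g \<in> borel_measurable M" "A \<in> sets M"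
  shows "(\<integral>\<^sup>+x. c * indicator A x + a * f x + d * g x \<partial>M) = c * emeasure M A + a * integral\<^sup>N M f + d * integral\<^sup>N M g"
proof -
  have "(\<integral>\<^sup>+x. c * indicator A x + a * f x + d * g x \<partial>M) = (\<integral>\<^sup>+x. c * indicator A x + a * f x \<partial>M) + (\<integral>\<^sup>+x. d * g x \<partial>M)"
    by (rule nn_integral_add) measurable
  also have "(\<integral>\<^sup>+x. c * indicator A x + a * f x \<partial>M) = (\<integral>\<^sup>+x. c * indicator A x \<partial>M) + (\<integral>\<^sup>+x. a * f x \<partial>M)"
    by (rule nn_integral_add) measurable
  finally show ?thesis by (simp add: nn_integral_cmult nn_integral_cmult_indicator)
qed

context plane
begin

text \<open>\<open>Z\<close> interpolates between the identity at slow starting points and the time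
  average of the accelerated flow at fast ones. Its derivative has three sources: two copies of
  \<open>h\<close> (\<open>2 * V\<close>); the derivative of \<psi>, at most
  \<open>16 * M / \<kappa>\<^sup>2\<close> times that of \<open>b\<close>, times a displacement of
  at most \<open>2 * R3\<close>; and the derivative of the average, from
  \<open>flow_average_variation\<close> with minimal speed \<open>2 * \<epsilon>\<close>. Of the
  field \<open>b\<close>, only \<open>M\<close> and \<open>I\<close> enter the bound, so it is
  uniform over a family of fields.\<close>

lemma averaged_flow_variation:
  fixes b :: "'a \<Rightarrow> 'a" and Db :: "'a \<Rightarrow> 'a \<Rightarrow>\<^sub>L 'a"
  assumes db: "\<And>x. (b has_derivative blinfun_apply (Db x)) (at x)" and cD: "continuous_on UNIV Db"
    and nz: "\<And>x. b x \<noteq> 0" and bM: "\<And>x. norm (b x) \<le> M"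
    and I: "(\<integral>\<^sup>+x\<in>cball 0 R3. ennreal (norm (Db x)) \<partial>lborel) \<le> ennreal I" "0 \<le> I"
    and \<epsilon>: "0 < \<epsilon>" and \<kappa>: "0 < \<kappa>" "2 * \<epsilon>\<^sup>2 \<le> \<kappa>"
    and S: "0 \<le> S" and R: "0 \<le> R1" "R1 < R2" "R2 + (M + 1) * S \<le> R3"
    and far: "\<And>x. R2 \<le> norm x \<Longrightarrow> norm x \<le> R3 \<Longrightarrow> \<epsilon>\<^sup>2 \<le> norm (b x)"
  defines "v \<equiv> \<lambda>x. (1 + \<epsilon>\<^sup>2 / (norm (b x))\<^sup>2) *\<^sub>R b x"
    and "\<psi> \<equiv> \<lambda>x. 1 - cutoff (2 * (norm (b x))\<^sup>2 / \<kappa>\<^sup>2)"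
    and "V \<equiv> measure lborel (cball (0::'a) R3)"
  obtains \<Phi> :: "real \<Rightarrow> 'a \<Rightarrow> 'a" and L :: real where
    "\<And>x. \<Phi> 0 x = x"
    "\<And>x t. x \<in> ball 0 R2 \<Longrightarrow> t \<in> {0..S} \<Longrightarrow> norm (\<Phi> t x) \<le> R3"
    "\<And>x t. x \<in> ball 0 R2 \<Longrightarrow> t \<in> {0..S} \<Longrightarrow> ((\<lambda>t. \<Phi> t x) has_vector_derivative v (\<Phi> t x)) (at t within {0..S})"
    "\<And>x z. x \<in> cball 0 R3 \<Longrightarrow> z \<in> cball 0 R3 \<Longrightarrow> norm (v x - v z) \<le> L * norm (x - z)" "0 \<le> L"
    "\<And>t0 t1. \<lbrakk>0 \<le> t0; t0 < t1; t1 \<le> S\<rbrakk> \<Longrightarrow>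
       continuous_on (cball 0 R1) (\<lambda>x. x + \<psi> x *\<^sub>R ((1 / (t1 - t0)) *\<^sub>R integral {t0..t1} (\<lambda>t. \<Phi> t x) - x))"
    "\<And>t0 t1 h R0 Z. \<lbrakk>0 \<le> t0; t0 < t1; t1 \<le> S; R0 + norm h \<le> R1;
       Z = (\<lambda>x. x + \<psi> x *\<^sub>R ((1 / (t1 - t0)) *\<^sub>R integral {t0..t1} (\<lambda>t. \<Phi> t x) - x))\<rbrakk> \<Longrightarrow>
       (\<integral>\<^sup>+x\<in>cball 0 R0. ennreal (norm (Z (x + h) - Z x)) \<partial>lborel) \<le>
       ennreal (norm h * (2 * V + 32 * M * R3 / \<kappa>\<^sup>2 * I
          + 1 / (t1 - t0) * (3 * R3 / (2 * \<epsilon>) * V + S * (M + 1) * (6 * R3 / \<epsilon>\<^sup>2 * I + V / (2 * \<epsilon>)))))"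
proof -
  have M0: "0 \<le> M" using order_trans[OF norm_ge_zero bM] .
  have "0 \<le> (M + 1) * S" using M0 S by simp
  then have R23: "R2 \<le> R3" using R(3) by linarith
  have R3: "0 \<le> R3" "R1 \<le> R3" using R R23 by auto
  obtain Dv where dv: "\<And>x. (v has_derivative blinfun_apply (Dv x)) (at x)"
    and cDv: "continuous_on UNIV Dv"
    and Dvb: "\<And>x. norm (Dv x) \<le> norm (Db x) / \<epsilon>\<^sup>2 * (norm (v x))\<^sup>2"
    and nv: "\<And>x. norm (v x) = norm (b x) + \<epsilon>\<^sup>2 / norm (b x)"
    and lv: "\<And>x. 2 * \<epsilon> \<le> norm (v x)"
    unfolding v_def by (rule accelerated_field[OF db cD nz \<epsilon>]) blast
  \<comment> \<open>In the shell the acceleration adds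
    \<open>\<epsilon>\<^sup>2 / norm (b x)\<close>, which \<open>far\<close> bounds by
    \<open>1\<close>.\<close>
  have speed: "norm (v x) \<le> M + 1" if "R2 \<le> norm x" "norm x \<le> R3" for x
    unfolding nv using far[OF that] bM[of x] nz[of x] by (intro add_mono) (auto simp: divide_simps)
  have R20: "0 < R2" using R by linarith
  have M10: "0 \<le> M + 1" using M0 by simp
  obtain \<Phi> p where F:
    "\<And>x. \<Phi> 0 x = x"
    "\<And>x t. x \<in> ball 0 R2 \<Longrightarrow> t \<in> {0..S} \<Longrightarrow> norm (\<Phi> t x) \<le> R3"
    "\<And>x t. x \<in> ball 0 R2 \<Longrightarrow> t \<in> {0..S} \<Longrightarrow> ((\<lambda>t. \<Phi> t x) has_vector_derivative v (\<Phi> t x)) (at t within {0..S})"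
    "continuous_on ({0..S} \<times> UNIV) (\<lambda>(t, x). \<Phi> t x)"
    "\<And>x t. x \<in> ball 0 R2 \<Longrightarrow> t \<in> {0..S} \<Longrightarrow> (\<Phi> t has_derivative p t x) (at x)"
    "\<And>x u. x \<in> ball 0 R2 \<Longrightarrow> p 0 x u = u"
    "\<And>x u t. x \<in> ball 0 R2 \<Longrightarrow> t \<in> {0..S} \<Longrightarrow>
        ((\<lambda>t. p t x u) has_vector_derivative Dv (\<Phi> t x) (p t x u)) (at t within {0..S})"
    "\<And>u C. compact C \<Longrightarrow> C \<subseteq> ball 0 R2 \<Longrightarrow> continuous_on ({0..S} \<times> C) (\<lambda>(t, x). p t x u)"
    "\<And>t. t \<in> {0..S} \<Longrightarrow> inj_on (\<Phi> t) (ball 0 R2)"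
    "\<And>x t. x \<in> ball 0 R2 \<Longrightarrow> t \<in> {0..S} \<Longrightarrow> p t x (v x) = v (\<Phi> t x)"
    by (rule C1_flow_on_ball[OF dv cDv speed M10 S R20 R(3)]; (assumption | (rule that; assumption)))
  obtain L where L: "0 < L" "\<And>x z. x \<in> cball 0 R3 \<Longrightarrow> z \<in> cball 0 R3 \<Longrightarrow> norm (v x - v z) \<le> L * norm (x - z)"
    by (rule C1_imp_lipschitz_on_cball[OF dv cDv]) (rule that; assumption)
  have cb: "continuous_on UNIV b" using db by (meson continuous_at_imp_continuous_on has_derivative_continuous)
  have sub: "cball 0 R1 \<subseteq> ball (0::'a) R2" using R by auto
  define A where "A t0 t1 x = (1 / (t1 - t0)) *\<^sub>R integral {t0..t1} (\<lambda>t. \<Phi> t x)" for t0 t1 x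
  define D\<psi> where "D\<psi> x u = - (cutoff' (2 * (norm (b x))\<^sup>2 / \<kappa>\<^sup>2) * (4 * (b x \<bullet> Db x u) / \<kappa>\<^sup>2))" for x u
  have d\<psi>: "(\<psi> has_derivative D\<psi> x) (at x)" for x
  proof -
    have "((\<lambda>x. 2 * (b x \<bullet> b x) / \<kappa>\<^sup>2) has_derivative (\<lambda>u. 4 * (b x \<bullet> Db x u) / \<kappa>\<^sup>2)) (at x)"
      using has_derivative_mult_right[OF has_derivative_inner[OF db db], of "2 / \<kappa>\<^sup>2" x]
      by (simp add: inner_commute)
    from has_derivative_compose[OF this DERIV_cutoff[unfolded has_field_derivative_def]]
    have "((\<lambda>x. cutoff (2 * (b x \<bullet> b x) / \<kappa>\<^sup>2)) has_derivative (\<lambda>u. cutoff' (2 * (b x \<bullet> b x) / \<kappa>\<^sup>2) * (4 * (b x \<bullet> Db x u) / \<kappa>\<^sup>2))) (at x)"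
      by simp
    from has_derivative_diff[OF has_derivative_const this] show ?thesis
      unfolding \<psi>_def D\<psi>_def power2_norm_eq_inner by simp
  qed
  have c\<psi>: "continuous_on UNIV \<psi>" using d\<psi> by (meson continuous_at_imp_continuous_on has_derivative_continuous)
  have \<psi>01: "0 \<le> \<psi> x" "\<psi> x \<le> 1" for x using cutoff_bounds by (auto simp: \<psi>_def)
  \<comment> \<open>Where \<psi> does not vanish, the speed is at least \<open>\<kappa> / 2\<close>,
    so acceleration adds at most \<open>2 * \<epsilon>\<^sup>2 / \<kappa>\<close>, hence at most
    \<open>1\<close>.\<close>
  have \<psi>v: "\<psi> x * norm (v x) \<le> M + 1" for x
  proof (cases "2 * (norm (b x))\<^sup>2 / \<kappa>\<^sup>2 \<le> 1")
    case True then show ?thesis using M0 by (simp add: \<psi>_def cutoff_eq_1)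
  next
    case False
    then have "\<kappa>\<^sup>2 < 2 * (norm (b x))\<^sup>2" using \<kappa> by (simp add: divide_simps)
    moreover have "(\<kappa> / 2)\<^sup>2 = \<kappa>\<^sup>2 / 4" by (simp add: power_divide)
    ultimately have "(\<kappa> / 2)\<^sup>2 \<le> (norm (b x))\<^sup>2" using zero_le_power2[of "norm (b x)"] by linarith
    then have "\<kappa> / 2 \<le> norm (b x)" by (rule power2_le_imp_le) simp
    then have "\<epsilon>\<^sup>2 / norm (b x) \<le> \<epsilon>\<^sup>2 / (\<kappa> / 2)" using \<kappa> nz[of x] by (intro divide_left_mono) auto
    also have "\<dots> \<le> 1" using \<kappa> by (simp add: divide_simps)
    finally have "norm (v x) \<le> M + 1" using bM[of x] by (simp add: nv)
    then have "\<psi> x * norm (v x) \<le> 1 * (M + 1)" using \<psi>01 by (intro mult_mono) auto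
    then show ?thesis by simp
  qed
  have D\<psi>b: "\<bar>D\<psi> x u\<bar> \<le> 16 * M / \<kappa>\<^sup>2 * norm (Db x) * norm u" for x u
  proof -
    have "\<bar>b x \<bullet> Db x u\<bar> \<le> norm (b x) * norm (Db x u)" by (rule Cauchy_Schwarz_ineq2)
    also have "\<dots> \<le> M * (norm (Db x) * norm u)" by (intro mult_mono bM norm_blinfun M0) auto
    finally have "\<bar>4 * (b x \<bullet> Db x u) / \<kappa>\<^sup>2\<bar> \<le> 4 * (M * (norm (Db x) * norm u)) / \<kappa>\<^sup>2"
      by (simp add: divide_right_mono)
    then have "\<bar>D\<psi> x u\<bar> \<le> 4 * (4 * (M * (norm (Db x) * norm u)) / \<kappa>\<^sup>2)"
      unfolding D\<psi>_def abs_minus_cancel abs_mult[of "cutoff' _"] using cutoff'_bound by (intro mult_mono) auto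
    then show ?thesis by (simp add: mult_ac)
  qed
  have csl: "continuous_on {0..S} (\<lambda>t. \<Phi> t x)" for x
    using continuous_on_compose2[OF F(4), of "{0..S}" "\<lambda>t. (t, x)"] by (force intro!: continuous_intros)
  have cA: "continuous_on (cball 0 R1) (A t0 t1)" if t: "0 \<le> t0" "t0 < t1" "t1 \<le> S" for t0 t1
  proof -
    have "continuous_on (cball 0 R1 \<times> cbox t0 t1) (\<lambda>z. \<Phi> (snd z) (fst z))"
      using t continuous_on_compose2[OF F(4), of "cball 0 R1 \<times> cbox t0 t1" "\<lambda>z. (snd z, fst z)"]
      by (force intro!: continuous_intros simp: split_beta)
    then have "continuous_on (cball 0 R1) (\<lambda>x. integral (cbox t0 t1) (\<lambda>t. \<Phi> t x))"
      by (intro integral_continuous_on_param) (simp add: split_beta)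
    then show ?thesis unfolding A_def by (intro continuous_intros) simp
  qed
  show ?thesis
  proof (rule that[of \<Phi> L])
    show "continuous_on (cball 0 R1) (\<lambda>x. x + \<psi> x *\<^sub>R ((1 / (t1 - t0)) *\<^sub>R integral {t0..t1} (\<lambda>t. \<Phi> t x) - x))"
      if t: "0 \<le> t0" "t0 < t1" "t1 \<le> S" for t0 t1
    proof -
      have "continuous_on (cball 0 R1) (\<lambda>x. x + \<psi> x *\<^sub>R (A t0 t1 x - x))"
        by (intro continuous_intros cA[OF t] continuous_on_subset[OF c\<psi>]) auto
      then show ?thesis unfolding A_def .
    qed
  next
    fix t0 t1 R0 :: real and h :: 'a and Z
    assume t: "0 \<le> t0" "t0 < t1" "t1 \<le> S" and R0: "R0 + norm h \<le> R1"
      and Z': "Z = (\<lambda>x. x + \<psi> x *\<^sub>R ((1 / (t1 - t0)) *\<^sub>R integral {t0..t1} (\<lambda>t. \<Phi> t x) - x))"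
    have Z: "Z = (\<lambda>x. x + \<psi> x *\<^sub>R (A t0 t1 x - x))" by (simp add: Z' A_def)
    define \<delta> where "\<delta> = t1 - t0"
    have \<delta>: "\<delta> > 0" using t by (simp add: \<delta>_def)
    define DA where "DA x = (1 / \<delta>) *\<^sub>R integral {t0..t1} (\<lambda>t. p t x h)" for x
    define DZ where "DZ x = h + (D\<psi> x h *\<^sub>R (A t0 t1 x - x) + \<psi> x *\<^sub>R (DA x - h))" for x
    define G where "G x = 2 * norm h + 32 * M * R3 / \<kappa>\<^sup>2 * norm h * norm (Db x)
      + 1 / \<delta> * (\<psi> x * norm (integral {t0..t1} (\<lambda>t. p t x h)))" for x
    have cp: "continuous_on ({0..S} \<times> cball 0 R1) (\<lambda>(t, x). p t x h)" by (rule F(8)) (use sub in auto)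
    have cDA: "continuous_on (cball 0 R1) (\<lambda>x. integral {t0..t1} (\<lambda>t. p t x h))"
    proof -
      have "continuous_on (cball 0 R1 \<times> cbox t0 t1) (\<lambda>z. p (snd z) (fst z) h)"
        using t continuous_on_compose2[OF cp, of "cball 0 R1 \<times> cbox t0 t1" "\<lambda>z. (snd z, fst z)"]
        by (force intro!: continuous_intros simp: split_beta)
      then have "continuous_on (cball 0 R1) (\<lambda>x. integral (cbox t0 t1) (\<lambda>t. p t x h))"
        by (intro integral_continuous_on_param) (simp add: split_beta)
      then show ?thesis by simp
    qed
    have cG: "continuous_on (cball 0 R1) G"
      unfolding G_def by (intro continuous_intros cDA continuous_on_subset[OF c\<psi>] continuous_on_subset[OF cD]) auto
    have GZ: "norm (DZ x) \<le> G x" if x: "x \<in> cball 0 R1" for x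
    proof -
      have xb: "x \<in> ball 0 R2" using x sub by auto
      have "norm (A t0 t1 x - 0) \<le> R3"
        unfolding A_def using t xb F(2)[OF xb]
        by (intro interval_average_norm_le continuous_on_subset[OF csl]) auto
      then have "norm (A t0 t1 x - x) \<le> 2 * R3"
        using norm_triangle_ineq4[of "A t0 t1 x" x] x R3 by simp
      then have 1: "norm (D\<psi> x h *\<^sub>R (A t0 t1 x - x)) \<le> 16 * M / \<kappa>\<^sup>2 * norm (Db x) * norm h * (2 * R3)"
        unfolding norm_scaleR using D\<psi>b M0 by (intro mult_mono) auto
      have "norm (\<psi> x *\<^sub>R (DA x - h)) \<le> \<psi> x * (norm (DA x) + norm h)"
        using \<psi>01(1)[of x] by (simp add: mult_left_mono norm_triangle_ineq4)
      also have "\<dots> \<le> \<psi> x * norm (DA x) + norm h"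
        using mult_right_mono[OF \<psi>01(2)[of x] norm_ge_zero[of h]] by (simp add: distrib_left)
      finally have 2: "norm (\<psi> x *\<^sub>R (DA x - h)) \<le> \<psi> x * norm (DA x) + norm h" .
      have "norm (DZ x) \<le> norm h + (norm (D\<psi> x h *\<^sub>R (A t0 t1 x - x)) + norm (\<psi> x *\<^sub>R (DA x - h)))"
        unfolding DZ_def by (intro norm_triangle_le add_left_mono norm_triangle_ineq)
      also have "\<dots> \<le> norm h + (16 * M / \<kappa>\<^sup>2 * norm (Db x) * norm h * (2 * R3) + (\<psi> x * norm (DA x) + norm h))"
        by (intro add_left_mono add_mono 1 2)
      also have "\<dots> = G x" using \<delta> by (simp add: G_def DA_def)
      finally show ?thesis .
    qed
    have dZ: "((\<lambda>s. Z (x + s *\<^sub>R h)) has_vector_derivative DZ (x + s *\<^sub>R h)) (at s within {0..1})"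
      if x: "x \<in> cball 0 R0" and s: "s \<in> {0..1}" for x s
    proof -
      note inR1 = add_mem_cball_0[OF x _ R0]
      have inb: "x + r *\<^sub>R h \<in> ball 0 R2" if "r \<in> {0..1}" for r using inR1[OF that] sub by auto
      have line: "((\<lambda>s. x + s *\<^sub>R h) has_derivative (\<lambda>r. r *\<^sub>R h)) (at s within T)" for s T
        by (auto intro!: derivative_eq_intros)
      have d1: "((\<lambda>s. x + s *\<^sub>R h) has_vector_derivative h) (at s within {0..1})"
        using line by (simp add: has_vector_derivative_def)
      have d2: "((\<lambda>s. \<psi> (x + s *\<^sub>R h)) has_real_derivative D\<psi> (x + s *\<^sub>R h) h) (at s within {0..1})"
      proof -
        have "((\<lambda>s. \<psi> (x + s *\<^sub>R h)) has_derivative (\<lambda>r. D\<psi> (x + s *\<^sub>R h) (r *\<^sub>R h))) (at s within {0..1})"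
          using has_derivative_compose[OF line d\<psi>] .
        moreover have "(\<lambda>r. D\<psi> (x + s *\<^sub>R h) (r *\<^sub>R h)) = (*) (D\<psi> (x + s *\<^sub>R h) h)"
          by (simp add: D\<psi>_def blinfun.scaleR_right fun_eq_iff)
        ultimately show ?thesis by (simp add: has_field_derivative_def)
      qed
      have "((\<lambda>s. integral (cbox t0 t1) (\<lambda>t. \<Phi> t (x + s *\<^sub>R h))) has_vector_derivative
          integral (cbox t0 t1) (\<lambda>t. p t (x + s *\<^sub>R h) h)) (at s within {0..1})"
      proof (rule leibniz_rule_vector_derivative[where fx = "\<lambda>s t. p t (x + s *\<^sub>R h) h"])
        fix r t assume r: "r \<in> {0..1::real}" and t': "t \<in> cbox t0 t1"
        have tS: "t \<in> {0..S}" using t' t by auto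
        have "((\<lambda>s. \<Phi> t (x + s *\<^sub>R h)) has_derivative (\<lambda>q. p t (x + r *\<^sub>R h) (q *\<^sub>R h))) (at r within {0..1})"
          using has_derivative_compose[OF line F(5)[OF inb[OF r] tS]] .
        moreover have "linear (p t (x + r *\<^sub>R h))" using F(5)[OF inb[OF r] tS] by (rule has_derivative_linear)
        ultimately show "((\<lambda>s. \<Phi> t (x + s *\<^sub>R h)) has_vector_derivative p t (x + r *\<^sub>R h) h) (at r within {0..1})"
          by (simp add: has_vector_derivative_def linear_scale)
      next
        fix r assume "r \<in> {0..1::real}"
        show "(\<lambda>t. \<Phi> t (x + r *\<^sub>R h)) integrable_on cbox t0 t1"
          using t by (intro integrable_continuous continuous_on_subset[OF csl]) auto
      next
        show "continuous_on ({0..1} \<times> cbox t0 t1) (\<lambda>(s, t). p t (x + s *\<^sub>R h) h)"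
          using t inR1 continuous_on_compose2[OF cp, of "{0..1} \<times> cbox t0 t1" "\<lambda>z. (snd z, x + fst z *\<^sub>R h)"]
          by (force intro!: continuous_intros simp: split_beta)
      qed (use s in auto)
      from bounded_linear.has_vector_derivative[OF bounded_linear_scaleR_right this, of "1 / \<delta>"]
      have d3: "((\<lambda>s. A t0 t1 (x + s *\<^sub>R h)) has_vector_derivative DA (x + s *\<^sub>R h)) (at s within {0..1})"
        by (simp add: A_def DA_def \<delta>_def)
      have "((\<lambda>s. Z (x + s *\<^sub>R h)) has_vector_derivative
          h + (\<psi> (x + s *\<^sub>R h) *\<^sub>R (DA (x + s *\<^sub>R h) - h) + D\<psi> (x + s *\<^sub>R h) h *\<^sub>R (A t0 t1 (x + s *\<^sub>R h) - (x + s *\<^sub>R h)))) (at s within {0..1})"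
        unfolding Z by (intro has_vector_derivative_add has_vector_derivative_scaleR has_vector_derivative_diff d1 d2 d3)
      then show ?thesis by (simp add: DZ_def add.commute)
    qed
    have "(\<integral>\<^sup>+x\<in>cball 0 R0. ennreal (norm (Z (x + h) - Z x)) \<partial>lborel) \<le> (\<integral>\<^sup>+x\<in>cball 0 R1. ennreal (G x) \<partial>lborel)"
      by (rule nn_integral_increment_le[OF dZ cG GZ R0])
    also have "\<dots> \<le> ennreal (norm h * (2 * V + 32 * M * R3 / \<kappa>\<^sup>2 * I
          + 1 / \<delta> * (3 * R3 / (2 * \<epsilon>) * V + S * (M + 1) * (6 * R3 / \<epsilon>\<^sup>2 * I + V / (2 * \<epsilon>)))))"
    proof -
      define a where "a = 32 * M * R3 / \<kappa>\<^sup>2 * norm h"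
      have a0: "0 \<le> a" using M0 R3 by (simp add: a_def)
      let ?f = "\<lambda>x. \<psi> x * norm (integral {t0..t1} (\<lambda>t. p t x h))"
      have f0: "0 \<le> ?f x" for x using \<psi>01 by simp
      have cf: "continuous_on (cball 0 R1) ?f"
        by (intro continuous_intros cDA continuous_on_subset[OF c\<psi>]) auto
      have cN: "continuous_on A (\<lambda>x. norm (Db x))" for A by (intro continuous_intros continuous_on_subset[OF cD]) auto
      have vol: "emeasure lborel (cball (0::'a) R3) = ennreal V"
        unfolding V_def using emeasure_compact_finite[of "cball (0::'a) R3"]
        by (intro emeasure_eq_ennreal_measure) (auto simp: less_top)
      have V0: "0 \<le> V" by (simp add: V_def)
      have vol1: "emeasure lborel (cball (0::'a) R1) \<le> ennreal V"
        unfolding vol[symmetric] using R3 by (intro emeasure_mono) auto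
      note m1 = borel_measurable_ennreal_indicator[OF cN, of "cball 0 R1"]
        and m2 = borel_measurable_ennreal_indicator[OF cf]
        and m3 = borel_measurable_ennreal_indicator[OF cN, of "cball 0 R3"]
      have "(\<integral>\<^sup>+x\<in>cball 0 R1. ennreal (G x) \<partial>lborel) =
        (\<integral>\<^sup>+x. (ennreal (2 * norm h) * indicator (cball 0 R1) x + ennreal a * (ennreal (norm (Db x)) * indicator (cball 0 R1) x))
          + ennreal (1 / \<delta>) * (ennreal (?f x) * indicator (cball 0 R1) x) \<partial>lborel)"
      proof (intro nn_integral_cong)
        fix x
        have "ennreal (G x) = ennreal (2 * norm h) + ennreal a * ennreal (norm (Db x)) + ennreal (1 / \<delta>) * ennreal (?f x)"
        proof -
          have "ennreal (q1 + a * q2 + q3 * q4) = ennreal q1 + ennreal a * ennreal q2 + ennreal q3 * ennreal q4"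
            if "0 \<le> q1" "0 \<le> q2" "0 \<le> q3" "0 \<le> q4" for q1 q2 q3 q4
            using that a0 by (simp add: ennreal_mult)
          from this[of "2 * norm h" "norm (Db x)" "1 / \<delta>" "?f x"] show ?thesis
            using f0[of x] \<delta> unfolding G_def a_def by simp
        qed
        then show "ennreal (G x) * indicator (cball 0 R1) x = (ennreal (2 * norm h) * indicator (cball 0 R1) x + ennreal a * (ennreal (norm (Db x)) * indicator (cball 0 R1) x))
          + ennreal (1 / \<delta>) * (ennreal (?f x) * indicator (cball 0 R1) x)"
          by (simp add: distrib_right mult.assoc)
      qed
      also have "\<dots> = ennreal (2 * norm h) * emeasure lborel (cball (0::'a) R1)
          + ennreal a * (\<integral>\<^sup>+x\<in>cball 0 R1. ennreal (norm (Db x)) \<partial>lborel)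
          + ennreal (1 / \<delta>) * (\<integral>\<^sup>+x\<in>cball 0 R1. ennreal (?f x) \<partial>lborel)"
        by (rule nn_integral_affine) (use m1 m2 in auto)
      also have "\<dots> \<le> ennreal (2 * norm h) * ennreal V + ennreal a * ennreal I
          + ennreal (1 / \<delta>) * (ennreal (norm h) * (ennreal (3 * R3 / (2 * \<epsilon>)) * ennreal V
            + ennreal (S * (M + 1)) * ennreal (6 * R3 / \<epsilon>\<^sup>2 * I + V / (2 * \<epsilon>))))"
      proof (intro add_mono mult_left_mono vol1)
        have "(\<integral>\<^sup>+x\<in>cball 0 R1. ennreal (norm (Db x)) \<partial>lborel) \<le> (\<integral>\<^sup>+x\<in>cball 0 R3. ennreal (norm (Db x)) \<partial>lborel)"
          using R3 by (intro nn_integral_mono) (auto simp: indicator_def)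
        then show "(\<integral>\<^sup>+x\<in>cball 0 R1. ennreal (norm (Db x)) \<partial>lborel) \<le> ennreal I" using I(1) by (rule order_trans)
        have F1: "(\<integral>\<^sup>+x\<in>cball 0 R1. ennreal (?f x) \<partial>lborel) \<le> ennreal (norm h) * (ennreal (3 * R3 / (2 * \<epsilon>)) * emeasure lborel (cball (0::'a) R1)
             + ennreal (S * (M + 1)) * (\<integral>\<^sup>+y\<in>cball 0 R3. ennreal (6 * R3 * (norm (Db y) / \<epsilon>\<^sup>2) + 1 / norm (v y)) \<partial>lborel))"
        proof (rule flow_average_variation[where Dv = Dv and ?R2.0 = R2])
          show "v x \<noteq> 0" for x using lv[of x] \<epsilon> by auto
          show "continuous_on UNIV (\<lambda>x. norm (Db x) / \<epsilon>\<^sup>2)" using \<epsilon> by (intro continuous_intros cN) auto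
          show "norm (Dv x) \<le> norm (Db x) / \<epsilon>\<^sup>2 * (norm (v x))\<^sup>2" for x by (rule Dvb)
        qed (use dv cDv \<epsilon> lv S R R23 F c\<psi> \<psi>01 \<psi>v t in \<open>simp_all\<close>)
        \<comment> \<open>The summand \<open>0 * 0\<close> only fits the integrand to the shape of
          \<open>nn_integral_affine\<close>.\<close>
        have "(\<integral>\<^sup>+y\<in>cball 0 R3. ennreal (6 * R3 * (norm (Db y) / \<epsilon>\<^sup>2) + 1 / norm (v y)) \<partial>lborel)
          \<le> (\<integral>\<^sup>+y. ennreal (1 / (2 * \<epsilon>)) * indicator (cball 0 R3) y + ennreal (6 * R3 / \<epsilon>\<^sup>2) * (ennreal (norm (Db y)) * indicator (cball 0 R3) y) + 0 * 0 \<partial>lborel)"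
        proof (intro nn_integral_mono)
          fix y
          have "1 / norm (v y) \<le> 1 / (2 * \<epsilon>)" using lv[of y] \<epsilon> by (intro divide_left_mono mult_pos_pos) linarith+
          then have "ennreal (6 * R3 * (norm (Db y) / \<epsilon>\<^sup>2) + 1 / norm (v y)) \<le> ennreal (6 * R3 / \<epsilon>\<^sup>2 * norm (Db y) + 1 / (2 * \<epsilon>))"
            by (intro ennreal_leI) simp
          also have "\<dots> = ennreal (6 * R3 / \<epsilon>\<^sup>2) * ennreal (norm (Db y)) + ennreal (1 / (2 * \<epsilon>))"
            using R3 \<epsilon> by (simp only: ennreal_plus ennreal_mult norm_ge_zero divide_nonneg_nonneg mult_nonneg_nonneg
                zero_le_power2 less_imp_le zero_le_numeral zero_le_one)
          finally show "ennreal (6 * R3 * (norm (Db y) / \<epsilon>\<^sup>2) + 1 / norm (v y)) * indicator (cball 0 R3) y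
             \<le> ennreal (1 / (2 * \<epsilon>)) * indicator (cball 0 R3) y + ennreal (6 * R3 / \<epsilon>\<^sup>2) * (ennreal (norm (Db y)) * indicator (cball 0 R3) y) + 0 * 0"
            by (auto simp: indicator_def add.commute)
        qed
        also have "\<dots> = ennreal (6 * R3 / \<epsilon>\<^sup>2) * (\<integral>\<^sup>+y\<in>cball 0 R3. ennreal (norm (Db y)) \<partial>lborel) + ennreal (1 / (2 * \<epsilon>)) * ennreal V"
          by (subst nn_integral_affine) (use m3 vol in \<open>auto simp: add.commute\<close>)
        also have "\<dots> \<le> ennreal (6 * R3 / \<epsilon>\<^sup>2) * ennreal I + ennreal (1 / (2 * \<epsilon>)) * ennreal V"
          by (intro add_mono mult_left_mono I) auto
        also have "\<dots> = ennreal (6 * R3 / \<epsilon>\<^sup>2 * I + V / (2 * \<epsilon>))"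
          using R3 \<epsilon> I(2) V0 by (simp add: ennreal_plus ennreal_mult[symmetric])
        finally have J: "(\<integral>\<^sup>+y\<in>cball 0 R3. ennreal (6 * R3 * (norm (Db y) / \<epsilon>\<^sup>2) + 1 / norm (v y)) \<partial>lborel)
          \<le> ennreal (6 * R3 / \<epsilon>\<^sup>2 * I + V / (2 * \<epsilon>))" .
        show "(\<integral>\<^sup>+x\<in>cball 0 R1. ennreal (?f x) \<partial>lborel) \<le> ennreal (norm h) * (ennreal (3 * R3 / (2 * \<epsilon>)) * ennreal V
            + ennreal (S * (M + 1)) * ennreal (6 * R3 / \<epsilon>\<^sup>2 * I + V / (2 * \<epsilon>)))"
          by (rule order_trans[OF F1]) (intro mult_left_mono add_mono vol1 J; simp)
      qed auto
      also have "\<dots> = ennreal (norm h * (2 * V + 32 * M * R3 / \<kappa>\<^sup>2 * I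
          + 1 / \<delta> * (3 * R3 / (2 * \<epsilon>) * V + S * (M + 1) * (6 * R3 / \<epsilon>\<^sup>2 * I + V / (2 * \<epsilon>)))))"
      proof -
        define c1 where "c1 = 3 * R3 / (2 * \<epsilon>)"
        define c2 where "c2 = S * (M + 1)"
        define c3 where "c3 = 6 * R3 / \<epsilon>\<^sup>2 * I + V / (2 * \<epsilon>)"
        define c4 where "c4 = 1 / \<delta>"
        have c: "0 \<le> c1" "0 \<le> c2" "0 \<le> c3" "0 \<le> c4" using R3 \<epsilon> S M0 I(2) V0 \<delta> by (simp_all add: c1_def c2_def c3_def c4_def)
        have "ennreal (2 * norm h) * ennreal V + ennreal a * ennreal I + ennreal c4 * (ennreal (norm h) * (ennreal c1 * ennreal V + ennreal c2 * ennreal c3))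
           = ennreal (2 * norm h * V + a * I + c4 * (norm h * (c1 * V + c2 * c3)))"
          using c a0 I(2) V0
          by (simp only: ennreal_plus ennreal_mult mult_nonneg_nonneg add_nonneg_nonneg norm_ge_zero zero_le_numeral)
        also have "2 * norm h * V + a * I + c4 * (norm h * (c1 * V + c2 * c3)) = norm h * (2 * V + 32 * M * R3 / \<kappa>\<^sup>2 * I + c4 * (c1 * V + c2 * c3))"
          unfolding a_def by (simp add: algebra_simps)
        finally show ?thesis unfolding c1_def c2_def c3_def c4_def .
      qed
      finally show ?thesis .
    qed
    finally show "(\<integral>\<^sup>+x\<in>cball 0 R0. ennreal (norm (Z (x + h) - Z x)) \<partial>lborel) \<le>
       ennreal (norm h * (2 * V + 32 * M * R3 / \<kappa>\<^sup>2 * I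
          + 1 / (t1 - t0) * (3 * R3 / (2 * \<epsilon>) * V + S * (M + 1) * (6 * R3 / \<epsilon>\<^sup>2 * I + V / (2 * \<epsilon>)))))"
      by (simp add: \<delta>_def)
  qed (use F(1-3) L in auto)
qed

end

subsection \<open>The shift modulus of a nearly incompressible plane flow\<close>

lemma solution_speed_bound:
  fixes X :: "real \<Rightarrow> 'a::real_normed_vector"
  assumes X: "\<And>t. t \<in> {0..T} \<Longrightarrow> (X has_vector_derivative b (X t)) (at t within {0..T})"
    and bM: "\<And>t. t \<in> {0..T} \<Longrightarrow> norm (b (X t)) \<le> M" and st: "s \<in> {0..T}" "t \<in> {0..T}"
  shows "norm (X s - X t) \<le> M * \<bar>s - t\<bar>"
proof -
  have "norm (X s - X t) \<le> M * norm (s - t)"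
  proof (rule differentiable_bound[of "{0..T}" X "\<lambda>r h. h *\<^sub>R b (X r)"])
    show "(X has_derivative (\<lambda>h. h *\<^sub>R b (X r))) (at r within {0..T})" if "r \<in> {0..T}" for r
      using X[OF that] by (simp add: has_vector_derivative_def)
    show "onorm (\<lambda>h. h *\<^sub>R b (X r)) \<le> M" if "r \<in> {0..T}" for r
      using bM[OF that] by (intro onorm_le) (simp add: mult.commute[of M] mult_left_mono)
  qed (use st in auto)
  then show ?thesis by simp
qed

text \<open>At each point \<open>c\<close> is a convex combination of two vectors with positive
  scalar product with \<open>B x\<close>, so it vanishes nowhere. The cutoff is taken in the squared
  norm, which is differentiable at the origin too; at radius \<open>2 * R\<close> its argument is
  already \<open>4\<close>. The constant 16 is 4 for \<open>cutoff'\<close>, 2 for the derivative of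
  the squared norm, and 2 for \<open>norm (b x - b0 x) \<le> 2 * M\<close>.\<close>

lemma blended_field:
  fixes b b0 B :: "'a::euclidean_space \<Rightarrow> 'a" and Db Db0 :: "'a \<Rightarrow> 'a \<Rightarrow>\<^sub>L 'a"
  assumes db0: "\<And>x. (b0 has_derivative blinfun_apply (Db0 x)) (at x)" and cD0: "continuous_on UNIV Db0"
    and db: "\<And>x. (b has_derivative blinfun_apply (Db x)) (at x)" and cD: "continuous_on UNIV Db"
    and b0M: "\<And>x. norm (b0 x) \<le> M" and bM: "\<And>x. norm (b x) \<le> M"
    and b0B: "\<And>x. 0 < b0 x \<bullet> B x" and bB: "\<And>x. 0 < b x \<bullet> B x" and R: "0 < R"
  obtains c :: "'a \<Rightarrow> 'a" and Dc :: "'a \<Rightarrow> 'a \<Rightarrow>\<^sub>L 'a" where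
    "\<And>x. (c has_derivative blinfun_apply (Dc x)) (at x)" "continuous_on UNIV Dc"
    "\<And>x. c x \<noteq> 0" "\<And>x. norm (c x) \<le> M"
    "\<And>x. norm x \<le> R \<Longrightarrow> c x = b x" "\<And>x. 2 * R \<le> norm x \<Longrightarrow> c x = b0 x"
    "\<And>x R3. norm x \<le> R3 \<Longrightarrow> norm (Dc x) \<le> norm (Db0 x) + norm (Db x) + 16 * M * R3 / R\<^sup>2"
proof -
  define \<chi>r where "\<chi>r x = cutoff (x \<bullet> x / R\<^sup>2)" for x :: 'a
  define \<chi>r' where "\<chi>r' x = cutoff' (x \<bullet> x / R\<^sup>2) * (2 / R\<^sup>2)" for x :: 'a
  define c where "c x = b0 x + \<chi>r x *\<^sub>R (b x - b0 x)" for x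
  define Dc where "Dc x = Db0 x + \<chi>r x *\<^sub>R (Db x - Db0 x) + \<chi>r' x *\<^sub>R (blinfun_scaleR_left (b x - b0 x) o\<^sub>L blinfun_inner_right x)" for x
  have Dc: "blinfun_apply (Dc x) u = Db0 x u + \<chi>r x *\<^sub>R (Db x u - Db0 x u) + (\<chi>r' x * (x \<bullet> u)) *\<^sub>R (b x - b0 x)" for x u
    by (simp add: Dc_def blinfun.add_left blinfun.diff_left blinfun.scaleR_left)
  have M0: "0 \<le> M" using order_trans[OF norm_ge_zero bM] .
  have \<chi>01: "0 \<le> \<chi>r x" "\<chi>r x \<le> 1" for x using cutoff_bounds by (auto simp: \<chi>r_def)
  have d\<chi>: "(\<chi>r has_derivative (\<lambda>u. \<chi>r' x * (x \<bullet> u))) (at x)" for x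
  proof -
    have "((\<lambda>x. 1 / R\<^sup>2 * (x \<bullet> x)) has_derivative (\<lambda>u. 1 / R\<^sup>2 * (x \<bullet> u + u \<bullet> x))) (at x)"
      by (rule has_derivative_mult_right[OF has_derivative_inner[OF has_derivative_ident has_derivative_ident]])
    from has_derivative_compose[OF this DERIV_cutoff[unfolded has_field_derivative_def]] show ?thesis
      unfolding \<chi>r_def \<chi>r'_def by (simp add: inner_commute mult_ac)
  qed
  have dc: "(c has_derivative blinfun_apply (Dc x)) (at x)" for x
  proof -
    have "(c has_derivative (\<lambda>u. Db0 x u + (\<chi>r x *\<^sub>R (Db x u - Db0 x u) + (\<chi>r' x * (x \<bullet> u)) *\<^sub>R (b x - b0 x)))) (at x)"
      unfolding c_def by (intro has_derivative_add has_derivative_scaleR d\<chi> has_derivative_diff db db0)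
    moreover have "blinfun_apply (Dc x) = (\<lambda>u. Db0 x u + (\<chi>r x *\<^sub>R (Db x u - Db0 x u) + (\<chi>r' x * (x \<bullet> u)) *\<^sub>R (b x - b0 x)))"
      by (simp add: fun_eq_iff Dc add.assoc)
    ultimately show ?thesis by simp
  qed
  have cb: "continuous_on UNIV b" "continuous_on UNIV b0" "continuous_on UNIV \<chi>r"
    using db db0 d\<chi> by (meson continuous_at_imp_continuous_on has_derivative_continuous)+
  have "continuous_on UNIV (\<lambda>x::'a. x \<bullet> x / R\<^sup>2)" using R by (intro continuous_intros) auto
  from continuous_on_compose2[OF continuous_cutoff' this]
  have c\<chi>': "continuous_on UNIV \<chi>r'" unfolding \<chi>r'_def by (intro continuous_intros) auto
  have cDc: "continuous_on UNIV Dc"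
    unfolding Dc_def
    by (intro continuous_intros cb cD cD0 c\<chi>' bounded_bilinear.continuous_on[OF bounded_bilinear_blinfun_compose]
        bounded_linear.continuous_on[OF bounded_linear_blinfun_scaleR_left] bounded_linear.continuous_on[OF bounded_linear_blinfun_inner_right])
  have convex: "c x = (1 - \<chi>r x) *\<^sub>R b0 x + \<chi>r x *\<^sub>R b x" for x by (simp add: c_def algebra_simps)
  have cB: "0 < c x \<bullet> B x" for x
  proof (cases "\<chi>r x = 0")
    case True then show ?thesis using b0B by (simp add: convex)
  next
    case False
    then have "0 < \<chi>r x" using \<chi>01(1)[of x] by simp
    then have "0 < \<chi>r x * (b x \<bullet> B x)" using bB by simp
    moreover have "0 \<le> (1 - \<chi>r x) * (b0 x \<bullet> B x)" using \<chi>01(2)[of x] less_imp_le[OF b0B] by simp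
    ultimately show ?thesis unfolding convex by (simp add: inner_add_left)
  qed
  have cM: "norm (c x) \<le> M" for x
  proof -
    have "norm (c x) \<le> (1 - \<chi>r x) * norm (b0 x) + \<chi>r x * norm (b x)"
      unfolding convex using \<chi>01[of x] norm_triangle_ineq[of "(1 - \<chi>r x) *\<^sub>R b0 x" "\<chi>r x *\<^sub>R b x"] by simp
    also have "\<dots> \<le> (1 - \<chi>r x) * M + \<chi>r x * M" using \<chi>01[of x] by (intro add_mono mult_left_mono b0M bM) auto
    finally show ?thesis by (simp add: algebra_simps)
  qed
  have near: "c x = b x" if "norm x \<le> R" for x
  proof -
    have "x \<bullet> x \<le> R\<^sup>2" unfolding power2_norm_eq_inner[symmetric] using that by (intro power_mono) auto
    then have "\<chi>r x = 1" unfolding \<chi>r_def using R by (intro cutoff_eq_1) (simp add: divide_simps)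
    then show ?thesis by (simp add: c_def)
  qed
  have far: "c x = b0 x" if "2 * R \<le> norm x" for x
  proof -
    have "(2 * R)\<^sup>2 \<le> x \<bullet> x" unfolding power2_norm_eq_inner[symmetric] using that R by (intro power_mono) auto
    moreover have "(2 * R)\<^sup>2 = 4 * R\<^sup>2" by (simp add: power_mult_distrib)
    ultimately have "2 * R\<^sup>2 \<le> x \<bullet> x" using zero_le_power2[of R] by linarith
    then have "\<chi>r x = 0" unfolding \<chi>r_def using R by (intro cutoff_eq_0) (simp add: divide_simps)
    then show ?thesis by (simp add: c_def)
  qed
  have bound: "norm (Dc x) \<le> norm (Db0 x) + norm (Db x) + 16 * M * R3 / R\<^sup>2" if x: "norm x \<le> R3" for x R3
  proof (rule norm_blinfun_bound)
    have R3: "0 \<le> R3" using x norm_ge_zero order_trans by blast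
    show "0 \<le> norm (Db0 x) + norm (Db x) + 16 * M * R3 / R\<^sup>2" using M0 R3 by simp
    fix u
    have 1: "norm (Db0 x u + \<chi>r x *\<^sub>R (Db x u - Db0 x u)) \<le> norm (Db0 x u) + norm (Db x u)"
    proof -
      have "Db0 x u + \<chi>r x *\<^sub>R (Db x u - Db0 x u) = (1 - \<chi>r x) *\<^sub>R Db0 x u + \<chi>r x *\<^sub>R Db x u" by (simp add: algebra_simps)
      also have "norm \<dots> \<le> (1 - \<chi>r x) * norm (Db0 x u) + \<chi>r x * norm (Db x u)"
        using \<chi>01[of x] norm_triangle_ineq[of "(1 - \<chi>r x) *\<^sub>R Db0 x u" "\<chi>r x *\<^sub>R Db x u"] by simp
      also have "\<dots> \<le> 1 * norm (Db0 x u) + 1 * norm (Db x u)" using \<chi>01[of x] by (intro add_mono mult_right_mono) auto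
      finally show ?thesis by simp
    qed
    have 2: "norm ((\<chi>r' x * (x \<bullet> u)) *\<^sub>R (b x - b0 x)) \<le> 16 * M * R3 / R\<^sup>2 * norm u"
    proof -
      have "norm (b x - b0 x) \<le> 2 * M" using norm_triangle_ineq4[of "b x" "b0 x"] bM[of x] b0M[of x] by simp
      moreover have "\<bar>x \<bullet> u\<bar> \<le> R3 * norm u"
        using Cauchy_Schwarz_ineq2[of x u] x by (meson mult_right_mono norm_ge_zero order_trans)
      moreover have "\<bar>\<chi>r' x\<bar> \<le> 4 * (2 / R\<^sup>2)"
        unfolding \<chi>r'_def abs_mult using cutoff'_bound by (intro mult_mono) auto
      ultimately have "\<bar>\<chi>r' x\<bar> * \<bar>x \<bullet> u\<bar> * norm (b x - b0 x) \<le> 4 * (2 / R\<^sup>2) * (R3 * norm u) * (2 * M)"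
        using R3 by (intro mult_mono mult_nonneg_nonneg) auto
      then show ?thesis by (simp add: abs_mult mult_ac)
    qed
    have "norm (Dc x u) \<le> norm (Db0 x u) + norm (Db x u) + 16 * M * R3 / R\<^sup>2 * norm u"
      unfolding Dc by (rule norm_triangle_le[OF add_mono[OF 1 2]])
    also have "\<dots> \<le> norm (Db0 x) * norm u + norm (Db x) * norm u + 16 * M * R3 / R\<^sup>2 * norm u"
      by (intro add_mono norm_blinfun order_refl)
    finally show "norm (Dc x u) \<le> (norm (Db0 x) + norm (Db x) + 16 * M * R3 / R\<^sup>2) * norm u" by (simp add: distrib_right)
  qed
  have nz: "c x \<noteq> 0" for x using cB[of x] by auto
  show ?thesis by (rule that[OF dc cDc nz cM near far bound])
qed

context plane
begin

text \<open>Here the compressibility bound enters: the logarithm of the speed \<open>|b|\<close> varies along a trajectory by at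
  most the time integral of \<open>|Db|\<close>, and this quantity is bounded in \<open>L\<^sup>1\<close> over the starting points.\<close>

lemma nn_integral_derivative_along_flow:
  fixes b :: "'a \<Rightarrow> 'a" and Db :: "'a \<Rightarrow> 'a \<Rightarrow>\<^sub>L 'a" and X :: "real \<Rightarrow> 'a \<Rightarrow> 'a"
  assumes db: "\<And>x. (b has_derivative blinfun_apply (Db x)) (at x)" and cD: "continuous_on UNIV Db"
    and I: "(\<integral>\<^sup>+x. ennreal (norm (Db x)) \<partial>lborel) \<le> ennreal I" "0 \<le> I"
    and T: "0 \<le> T" and C: "0 < C" and bM: "\<And>x. norm (b x) \<le> M"
    and cX: "continuous_on ({0..T} \<times> UNIV) (\<lambda>(t, x). X t x)"
    and X: "\<And>t x. t \<in> {0..T} \<Longrightarrow> ((\<lambda>t. X t x) has_vector_derivative b (X t x)) (at t within {0..T})"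
    and init: "\<And>x. X 0 x = x"
    and dX: "\<And>t x. t \<in> {0..T} \<Longrightarrow> (X t has_derivative DX t x) (at x)"
    and jac: "\<And>t x. t \<in> {0..T} \<Longrightarrow> 1 / C \<le> dt (DX t x)"
  shows "(\<integral>\<^sup>+x\<in>cball 0 R. ennreal (integral {0..T} (\<lambda>t. norm (Db (X t x)))) \<partial>lborel) \<le> ennreal (T * (C * I))"
    and "continuous_on (cball 0 R) (\<lambda>x. integral {0..T} (\<lambda>t. norm (Db (X t x))))"
proof -
  have M0: "0 \<le> M" using order_trans[OF norm_ge_zero bM] .
  have cX': "continuous_on ({0..T} \<times> cball 0 R) (\<lambda>(t, x). X t x)" by (rule continuous_on_subset[OF cX]) auto
  have cN: "continuous_on UNIV (\<lambda>x. norm (Db x))" by (intro continuous_intros cD)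
  have cK: "continuous_on ({0..T} \<times> cball 0 R) (\<lambda>(t, x). norm (Db (X t x)))"
    using continuous_on_compose2[OF cN cX'] by (auto simp: split_beta)
  have slice: "continuous_on {0..T} (\<lambda>t. norm (Db (X t x)))" if "x \<in> cball 0 R" for x
  proof -
    have "continuous_on {0..T} (\<lambda>t. case (t, x) of (t, x) \<Rightarrow> norm (Db (X t x)))"
      by (rule continuous_on_compose2[OF cK]) (use that in \<open>auto intro!: continuous_intros\<close>)
    then show ?thesis by simp
  qed
  have "continuous_on (cball 0 R \<times> cbox 0 T) (\<lambda>z. norm (Db (X (snd z) (fst z))))"
  proof -
    have "continuous_on (cball 0 R \<times> cbox 0 T) (\<lambda>z. case (snd z, fst z) of (t, x) \<Rightarrow> norm (Db (X t x)))"
      by (rule continuous_on_compose2[OF cK]) (auto intro!: continuous_intros)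
    then show ?thesis by simp
  qed
  then have "continuous_on (cball 0 R) (\<lambda>x. integral (cbox 0 T) (\<lambda>t. norm (Db (X t x))))"
    by (intro integral_continuous_on_param) (simp add: split_beta)
  then show "continuous_on (cball 0 R) (\<lambda>x. integral {0..T} (\<lambda>t. norm (Db (X t x))))" by simp
  have inj: "inj_on (X t) (cball 0 R)" if t: "t \<in> {0..T}" for t
  proof (rule inj_onI)
    fix x y assume xy: "x \<in> cball 0 R" "y \<in> cball 0 R" "X t x = X t y"
    obtain L where L: "0 < L" "\<And>y z. y \<in> cball 0 (R + M * T) \<Longrightarrow> z \<in> cball 0 (R + M * T) \<Longrightarrow> norm (b y - b z) \<le> L * norm (y - z)"
      using C1_imp_lipschitz_on_cball[OF db cD] by metis
    have inK: "X s z \<in> cball 0 (R + M * T)" if z: "z \<in> cball 0 R" and s: "s \<in> {0..T}" for s z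
    proof -
      have "norm (X s z - X 0 z) \<le> M * \<bar>s - 0\<bar>" by (rule solution_speed_bound[OF X]) (use bM s T in auto)
      also have "\<dots> \<le> M * T" using s M0 by (intro mult_left_mono) auto
      finally have "norm (X s z) \<le> norm z + M * T" using norm_triangle_sub[of "X s z" z] by (simp add: init)
      then show ?thesis using z by simp
    qed
    have "X 0 x = X 0 y"
      by (rule solution_backward_unique[where v = b and S = T and t = t and L = L and K = "cball 0 (R + M * T)"])
         (use X inK xy L t in auto)
    then show "x = y" by (simp add: init)
  qed
  have time_slice: "(\<integral>\<^sup>+x\<in>cball 0 R. ennreal (norm (Db (X t x))) \<partial>lborel) \<le> ennreal (C * I)" if t: "t \<in> {0..T}" for t
  proof -
    \<comment> \<open>The lower Jacobian bound makes \<open>\<bar>dt (DX t x)\<bar> * C\<close> at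
      least \<open>1\<close>, so the factor that the change of variables calls for can be
      inserted.\<close>
    have "norm (Db (X t x)) \<le> \<bar>dt (DX t x)\<bar> * (C * norm (Db (X t x)))" for x
    proof -
      have "1 \<le> dt (DX t x) * C" using jac[OF t, of x] C by (simp add: divide_simps)
      also have "\<dots> \<le> \<bar>dt (DX t x)\<bar> * C" using C by (intro mult_right_mono) auto
      finally have "1 * norm (Db (X t x)) \<le> (\<bar>dt (DX t x)\<bar> * C) * norm (Db (X t x))" by (intro mult_right_mono) auto
      then show ?thesis by (simp add: mult.assoc)
    qed
    then have "(\<integral>\<^sup>+x\<in>cball 0 R. ennreal (norm (Db (X t x))) \<partial>lborel) \<le> (\<integral>\<^sup>+x\<in>cball 0 R. ennreal (\<bar>dt (DX t x)\<bar> * (C * norm (Db (X t x)))) \<partial>lborel)"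
      by (intro nn_integral_mono mult_right_mono ennreal_leI) auto
    also have "\<dots> \<le> (\<integral>\<^sup>+y\<in>X t ` cball 0 R. ennreal (C * norm (Db y)) \<partial>lborel)"
    proof (rule change_of_variables)
      show "(X t has_derivative DX t x) (at x within cball 0 R)" for x
        by (rule has_derivative_at_withinI[OF dX[OF t]])
      show "continuous_on UNIV (\<lambda>y. C * norm (Db y))" by (intro continuous_intros cN)
    qed (use inj[OF t] C in auto)
    also have "\<dots> \<le> (\<integral>\<^sup>+y. ennreal C * ennreal (norm (Db y)) \<partial>lborel)"
      using C by (intro nn_integral_mono) (auto simp: indicator_def ennreal_mult)
    also have "\<dots> = ennreal C * (\<integral>\<^sup>+y. ennreal (norm (Db y)) \<partial>lborel)"
      using borel_measurable_continuous_onI[OF cN] by (intro nn_integral_cmult) auto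
    also have "\<dots> \<le> ennreal C * ennreal I" by (intro mult_left_mono I) auto
    finally show ?thesis using C I(2) by (simp add: ennreal_mult)
  qed
  have "(\<integral>\<^sup>+x\<in>cball 0 R. ennreal (integral {0..T} (\<lambda>t. norm (Db (X t x)))) \<partial>lborel)
     = (\<integral>\<^sup>+x\<in>cball 0 R. (\<integral>\<^sup>+t\<in>{0..T}. ennreal (norm (Db (X t x))) \<partial>lborel) \<partial>lborel)"
    using ennreal_integral_eq_nn_integral[OF slice] by (intro nn_integral_cong) (auto simp: indicator_def)
  also have "\<dots> = (\<integral>\<^sup>+t\<in>{0..T}. (\<integral>\<^sup>+x\<in>cball 0 R. ennreal (norm (Db (X t x))) \<partial>lborel) \<partial>lborel)"
    by (intro nn_integral_swap_continuous_on(1) cK) auto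
  also have "\<dots> \<le> (\<integral>\<^sup>+t\<in>{0..T}. ennreal (C * I) \<partial>lborel)"
    using time_slice by (intro nn_integral_mono) (auto simp: indicator_def)
  also have "\<dots> = ennreal (C * I) * ennreal T" using T by (subst nn_integral_cmult_indicator) auto
  also have "\<dots> = ennreal (T * (C * I))" using T C I(2) by (simp add: ennreal_mult mult_ac)
  finally show "(\<integral>\<^sup>+x\<in>cball 0 R. ennreal (integral {0..T} (\<lambda>t. norm (Db (X t x)))) \<partial>lborel) \<le> ennreal (T * (C * I))" .
qed

end

lemma nn_integral_add3_continuous_on:
  fixes f g h :: "'a::euclidean_space \<Rightarrow> real"
  assumes c: "continuous_on A f" "continuous_on A g" "continuous_on A h" and A: "A \<in> sets borel"
    and nn: "\<And>x. x \<in> A \<Longrightarrow> 0 \<le> f x" "\<And>x. x \<in> A \<Longrightarrow> 0 \<le> g x" "\<And>x. x \<in> A \<Longrightarrow> 0 \<le> h x"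
  shows "(\<integral>\<^sup>+x\<in>A. ennreal (f x + g x + h x) \<partial>lborel) =
    (\<integral>\<^sup>+x\<in>A. ennreal (f x) \<partial>lborel) + (\<integral>\<^sup>+x\<in>A. ennreal (g x) \<partial>lborel) + (\<integral>\<^sup>+x\<in>A. ennreal (h x) \<partial>lborel)"
proof -
  note m = c[THEN borel_measurable_ennreal_indicator, OF A]
  have "(\<integral>\<^sup>+x\<in>A. ennreal (f x + g x + h x) \<partial>lborel)
    = (\<integral>\<^sup>+x. ennreal (f x) * indicator A x + ennreal (g x) * indicator A x + ennreal (h x) * indicator A x \<partial>lborel)"
    using nn by (intro nn_integral_cong) (auto simp: indicator_def)
  also have "\<dots> = (\<integral>\<^sup>+x. ennreal (f x) * indicator A x + ennreal (g x) * indicator A x \<partial>lborel) + (\<integral>\<^sup>+x\<in>A. ennreal (h x) \<partial>lborel)"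
    using m by (intro nn_integral_add) auto
  also have "(\<integral>\<^sup>+x. ennreal (f x) * indicator A x + ennreal (g x) * indicator A x \<partial>lborel)
    = (\<integral>\<^sup>+x\<in>A. ennreal (f x) \<partial>lborel) + (\<integral>\<^sup>+x\<in>A. ennreal (g x) \<partial>lborel)"
    using m by (intro nn_integral_add) auto
  finally show ?thesis .
qed

context plane
begin

text \<open>Off the set where \<open>Q x > q\<close> the speed along the trajectory of \<open>x\<close> stays comparable to its initial
  value. If that is at least \<open>\<kappa> / 2\<close>, the accelerated flow is a time change close to the identity; if it is
  at most \<open>\<kappa>\<close>, the point hardly moves.\<close>

lemma flow_approximation:
  fixes b c :: "'a \<Rightarrow> 'a" and Db :: "'a \<Rightarrow> 'a \<Rightarrow>\<^sub>L 'a" and X :: "real \<Rightarrow> 'a" and y :: "real \<Rightarrow> 'a"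
  assumes db: "\<And>x. (b has_derivative blinfun_apply (Db x)) (at x)" and cD: "continuous_on UNIV Db"
    and bM: "\<And>x. norm (b x) \<le> M" and cM: "\<And>x. norm (c x) \<le> M" and nz: "\<And>x. b x \<noteq> 0"
    and cc: "continuous_on UNIV c"
    and v: "\<And>x. v x = (1 + \<epsilon>\<^sup>2 / (norm (c x))\<^sup>2) *\<^sub>R c x"
    and X: "\<And>t. t \<in> {0..T} \<Longrightarrow> (X has_vector_derivative b (X t)) (at t within {0..T})"
    and y: "\<And>t. t \<in> {0..T} \<Longrightarrow> (y has_vector_derivative v (y t)) (at t within {0..T})"
    and init: "X 0 = x" "y 0 = x"
    and XR: "\<And>t. t \<in> {0..T} \<Longrightarrow> c (X t) = b (X t)"
    and K: "\<And>t. t \<in> {0..T} \<Longrightarrow> norm (X t) \<le> R3" "\<And>t. t \<in> {0..T} \<Longrightarrow> norm (y t) \<le> R3"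
    and lip: "\<And>x z. x \<in> cball 0 R3 \<Longrightarrow> z \<in> cball 0 R3 \<Longrightarrow> norm (v x - v z) \<le> L * norm (x - z)" and L: "0 \<le> L"
    and q: "integral {0..T} (\<lambda>s. norm (Db (X s))) \<le> q"
    and \<kappa>: "0 < \<kappa>" "\<kappa> * exp q * T \<le> \<eta>"
    and \<omega>: "0 < \<omega>" "2 * \<omega> \<le> T" "3 * M * \<omega> \<le> \<eta>" "T * (\<epsilon>\<^sup>2 / (\<kappa> / 2 * exp (- q))\<^sup>2) \<le> \<omega>"
    and t: "t \<in> {0..T}" and t0: "t0 = min t (T - 2 * \<omega>)"
    and \<psi>: "\<psi> = 1 - cutoff (2 * (norm (c x))\<^sup>2 / \<kappa>\<^sup>2)"
  shows "norm (X t - (x + \<psi> *\<^sub>R ((1 / \<omega>) *\<^sub>R integral {t0..t0 + \<omega>} y - x))) \<le> \<eta>"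
proof -
  have T: "0 \<le> T" "0 \<in> {0..T}" using t by auto
  have M0: "0 \<le> M" using order_trans[OF norm_ge_zero bM] .
  have \<psi>01: "0 \<le> \<psi>" "\<psi> \<le> 1" using cutoff_bounds by (auto simp: \<psi>)
  have cx: "c x = b x" using XR[OF T(2)] init by simp
  have cX: "continuous_on {0..T} X" and cy: "continuous_on {0..T} y"
    using X y by (meson continuous_on_eq_continuous_within has_vector_derivative_continuous)+
  have cN: "continuous_on {0..T} (\<lambda>s. norm (Db (X s)))"
    by (intro continuous_intros continuous_on_compose2[OF cD cX]) auto
  have dbX: "((\<lambda>t. b (X t)) has_vector_derivative Db (X s) (b (X s))) (at s within {0..T})" if s: "s \<in> {0..T}" for s
  proof -
    have "((b \<circ> X) has_derivative (blinfun_apply (Db (X s)) \<circ> (\<lambda>h. h *\<^sub>R b (X s)))) (at s within {0..T})"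
      using X[OF s] unfolding has_vector_derivative_def by (intro diff_chain_within has_derivative_at_withinI[OF db])
    then show ?thesis by (simp add: has_vector_derivative_def o_def blinfun.scaleR_right)
  qed
  have var: "norm (b x) * exp (- q) \<le> norm (b (X s))" "norm (b (X s)) \<le> norm (b x) * exp q" if s: "s \<in> {0..T}" for s
    using norm_along_linear_flow[where w = "\<lambda>t. b (X t)" and A = "\<lambda>s. blinfun_apply (Db (X s))", OF dbX norm_blinfun nz cN _ q s] init
    by auto
  let ?A = "(1 / \<omega>) *\<^sub>R integral {t0..t0 + \<omega>} y"
  have slow: "norm (X t - x) \<le> \<eta>" if r: "norm (b x) \<le> \<kappa>"
  proof -
    have "norm (X t - X 0) \<le> (\<kappa> * exp q) * \<bar>t - 0\<bar>"
    proof (rule solution_speed_bound[OF X])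
      show "norm (b (X s)) \<le> \<kappa> * exp q" if s: "s \<in> {0..T}" for s
        by (rule order_trans[OF var(2)[OF s] mult_right_mono[OF r]]) simp
    qed (use t in auto)
    also have "\<dots> \<le> (\<kappa> * exp q) * T" using t \<kappa>(1) by (intro mult_left_mono) auto
    finally show ?thesis using \<kappa>(2) init by simp
  qed
  have fast: "norm (X t - ?A) \<le> \<eta>" if r: "\<kappa> / 2 \<le> norm (b x)"
  proof -
    \<comment> \<open>Every \<open>s\<close> in the window is at most \<open>T - \<omega>\<close>,
      where the time change applies with error \<open>M * \<omega>\<close>, and within
      \<open>2 * \<omega>\<close> of \<open>t\<close>, which costs another
      \<open>2 * M * \<omega>\<close>.\<close>
    have near: "norm (y s - X t) \<le> \<eta>" if s: "s \<in> {t0..t0 + \<omega>}" for s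
    proof -
      have sT: "0 \<le> s" "s \<le> T - \<omega>" "s \<in> {0..T}" "\<bar>s - t\<bar> \<le> 2 * \<omega>"
        using s t t0 \<omega> by (auto simp: min_def abs_if split: if_splits)
      have 1: "norm (y s - X s) \<le> M * \<omega>"
      proof (rule time_change_comparison[where b = c and v = v and K = "cball 0 R3" and L = L and T = T and \<epsilon> = \<epsilon> and \<kappa> = "\<kappa> / 2 * exp (- q)"])
        show "\<kappa> / 2 * exp (- q) \<le> norm (c (X r))" if "r \<in> {0..T}" for r
          unfolding XR[OF that] by (rule order_trans[OF mult_right_mono[OF r] var(1)[OF that]]) simp
        show "(X has_vector_derivative c (X r)) (at r within {0..T})" if "r \<in> {0..T}" for r
          using X[OF that] XR[OF that] by simp
      qed (use v y init K lip L cc cM \<kappa>(1) \<omega> T sT in auto)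
      have "norm (X s - X t) \<le> M * \<bar>s - t\<bar>"
        by (rule solution_speed_bound[OF X]) (use bM sT t in auto)
      also have "\<dots> \<le> M * (2 * \<omega>)" using sT M0 by (intro mult_left_mono) auto
      finally show ?thesis using 1 \<omega>(3) norm_triangle_ineq[of "y s - X s" "X s - X t"] by simp
    qed
    have "norm ((1 / (t0 + \<omega> - t0)) *\<^sub>R integral {t0..t0 + \<omega>} y - X t) \<le> \<eta>"
    proof (rule interval_average_norm_le)
      show "continuous_on {t0..t0 + \<omega>} y" by (rule continuous_on_subset[OF cy]) (use t t0 \<omega> in \<open>auto simp: min_def split: if_splits\<close>)
    qed (use \<omega>(1) near in auto)
    then show ?thesis by (simp add: norm_minus_commute)
  qed
  have \<eta>0: "0 \<le> \<eta>" using \<omega>(1,3) M0 by (auto intro: order_trans[rotated])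
  \<comment> \<open>\<psi> is \<open>1\<close> for speeds from \<kappa> on and \<open>0\<close> for
    speeds up to \<open>\<kappa> / 2\<close>. So each of the two terms has a nonzero coefficient
    only in the regime where its estimate holds, and in between both hold.\<close>
  have "X t - (x + \<psi> *\<^sub>R (?A - x)) = (1 - \<psi>) *\<^sub>R (X t - x) + \<psi> *\<^sub>R (X t - ?A)" by (simp add: algebra_simps)
  also have "norm \<dots> \<le> (1 - \<psi>) * norm (X t - x) + \<psi> * norm (X t - ?A)"
    using norm_triangle_ineq[of "(1 - \<psi>) *\<^sub>R (X t - x)" "\<psi> *\<^sub>R (X t - ?A)"] \<psi>01 by simp
  also have "\<dots> \<le> (1 - \<psi>) * \<eta> + \<psi> * \<eta>"
  proof (rule add_mono)
    show "(1 - \<psi>) * norm (X t - x) \<le> (1 - \<psi>) * \<eta>"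
    proof (cases "norm (b x) \<le> \<kappa>")
      case True then show ?thesis using slow \<psi>01 by (intro mult_left_mono) auto
    next
      case False
      then have "\<kappa>\<^sup>2 \<le> (norm (b x))\<^sup>2" using \<kappa>(1) by (intro power_mono) auto
      then have "\<psi> = 1" unfolding \<psi> cx using \<kappa>(1) by (subst cutoff_eq_0) (auto simp: divide_simps)
      then show ?thesis by simp
    qed
    show "\<psi> * norm (X t - ?A) \<le> \<psi> * \<eta>"
    proof (cases "\<kappa> / 2 \<le> norm (b x)")
      case True then show ?thesis using fast \<psi>01 by (intro mult_left_mono) auto
    next
      case False
      then have "(norm (b x))\<^sup>2 \<le> (\<kappa> / 2)\<^sup>2" using \<kappa>(1) by (intro power_mono) auto
      moreover have "(\<kappa> / 2)\<^sup>2 = \<kappa>\<^sup>2 / 4" by (simp add: power_divide)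
      ultimately have "2 * (norm (b x))\<^sup>2 \<le> \<kappa>\<^sup>2" using zero_le_power2[of \<kappa>] by linarith
      then have "\<psi> = 0" unfolding \<psi> cx using \<kappa>(1) by (subst cutoff_eq_1) (auto simp: divide_simps)
      then show ?thesis by simp
    qed
  qed
  also have "\<dots> = \<eta>" by (simp add: algebra_simps)
  finally show ?thesis .
qed

text \<open>The order of quantifiers is the point: every constant is fixed from \<open>M\<close>,
  \<open>C\<close>, \<open>T\<close>, \<open>R0\<close>, \<open>e\<close> and the reference field
  \<open>b0\<close> before \<open>b\<close> is given, so one \<open>K\<close> serves all fields.
  \<open>K\<close> depends on \<open>e\<close>; the result is a modulus of continuity in L^1, not a
  Lipschitz bound.\<close>

lemma flow_shift_modulus:
  fixes b0 B :: "'a \<Rightarrow> 'a" and Db0 :: "'a \<Rightarrow> 'a \<Rightarrow>\<^sub>L 'a"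
  assumes db0: "\<And>x. (b0 has_derivative blinfun_apply (Db0 x)) (at x)" and cD0: "continuous_on UNIV Db0"
    and b0M: "\<And>x. norm (b0 x) \<le> M" and I0: "(\<integral>\<^sup>+x. ennreal (norm (Db0 x)) \<partial>lborel) \<le> ennreal M"
    and b0B: "\<And>x. 0 < b0 x \<bullet> B x"
    and T: "0 < T" and C: "0 < C" and R0: "0 \<le> R0" and e: "0 < e"
  obtains K where "0 \<le> K"
    "\<And>b Db X DX t h. \<lbrakk>
       \<And>x. (b has_derivative blinfun_apply (Db x)) (at x); continuous_on UNIV Db;
       \<And>x. norm (b x) \<le> M; (\<integral>\<^sup>+x. ennreal (norm (Db x)) \<partial>lborel) \<le> ennreal M; \<And>x. 0 < b x \<bullet> B x;
       continuous_on ({0..T} \<times> UNIV) (\<lambda>(t, x). X t x);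
       \<And>t x. t \<in> {0..T} \<Longrightarrow> ((\<lambda>t. X t x) has_vector_derivative b (X t x)) (at t within {0..T});
       \<And>x. X 0 x = x;
       \<And>t x. t \<in> {0..T} \<Longrightarrow> (X t has_derivative DX t x) (at x);
       \<And>t x. t \<in> {0..T} \<Longrightarrow> 1 / C \<le> dt (DX t x);
       t \<in> {0..T}; norm h \<le> 1\<rbrakk> \<Longrightarrow>
     (\<integral>\<^sup>+x\<in>cball 0 R0. ennreal (norm (X t (x + h) - X t x)) \<partial>lborel) \<le> ennreal (e + K * norm h)"
proof -
  have M0: "0 \<le> M" using order_trans[OF norm_ge_zero b0M] .
  \<comment> \<open>\<open>R1\<close> leaves room for shifts of norm at most 1. Trajectories of
    \<open>b\<close> from there stay within \<open>R\<close> up to time \<open>T\<close>, where the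
    blended field is \<open>b\<close>. From radius \<open>R2\<close> on it is \<open>b0\<close>, and
    in the shell up to \<open>R3\<close> the accelerated speed is at most \<open>M + 1\<close>, too
    slow to cross it in time \<open>T\<close>.\<close>
  define R1 where "R1 = R0 + 1"
  define R where "R = R1 + M * T + 1"
  define R2 where "R2 = 2 * R"
  define R3 where "R3 = R2 + (M + 1) * T"
  define V where "V = measure lborel (cball (0::'a) R3)"
  \<comment> \<open>\<open>W\<close> bounds \<open>norm (X t x - Z x)\<close>, as
    \<open>X t x\<close> has norm at most \<open>R3\<close> and \<open>Z x\<close> at most
    \<open>3 * R3\<close>. The threshold \<open>q\<close> makes trajectories with large variation of
    speed cost at most \<open>e / 4\<close>, and \<eta> does the same for all others. \<kappa> is so
    small that slow points move by at most \<eta>; \<open>\<kappa>1\<close> is a lower bound for the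
    speed along fast trajectories.\<close>
  define W where "W = 4 * R3"
  define q where "q = 4 * W * (T * (C * M)) / e + 1"
  define \<eta> where "\<eta> = e / (4 * (V + 1))"
  define \<kappa> where "\<kappa> = \<eta> / (T + 1) * exp (- q)"
  define \<kappa>1 where "\<kappa>1 = \<kappa> / 2 * exp (- q)"
  define \<omega> where "\<omega> = min (T / 2) (\<eta> / (3 * (M + 1)))"
  have MT: "0 \<le> M * T" "0 \<le> (M + 1) * T" using M0 T by auto
  have Rs: "0 \<le> R1" "R1 \<le> R" "R1 + M * T \<le> R" "0 < R" "R1 < R2" "R2 \<le> R3" "R \<le> R3" "0 < R3" "R1 \<le> R3" "R2 + (M + 1) * T \<le> R3"
    using R0 MT by (auto simp: R1_def R_def R2_def R3_def)
  have V0: "0 \<le> V" by (simp add: V_def)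
  have W0: "0 < W" using Rs by (simp add: W_def)
  have q0: "0 < q" using W0 T C M0 e unfolding q_def by (intro add_nonneg_pos) auto
  have \<eta>0: "0 < \<eta>" using e V0 by (simp add: \<eta>_def)
  have \<kappa>0: "0 < \<kappa>" using \<eta>0 T by (simp add: \<kappa>_def)
  have \<kappa>10: "0 < \<kappa>1" using \<kappa>0 by (simp add: \<kappa>1_def)
  have \<omega>0: "0 < \<omega>" "2 * \<omega> \<le> T" using T \<eta>0 M0 by (auto simp: \<omega>_def)
  have \<omega>M: "3 * M * \<omega> \<le> \<eta>"
  proof -
    have "3 * M * \<omega> \<le> 3 * (M + 1) * (\<eta> / (3 * (M + 1)))"
      using M0 \<omega>0 by (intro mult_mono) (auto simp: \<omega>_def)
    also have "\<dots> = \<eta>" using M0 by simp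
    finally show ?thesis .
  qed
  have \<kappa>e: "\<kappa> * exp q * T \<le> \<eta>"
  proof -
    have "\<kappa> * exp q * T = \<eta> * (T / (T + 1))" by (simp add: \<kappa>_def exp_minus)
    also have "\<dots> \<le> \<eta> * 1" using \<eta>0 T by (intro mult_left_mono) auto
    finally show ?thesis by simp
  qed
  have cb0: "continuous_on UNIV b0" using db0 by (meson continuous_at_imp_continuous_on has_derivative_continuous)
  have "\<exists>c>0. \<forall>x\<in>cball 0 R3. c \<le> norm (b0 x)"
  proof -
    have "\<exists>x\<in>cball 0 R3. \<forall>y\<in>cball 0 R3. norm (b0 x) \<le> norm (b0 y)"
      using Rs by (intro continuous_attains_inf continuous_intros continuous_on_subset[OF cb0]) auto
    then obtain x where "\<forall>y\<in>cball 0 R3. norm (b0 x) \<le> norm (b0 y)" by blast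
    moreover have "0 < norm (b0 x)" using b0B[of x] by auto
    ultimately show ?thesis by blast
  qed
  then obtain c0 where c0: "0 < c0" "\<And>x. x \<in> cball 0 R3 \<Longrightarrow> c0 \<le> norm (b0 x)" by blast
  \<comment> \<open>Three demands on the square of \<epsilon>: at most the minimal speed of
    \<open>b0\<close>, for the accelerated speed in the shell; at most \<open>\<kappa> / 2\<close>,
    for the weighted initial speed; and small enough that the clock of the time change lags by at
    most \<omega> when the speed is at least \<open>\<kappa>1\<close>.\<close>
  define \<epsilon>2 where "\<epsilon>2 = min (min c0 (\<kappa> / 2)) (\<omega> * \<kappa>1\<^sup>2 / T)"
  define \<epsilon> where "\<epsilon> = sqrt \<epsilon>2"
  have \<epsilon>20: "0 < \<epsilon>2" using c0 \<kappa>0 \<omega>0 \<kappa>10 T by (simp add: \<epsilon>2_def)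
  have \<epsilon>: "0 < \<epsilon>" "\<epsilon>\<^sup>2 = \<epsilon>2" using \<epsilon>20 by (auto simp: \<epsilon>_def)
  have \<epsilon>b: "\<epsilon>\<^sup>2 \<le> c0" "2 * \<epsilon>\<^sup>2 \<le> \<kappa>" "T * (\<epsilon>\<^sup>2 / \<kappa>1\<^sup>2) \<le> \<omega>"
  proof -
    show "\<epsilon>\<^sup>2 \<le> c0" "2 * \<epsilon>\<^sup>2 \<le> \<kappa>" unfolding \<epsilon> by (auto simp: \<epsilon>2_def)
    have "\<epsilon>2 \<le> \<omega> * \<kappa>1\<^sup>2 / T" by (simp add: \<epsilon>2_def)
    then have "\<epsilon>2 * T \<le> \<omega> * \<kappa>1\<^sup>2" using T by (simp add: pos_le_divide_eq)
    then show "T * (\<epsilon>\<^sup>2 / \<kappa>1\<^sup>2) \<le> \<omega>" unfolding \<epsilon> using \<kappa>10 by (simp add: pos_divide_le_eq mult.commute)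
  qed
  define I where "I = 2 * M + 16 * M * R3 / R\<^sup>2 * V"
  have Ib: "0 \<le> I" using M0 Rs V0 by (simp add: I_def)
  define K where "K = 2 * V + 32 * M * R3 / \<kappa>\<^sup>2 * I + 1 / \<omega> * (3 * R3 / (2 * \<epsilon>) * V + T * (M + 1) * (6 * R3 / \<epsilon>\<^sup>2 * I + V / (2 * \<epsilon>)))"
  have K0: "0 \<le> K" using V0 M0 Rs \<kappa>0 Ib \<omega>0 \<epsilon> T unfolding K_def
    by (intro add_nonneg_nonneg mult_nonneg_nonneg divide_nonneg_nonneg) auto
  have vol: "emeasure lborel (cball (0::'a) R3) = ennreal V"
    unfolding V_def using emeasure_compact_finite[of "cball (0::'a) R3"]
    by (intro emeasure_eq_ennreal_measure) (auto simp: less_top)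
  show ?thesis
  proof (rule that[OF K0])
    fix b :: "'a \<Rightarrow> 'a" and Db X DX and t :: real and h :: 'a
    assume db: "\<And>x. (b has_derivative blinfun_apply (Db x)) (at x)" and cD: "continuous_on UNIV Db"
      and bM: "\<And>x. norm (b x) \<le> M" and IM: "(\<integral>\<^sup>+x. ennreal (norm (Db x)) \<partial>lborel) \<le> ennreal M" and bB: "\<And>x. 0 < b x \<bullet> B x"
      and cX: "continuous_on ({0..T} \<times> UNIV) (\<lambda>(t, x). X t x)"
      and X: "\<And>t x. t \<in> {0..T} \<Longrightarrow> ((\<lambda>t. X t x) has_vector_derivative b (X t x)) (at t within {0..T})"
      and init: "\<And>x. X 0 x = x"
      and dX: "\<And>t x. t \<in> {0..T} \<Longrightarrow> (X t has_derivative DX t x) (at x)"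
      and jac: "\<And>t x. t \<in> {0..T} \<Longrightarrow> 1 / C \<le> dt (DX t x)"
      and t: "t \<in> {0..T}" and h: "norm h \<le> 1"
    obtain c Dc where dc: "\<And>x. (c has_derivative blinfun_apply (Dc x)) (at x)" and cDc: "continuous_on UNIV Dc"
      and cnz: "\<And>x. c x \<noteq> 0" and cM: "\<And>x. norm (c x) \<le> M"
      and near: "\<And>x. norm x \<le> R \<Longrightarrow> c x = b x" and far: "\<And>x. 2 * R \<le> norm x \<Longrightarrow> c x = b0 x"
      and Dcb: "\<And>x R3. norm x \<le> R3 \<Longrightarrow> norm (Dc x) \<le> norm (Db0 x) + norm (Db x) + 16 * M * R3 / R\<^sup>2"
      by (rule blended_field[OF db0 cD0 db cD b0M bM b0B bB Rs(4)]) (rule that; assumption)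
    have cc: "continuous_on UNIV c" using dc by (meson continuous_at_imp_continuous_on has_derivative_continuous)
    have cN: "continuous_on A (\<lambda>x. norm (Db x))" "continuous_on A (\<lambda>x. norm (Db0 x))" for A
      by (auto intro!: continuous_intros continuous_on_subset[OF cD] continuous_on_subset[OF cD0])
    have Ic: "(\<integral>\<^sup>+x\<in>cball 0 R3. ennreal (norm (Dc x)) \<partial>lborel) \<le> ennreal I"
    proof -
      define k where "k = 16 * M * R3 / R\<^sup>2"
      have k0: "0 \<le> k" using M0 Rs by (simp add: k_def)
      have "(\<integral>\<^sup>+x\<in>cball 0 R3. ennreal (norm (Dc x)) \<partial>lborel)
        \<le> (\<integral>\<^sup>+x. ennreal k * indicator (cball 0 R3) x + 1 * ennreal (norm (Db0 x)) + 1 * ennreal (norm (Db x)) \<partial>lborel)"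
      proof (intro nn_integral_mono)
        fix x :: 'a
        show "ennreal (norm (Dc x)) * indicator (cball 0 R3) x \<le> ennreal k * indicator (cball 0 R3) x + 1 * ennreal (norm (Db0 x)) + 1 * ennreal (norm (Db x))"
        proof (cases "x \<in> cball 0 R3")
          case True
          then have "norm (Dc x) \<le> k + norm (Db0 x) + norm (Db x)" using Dcb[of x R3] by (simp add: k_def)
          then have "ennreal (norm (Dc x)) \<le> ennreal (k + norm (Db0 x) + norm (Db x))" by (rule ennreal_leI)
          then show ?thesis using True k0 by simp
        qed simp
      qed
      also have "\<dots> = ennreal k * ennreal V + 1 * (\<integral>\<^sup>+x. ennreal (norm (Db0 x)) \<partial>lborel) + 1 * (\<integral>\<^sup>+x. ennreal (norm (Db x)) \<partial>lborel)"
        unfolding vol[symmetric]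
        by (intro nn_integral_affine) (use cN[THEN borel_measurable_continuous_onI] in auto)
      also have "\<dots> \<le> ennreal k * ennreal V + 1 * ennreal M + 1 * ennreal M"
        by (intro add_mono mult_left_mono I0 IM) auto
      also have "\<dots> = ennreal (k * V + M + M)"
        using k0 V0 M0 by (simp only: ennreal_plus ennreal_mult mult_1 add_nonneg_nonneg mult_nonneg_nonneg)
      also have "k * V + M + M = I" by (simp add: I_def k_def)
      finally show ?thesis .
    qed
    have far': "\<epsilon>\<^sup>2 \<le> norm (c x)" if "R2 \<le> norm x" "norm x \<le> R3" for x
      using far[of x] c0(2)[of x] \<epsilon>b(1) that by (simp add: R2_def)
    obtain \<Phi> :: "real \<Rightarrow> 'a \<Rightarrow> 'a" and L :: real where
      \<Phi>0: "\<And>x. \<Phi> 0 x = x"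
      and \<Phi>R: "\<And>x t. x \<in> ball 0 R2 \<Longrightarrow> t \<in> {0..T} \<Longrightarrow> norm (\<Phi> t x) \<le> R3"
      and \<Phi>: "\<And>x t. x \<in> ball 0 R2 \<Longrightarrow> t \<in> {0..T} \<Longrightarrow> ((\<lambda>t. \<Phi> t x) has_vector_derivative
         (1 + \<epsilon>\<^sup>2 / (norm (c (\<Phi> t x)))\<^sup>2) *\<^sub>R c (\<Phi> t x)) (at t within {0..T})"
      and vlip: "\<And>x z. x \<in> cball 0 R3 \<Longrightarrow> z \<in> cball 0 R3 \<Longrightarrow>
         norm ((1 + \<epsilon>\<^sup>2 / (norm (c x))\<^sup>2) *\<^sub>R c x - (1 + \<epsilon>\<^sup>2 / (norm (c z))\<^sup>2) *\<^sub>R c z) \<le> L * norm (x - z)" and L: "0 \<le> L"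
      and cZ: "\<And>t0 t1. \<lbrakk>0 \<le> t0; t0 < t1; t1 \<le> T\<rbrakk> \<Longrightarrow>
       continuous_on (cball 0 R1) (\<lambda>x. x + (1 - cutoff (2 * (norm (c x))\<^sup>2 / \<kappa>\<^sup>2)) *\<^sub>R ((1 / (t1 - t0)) *\<^sub>R integral {t0..t1} (\<lambda>t. \<Phi> t x) - x))"
      and dZ: "\<And>t0 t1 h R0 Z. \<lbrakk>0 \<le> t0; t0 < t1; t1 \<le> T; R0 + norm h \<le> R1;
       Z = (\<lambda>x. x + (1 - cutoff (2 * (norm (c x))\<^sup>2 / \<kappa>\<^sup>2)) *\<^sub>R ((1 / (t1 - t0)) *\<^sub>R integral {t0..t1} (\<lambda>t. \<Phi> t x) - x))\<rbrakk> \<Longrightarrow>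
       (\<integral>\<^sup>+x\<in>cball 0 R0. ennreal (norm (Z (x + h) - Z x)) \<partial>lborel) \<le>
       ennreal (norm h * (2 * V + 32 * M * R3 / \<kappa>\<^sup>2 * I
          + 1 / (t1 - t0) * (3 * R3 / (2 * \<epsilon>) * V + T * (M + 1) * (6 * R3 / \<epsilon>\<^sup>2 * I + V / (2 * \<epsilon>)))))"
      by (rule averaged_flow_variation[OF dc cDc cnz cM Ic Ib \<epsilon>(1) \<kappa>0 \<epsilon>b(2) less_imp_le[OF T] Rs(1,5,10) far', folded V_def];
          (assumption | (rule that; assumption)))
    \<comment> \<open>The window starts at \<open>t\<close> unless that is too close to
      \<open>T\<close>: it has length \<omega> and must end by \<open>T - \<omega>\<close>, where
      the time change still reaches.\<close>
    define t0 where "t0 = min t (T - 2 * \<omega>)"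
    have t0: "0 \<le> t0" "t0 < t0 + \<omega>" "t0 + \<omega> \<le> T" using t \<omega>0 by (auto simp: t0_def)
    define \<psi> where "\<psi> x = 1 - cutoff (2 * (norm (c x))\<^sup>2 / \<kappa>\<^sup>2)" for x
    define Z where "Z x = x + \<psi> x *\<^sub>R ((1 / \<omega>) *\<^sub>R integral {t0..t0 + \<omega>} (\<lambda>t. \<Phi> t x) - x)" for x
    define Q where "Q x = integral {0..T} (\<lambda>s. norm (Db (X s x)))" for x
    \<comment> \<open>Markov's inequality in pointwise form: \<open>W / q * Q x\<close> exceeds the
      trivial bound \<open>W\<close> where \<open>Q x > q\<close>. The error bound stays continuous,
      and the exceptional set itself never has to be measured.\<close>
    define m where "m x = \<eta> + W / q * Q x" for x
    have \<psi>01: "0 \<le> \<psi> x" "\<psi> x \<le> 1" for x using cutoff_bounds by (auto simp: \<psi>_def)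
    have cZ1: "continuous_on (cball 0 R1) Z"
      using cZ[OF t0] by (simp add: Z_def[abs_def] \<psi>_def)
    have QI: "(\<integral>\<^sup>+x\<in>cball 0 R1. ennreal (Q x) \<partial>lborel) \<le> ennreal (T * (C * M))" and cQ: "continuous_on (cball 0 R1) Q"
      using nn_integral_derivative_along_flow[OF db cD IM M0 less_imp_le[OF T] C bM cX X init dX jac, of R1]
      unfolding Q_def by auto
    have Q0: "0 \<le> Q x" for x unfolding Q_def by (cases "(\<lambda>s. norm (Db (X s x))) integrable_on {0..T}") (auto intro: integral_nonneg simp: not_integrable_integral)
    have m0: "0 \<le> m x" for x using \<eta>0 W0 q0 Q0 by (simp add: m_def)
    have cm: "continuous_on (cball 0 R1) m" unfolding m_def by (intro continuous_intros cQ)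
    have close: "norm (X t x - Z x) \<le> m x" if x: "x \<in> cball 0 R1" for x
    proof -
      have xb: "x \<in> ball 0 R2" using x Rs by auto
      have XR: "norm (X s x) \<le> R" if s: "s \<in> {0..T}" for s
      proof -
        have "norm (X s x - X 0 x) \<le> M * \<bar>s - 0\<bar>" by (rule solution_speed_bound[OF X]) (use bM s T in auto)
        also have "\<dots> \<le> M * T" using s M0 by (intro mult_left_mono) auto
        finally have "norm (X s x) \<le> norm x + M * T" using norm_triangle_sub[of "X s x" x] by (simp add: init)
        then show ?thesis using x Rs by simp
      qed
      show ?thesis
      proof (cases "Q x \<le> q")
        case True
        have "norm (X t x - (x + \<psi> x *\<^sub>R ((1 / \<omega>) *\<^sub>R integral {t0..t0 + \<omega>} (\<lambda>t. \<Phi> t x) - x))) \<le> \<eta>"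
        proof (rule flow_approximation[where v = "\<lambda>x. (1 + \<epsilon>\<^sup>2 / (norm (c x))\<^sup>2) *\<^sub>R c x" and c = c and q = q and \<kappa> = \<kappa> and L = L and ?R3.0 = R3 and T = T and \<epsilon> = \<epsilon>, OF db cD bM cM])
          show "b x \<noteq> 0" for x using bB[of x] by auto
          show "norm (X s x) \<le> R3" if "s \<in> {0..T}" for s using XR[OF that] Rs by simp
          show "c (X s x) = b (X s x)" if "s \<in> {0..T}" for s using near[OF XR[OF that]] .
          show "integral {0..T} (\<lambda>s. norm (Db (X s x))) \<le> q" using True by (simp add: Q_def)
          show "T * (\<epsilon>\<^sup>2 / (\<kappa> / 2 * exp (- q))\<^sup>2) \<le> \<omega>" using \<epsilon>b(3) by (simp add: \<kappa>1_def)
        qed (use cc X \<Phi> \<Phi>R \<Phi>0 init xb vlip L \<kappa>0 \<kappa>e \<omega>0 \<omega>M t t0_def \<psi>_def in auto)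
        then have "norm (X t x - Z x) \<le> \<eta>" by (simp add: Z_def)
        moreover have "0 \<le> W / q * Q x" using W0 q0 Q0 by simp
        ultimately show ?thesis by (simp add: m_def)
      next
        case False
        have "norm ((1 / (t0 + \<omega> - t0)) *\<^sub>R integral {t0..t0 + \<omega>} (\<lambda>t. \<Phi> t x) - 0) \<le> R3"
        proof (rule interval_average_norm_le)
          have "continuous_on {0..T} (\<lambda>t. \<Phi> t x)"
            using \<Phi>[OF xb] by (meson continuous_on_eq_continuous_within has_vector_derivative_continuous)
          then show "continuous_on {t0..t0 + \<omega>} (\<lambda>t. \<Phi> t x)" by (rule continuous_on_subset) (use t0 in auto)
        qed (use t0 \<Phi>R[OF xb] in auto)
        then have A: "norm ((1 / \<omega>) *\<^sub>R integral {t0..t0 + \<omega>} (\<lambda>t. \<Phi> t x) - x) \<le> R3 + R3"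
          using x Rs by (intro order_trans[OF norm_triangle_ineq4] add_mono) auto
        have "norm (\<psi> x *\<^sub>R ((1 / \<omega>) *\<^sub>R integral {t0..t0 + \<omega>} (\<lambda>t. \<Phi> t x) - x)) \<le> 1 * (R3 + R3)"
          unfolding norm_scaleR using \<psi>01[of x] A by (intro mult_mono) auto
        then have "norm (Z x) \<le> R3 + (R3 + R3)"
          unfolding Z_def using x Rs by (intro norm_triangle_le add_mono) auto
        then have "norm (X t x - Z x) \<le> W"
          using norm_triangle_ineq4[of "X t x" "Z x"] XR[OF t] Rs by (simp add: W_def)
        also have "W \<le> W / q * Q x" using False W0 q0 by (simp add: divide_simps)
        finally show ?thesis using \<eta>0 by (simp add: m_def)
      qed
    qed
    have Im: "(\<integral>\<^sup>+x\<in>cball 0 R1. ennreal (m x) \<partial>lborel) \<le> ennreal (e / 2)"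
    proof -
      have "(\<integral>\<^sup>+x\<in>cball 0 R1. ennreal (m x) \<partial>lborel) =
        (\<integral>\<^sup>+x. ennreal \<eta> * indicator (cball 0 R1) x + ennreal (W / q) * (ennreal (Q x) * indicator (cball 0 R1) x) + 0 * 0 \<partial>lborel)"
      proof (intro nn_integral_cong)
        fix x
        have "ennreal (m x) = ennreal \<eta> + ennreal (W / q) * ennreal (Q x)"
          unfolding m_def using \<eta>0 W0 q0 Q0[of x] by (subst ennreal_plus) (auto simp flip: ennreal_mult)
        then show "ennreal (m x) * indicator (cball 0 R1) x =
           ennreal \<eta> * indicator (cball 0 R1) x + ennreal (W / q) * (ennreal (Q x) * indicator (cball 0 R1) x) + 0 * 0"
          by (simp add: distrib_right mult.assoc)
      qed
      also have "\<dots> = ennreal \<eta> * emeasure lborel (cball (0::'a) R1) + ennreal (W / q) * (\<integral>\<^sup>+x\<in>cball 0 R1. ennreal (Q x) \<partial>lborel) + 0 * (\<integral>\<^sup>+x. 0 \<partial>(lborel :: 'a measure))"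
        by (rule nn_integral_affine) (use borel_measurable_ennreal_indicator[OF cQ] in auto)
      also have "\<dots> \<le> ennreal \<eta> * ennreal V + ennreal (W / q) * ennreal (T * (C * M)) + 0"
        unfolding vol[symmetric] using Rs by (intro add_mono mult_left_mono QI emeasure_mono) auto
      also have "\<dots> = ennreal (\<eta> * V + W / q * (T * (C * M)))"
        using \<eta>0 V0 W0 q0 T C M0 by (subst ennreal_plus) (auto simp flip: ennreal_mult)
      also have "\<dots> \<le> ennreal (e / 2)"
      proof (rule ennreal_leI)
        have "\<eta> * V \<le> \<eta> * (V + 1)" using \<eta>0 by simp
        also have "\<dots> = e / 4" using V0 by (simp add: \<eta>_def divide_simps)
        finally have 1: "\<eta> * V \<le> e / 4" .
        have "4 * W * (T * (C * M)) / e \<le> q" by (simp add: q_def)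
        then have "4 * W * (T * (C * M)) \<le> q * e" using e by (simp add: pos_divide_le_eq)
        then have "W / q * (T * (C * M)) \<le> e / 4" using q0 by (simp add: divide_simps) (simp add: mult_ac)
        with 1 show "\<eta> * V + W / q * (T * (C * M)) \<le> e / 2" by linarith
      qed
      finally show ?thesis .
    qed
    have R01: "R0 + norm h \<le> R1" using h by (simp add: R1_def)
    have sub: "x + h \<in> cball 0 R1" "x \<in> cball 0 R1" if "x \<in> cball 0 R0" for x
      using add_mem_cball_0[OF that _ R01, of 1] that by (auto simp: R1_def)
    have ch: "continuous_on (cball 0 R0) (\<lambda>x. f (x + h))" if "continuous_on (cball 0 R1) f" for f :: "'a \<Rightarrow> 'b::topological_space"
      by (rule continuous_on_compose2[OF that]) (use sub in \<open>auto intro!: continuous_intros\<close>)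
    have sub0: "cball 0 R0 \<subseteq> cball (0::'a) R1" by (auto simp: R1_def)
    have "(\<integral>\<^sup>+x\<in>cball 0 R0. ennreal (norm (X t (x + h) - X t x)) \<partial>lborel)
       \<le> (\<integral>\<^sup>+x\<in>cball 0 R0. ennreal (m (x + h) + m x + norm (Z (x + h) - Z x)) \<partial>lborel)"
    proof (intro nn_integral_mono)
      fix x
      have "norm (X t (x + h) - X t x) \<le> m (x + h) + m x + norm (Z (x + h) - Z x)" if x: "x \<in> cball 0 R0"
      proof -
        have "X t (x + h) - X t x = (X t (x + h) - Z (x + h)) - (X t x - Z x) + (Z (x + h) - Z x)" by simp
        also have "norm \<dots> \<le> norm (X t (x + h) - Z (x + h)) + norm (X t x - Z x) + norm (Z (x + h) - Z x)"
          by (intro norm_triangle_le add_right_mono norm_triangle_ineq4)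
        also have "\<dots> \<le> m (x + h) + m x + norm (Z (x + h) - Z x)"
          by (intro add_right_mono add_mono close sub x)
        finally show ?thesis .
      qed
      then show "ennreal (norm (X t (x + h) - X t x)) * indicator (cball 0 R0) x \<le> ennreal (m (x + h) + m x + norm (Z (x + h) - Z x)) * indicator (cball 0 R0) x"
        by (cases "x \<in> cball 0 R0") (auto intro!: ennreal_leI)
    qed
    also have "\<dots> = (\<integral>\<^sup>+x\<in>cball 0 R0. ennreal (m (x + h)) \<partial>lborel) + (\<integral>\<^sup>+x\<in>cball 0 R0. ennreal (m x) \<partial>lborel)
        + (\<integral>\<^sup>+x\<in>cball 0 R0. ennreal (norm (Z (x + h) - Z x)) \<partial>lborel)"
      by (intro nn_integral_add3_continuous_on continuous_intros ch cm cZ1 continuous_on_subset[OF cm sub0] continuous_on_subset[OF cZ1 sub0] m0) auto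
    \<comment> \<open>The approximation error occurs twice, at \<open>x\<close> and at
      \<open>x + h\<close>, and the second is moved to the larger ball by translation; hence the
      halves.\<close>
    also have "\<dots> \<le> ennreal (e / 2) + ennreal (e / 2) + ennreal (K * norm h)"
    proof (intro add_mono)
      show "(\<integral>\<^sup>+x\<in>cball 0 R0. ennreal (m (x + h)) \<partial>lborel) \<le> ennreal (e / 2)"
        using nn_integral_translate_le[OF cm _ R01, of 1] Im by (auto intro: order_trans)
      show "(\<integral>\<^sup>+x\<in>cball 0 R0. ennreal (m x) \<partial>lborel) \<le> ennreal (e / 2)"
        by (rule order_trans[OF nn_integral_mono Im]) (use sub in \<open>auto simp: indicator_def\<close>)
      show "(\<integral>\<^sup>+x\<in>cball 0 R0. ennreal (norm (Z (x + h) - Z x)) \<partial>lborel) \<le> ennreal (K * norm h)"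
        using dZ[OF t0 R01, of Z] by (simp add: K_def mult.commute Z_def[abs_def] \<psi>_def)
    qed
    also have "\<dots> = ennreal (e + K * norm h)" using e K0 by (simp flip: ennreal_plus)
    finally show "(\<integral>\<^sup>+x\<in>cball 0 R0. ennreal (norm (X t (x + h) - X t x)) \<partial>lborel) \<le> ennreal (e + K * norm h)" .
  qed
qed

end

subsection \<open>Coordinate planes\<close>

lemma det_doubleton:
  fixes A :: "real^'n^'n"
  assumes U: "(UNIV :: 'n set) = {i, j}" and ij: "i \<noteq> j"
  shows "det A = A $ i $ i * A $ j $ j - A $ i $ j * A $ j $ i"
proof -
  have "{p. p permutes (UNIV :: 'n set)} = {id, Transposition.transpose i j}"
    unfolding U by (auto simp: permutes_doubleton_iff)
  moreover have "id \<noteq> Transposition.transpose i j" using ij by (metis id_apply transpose_apply_first)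
  moreover have "sign (Transposition.transpose i j) = - 1" using ij by (simp add: sign_swap_id)
  ultimately show ?thesis
    using ij by (simp add: det_def sign_id U)
qed

lemma matrix_vector_doubleton:
  fixes P :: "real^'n \<Rightarrow> real^'n"
  assumes U: "(UNIV :: 'n set) = {i, j}" and ij: "i \<noteq> j" and P: "linear P"
  shows "P y $ k = matrix P $ k $ i * y $ i + matrix P $ k $ j * y $ j"
proof -
  have all: "l = i \<or> l = j" for l using U by blast
  have "y = y $ i *\<^sub>R axis i 1 + y $ j *\<^sub>R axis j 1"
    using all ij by (auto simp: vec_eq_iff axis_def)
  from arg_cong[OF this, of P] have "P y = y $ i *\<^sub>R P (axis i 1) + y $ j *\<^sub>R P (axis j 1)"
    unfolding linear_add[OF P] linear_scale[OF P] .
  then show ?thesis by (simp add: matrix_def)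
qed

lemma prod_Basis_cart:
  fixes x :: "real^'n"
  shows "(\<Prod>b\<in>Basis. x \<bullet> b) = (\<Prod>k\<in>UNIV. x $ k)"
proof -
  have B: "(Basis :: (real^'n) set) = (\<lambda>k. axis k 1) ` UNIV" by (auto simp: Basis_vec_def)
  have "inj (\<lambda>k::'n. axis k (1::real))" by (auto simp: inj_on_def axis_eq_axis)
  then show ?thesis unfolding B by (subst prod.reindex) (simp_all add: inner_axis)
qed

text \<open>The change of variables theorem of the library requires a well-ordered index type, so it is applied
  in \<open>real^2\<close> and transported along the coordinate bijection.\<close>

lemma change_of_variables_2:
  fixes g :: "real^2 \<Rightarrow> real^2"
  assumes S: "compact S" and inj: "inj_on g S" and der: "\<And>x. x \<in> S \<Longrightarrow> (g has_derivative g' x) (at x within S)"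
    and H: "continuous_on UNIV H" "\<And>y. 0 \<le> H y"
  shows "(\<integral>\<^sup>+x\<in>S. ennreal (\<bar>det (matrix (g' x))\<bar> * H (g x)) \<partial>lborel) = (\<integral>\<^sup>+y\<in>g ` S. ennreal (H y) \<partial>lborel)"
proof -
  \<comment> \<open>The change of variables theorem is applied to vector-valued integrands, so
    \<open>H\<close> enters as a field with values in \<open>real^1\<close> and is read off from the
    coordinate afterwards.\<close>
  let ?f = "\<lambda>y. vec (H y) :: real^1"
  have cg: "continuous_on S g" using der by (rule has_derivative_continuous_on)
  have gS: "compact (g ` S)" by (rule compact_continuous_image[OF cg S])
  have cf: "continuous_on (g ` S) ?f"
    using continuous_on_subset[OF H(1), of "g ` S"] by (intro continuous_on_vec_lambda[of _ "\<lambda>_. H", folded vec_def]) auto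
  have "(\<lambda>y. indicator (g ` S) y *\<^sub>R ?f y) \<in> borel_measurable borel"
    using gS by (intro borel_measurable_continuous_on_indicator cf borel_closed compact_imp_closed)
  then have f: "?f absolutely_integrable_on (g ` S)"
    using borel_integrable_compact[OF gS cf] unfolding set_integrable_def by (simp add: integrable_completion)
  let ?h = "\<lambda>x. \<bar>det (matrix (g' x))\<bar> *\<^sub>R ?f (g x)"
  define I where "I = integral (g ` S) ?f"
  have h: "?h absolutely_integrable_on S" "integral S ?h = I"
    using has_absolute_integral_change_of_variables_compact[OF S der inj, of ?f I] f I_def by auto
  have "(?h has_integral I) S" using set_lebesgue_integral_eq_integral(1)[OF h(1)] h(2) by (simp add: has_integral_iff)
  then have 1: "((\<lambda>x. \<bar>det (matrix (g' x))\<bar> * H (g x)) has_integral I $ 1) S"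
    by (subst (asm) has_integral_componentwise_iff) (auto simp: Basis_vec_def inner_axis)
  have "(?f has_integral I) (g ` S)" using set_lebesgue_integral_eq_integral(1)[OF f] by (simp add: has_integral_iff I_def)
  then have 2: "(H has_integral I $ 1) (g ` S)"
    by (subst (asm) has_integral_componentwise_iff) (auto simp: Basis_vec_def inner_axis)
  show ?thesis
    using nn_integral_has_integral_lebesgue'[OF _ 1] nn_integral_has_integral_lebesgue'[OF _ 2] H(2) by simp
qed

text \<open>Valid for arbitrary \<open>f\<close>: simple functions below \<open>f\<close> are
  measurable, and they suffice for this inequality. It is applied to an integrand containing
  \<open>det (matrix (g' x))\<close>, for which no measurability in \<open>x\<close> is at hand;
  hence the change of variables is an inequality in the plane.\<close>

lemma nn_integral_distr_le:
  fixes f :: "'b \<Rightarrow> ennreal"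
  assumes T: "T \<in> measurable M N"
  shows "(\<integral>\<^sup>+y. f y \<partial>distr M N T) \<le> (\<integral>\<^sup>+x. f (T x) \<partial>M)"
  unfolding nn_integral_def[of "distr M N T"]
proof (rule SUP_least)
  fix s assume "s \<in> {g. simple_function (distr M N T) g \<and> g \<le> f}"
  then have s: "simple_function (distr M N T) s" "s \<le> f" by auto
  have "integral\<^sup>S (distr M N T) s = (\<integral>\<^sup>+y. s y \<partial>distr M N T)"
    by (rule nn_integral_eq_simple_integral[OF s(1), symmetric])
  also have "\<dots> = (\<integral>\<^sup>+x. s (T x) \<partial>M)"
    using borel_measurable_simple_function[OF s(1)] by (intro nn_integral_distr T) simp
  also have "\<dots> \<le> (\<integral>\<^sup>+x. f (T x) \<partial>M)"
    using s(2) by (intro nn_integral_mono) (simp add: le_fun_def)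
  finally show "integral\<^sup>S (distr M N T) s \<le> (\<integral>\<^sup>+x. f (T x) \<partial>M)" .
qed

lemma change_of_variables_doubleton:
  fixes g :: "real^'n \<Rightarrow> real^'n"
  assumes U: "(UNIV :: 'n set) = {i, j}" and ij: "i \<noteq> j"
    and S: "compact S" and inj: "inj_on g S" and der: "\<And>x. x \<in> S \<Longrightarrow> (g has_derivative g' x) (at x within S)"
    and H: "continuous_on UNIV H" "\<And>y. 0 \<le> H y"
  shows "(\<integral>\<^sup>+x\<in>S. ennreal (\<bar>det (matrix (g' x))\<bar> * H (g x)) \<partial>lborel) \<le> (\<integral>\<^sup>+y\<in>g ` S. ennreal (H y) \<partial>lborel)"
proof -
  have all: "(\<forall>k. Q k) \<longleftrightarrow> Q i \<and> Q j" for Q using U by (metis UNIV_I empty_iff insert_iff)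
  define \<iota> where "\<iota> z = (\<chi> k. if k = i then z $ 1 else z $ 2)" for z :: "real^2"
  define \<iota>' where "\<iota>' x = (\<chi> k::2. if k = 1 then x $ i else x $ j)" for x :: "real^'n"
  have inv: "\<iota> (\<iota>' x) = x" "\<iota>' (\<iota> z) = z" for x z
    using ij by (auto simp: \<iota>_def \<iota>'_def vec_eq_iff all forall_2)
  have lin: "linear \<iota>" "linear \<iota>'" by (auto intro!: linearI simp: \<iota>_def \<iota>'_def vec_eq_iff)
  have c\<iota>: "continuous_on A \<iota>" "continuous_on B \<iota>'" for A B
    using lin by (simp_all add: linear_continuous_on linear_conv_bounded_linear)
  \<comment> \<open>\<iota> only relabels coordinates, so the preimage of a box is a box with the
    same side lengths.\<close>
  have meas: "distr lborel borel \<iota> = lborel"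
  proof (rule lborel_eqI[symmetric])
    fix l u :: "real^'n" assume lu: "\<And>b. b \<in> Basis \<Longrightarrow> l \<bullet> b \<le> u \<bullet> b"
    have "l $ k \<le> u $ k" for k using lu[of "axis k 1"] by (auto simp: inner_axis Basis_vec_def)
    then have le: "(\<iota>' l) \<bullet> b \<le> (\<iota>' u) \<bullet> b" if "b \<in> Basis" for b
      using that by (auto simp: Basis_vec_def inner_axis \<iota>'_def)
    have "\<iota> -` box l u = box (\<iota>' l) (\<iota>' u)"
      using ij by (auto simp: mem_box_cart \<iota>_def \<iota>'_def all forall_2)
    then have "emeasure (distr lborel borel \<iota>) (box l u) = emeasure lborel (box (\<iota>' l) (\<iota>' u))"
      by (subst emeasure_distr) (auto intro: borel_measurable_continuous_onI c\<iota>)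
    also have "\<dots> = (\<Prod>b\<in>Basis. (\<iota>' u - \<iota>' l) \<bullet> b)"
      by (rule emeasure_lborel_box) (rule le)
    also have "(\<Prod>b\<in>Basis. (\<iota>' u - \<iota>' l) \<bullet> b) = (\<Prod>b\<in>Basis. (u - l) \<bullet> b)"
      unfolding prod_Basis_cart using ij by (simp add: U UNIV_2 \<iota>'_def)
    finally show "emeasure (distr lborel borel \<iota>) (box l u) = (\<Prod>b\<in>Basis. (u - l) \<bullet> b)" .
  qed simp
  have m\<iota>: "\<iota> \<in> borel_measurable lborel" using borel_measurable_continuous_onI[OF c\<iota>(1)] by simp
  define S2 where "S2 = \<iota>' ` S"
  define g2 where "g2 z = \<iota>' (g (\<iota> z))" for z
  define g2' where "g2' z u = \<iota>' (g' (\<iota> z) (\<iota> u))" for z u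
  have \<iota>S: "\<iota> z \<in> S \<longleftrightarrow> z \<in> S2" for z unfolding S2_def using inv by (metis image_iff)
  have gS: "\<iota> y \<in> g ` S \<longleftrightarrow> y \<in> g2 ` S2" for y
    unfolding g2_def S2_def using inv by (auto simp: image_iff) (metis inv)+
  have S2: "compact S2" unfolding S2_def by (intro compact_continuous_image c\<iota> S)
  have inj2: "inj_on g2 S2"
    using inj \<iota>S unfolding inj_on_def g2_def by (metis inv)
  have der2: "(g2 has_derivative g2' z) (at z within S2)" if z: "z \<in> S2" for z
  proof -
    have b: "bounded_linear \<iota>" "bounded_linear \<iota>'" using lin by (auto simp: linear_conv_bounded_linear)
    have im: "\<iota> ` S2 = S" unfolding S2_def by (simp add: image_image inv)
    have "(\<iota> has_derivative \<iota>) (at z within S2)" by (rule bounded_linear_imp_has_derivative[OF b(1)])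
    moreover have "(g has_derivative g' (\<iota> z)) (at (\<iota> z) within \<iota> ` S2)" using der[of "\<iota> z"] z \<iota>S im by simp
    ultimately have "(g \<circ> \<iota> has_derivative g' (\<iota> z) \<circ> \<iota>) (at z within S2)" by (rule diff_chain_within)
    from bounded_linear.has_derivative[OF b(2) this] show ?thesis
      by (simp add: g2_def[abs_def] g2'_def[abs_def] o_def)
  qed
  have det2: "det (matrix (g2' z)) = det (matrix (g' (\<iota> z)))" for z
  proof -
    have ax: "\<iota> (axis 1 1) = axis i 1" "\<iota> (axis 2 1) = axis j 1"
      using ij by (auto simp: \<iota>_def axis_def vec_eq_iff all)
    show ?thesis
      unfolding det_doubleton[OF U ij] det_2 by (simp add: matrix_def g2'_def ax) (simp add: \<iota>'_def)
  qed
  have cH: "continuous_on UNIV (\<lambda>z. H (\<iota> z))" by (rule continuous_on_compose2[OF H(1) c\<iota>(1)]) simp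
  have gSc: "compact (g ` S)"
    by (intro compact_continuous_image S has_derivative_continuous_on[OF der])
  have "(\<integral>\<^sup>+x\<in>S. ennreal (\<bar>det (matrix (g' x))\<bar> * H (g x)) \<partial>lborel)
     = (\<integral>\<^sup>+x\<in>S. ennreal (\<bar>det (matrix (g' x))\<bar> * H (g x)) \<partial>distr lborel borel \<iota>)" unfolding meas ..
  also have "\<dots> \<le> (\<integral>\<^sup>+z. ennreal (\<bar>det (matrix (g' (\<iota> z)))\<bar> * H (g (\<iota> z))) * indicator S (\<iota> z) \<partial>lborel)"
    using m\<iota> by (intro nn_integral_distr_le) simp
  also have "\<dots> = (\<integral>\<^sup>+z\<in>S2. ennreal (\<bar>det (matrix (g2' z))\<bar> * H (\<iota> (g2 z))) \<partial>lborel)"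
    by (intro nn_integral_cong) (auto simp: indicator_def \<iota>S det2 g2_def inv)
  also have "\<dots> = (\<integral>\<^sup>+z\<in>g2 ` S2. ennreal (H (\<iota> z)) \<partial>lborel)"
    by (rule change_of_variables_2[OF S2 inj2 der2 cH]) (use H in auto)
  also have "\<dots> = (\<integral>\<^sup>+z. ennreal (H (\<iota> z)) * indicator (g ` S) (\<iota> z) \<partial>lborel)"
    by (intro nn_integral_cong) (auto simp: indicator_def gS)
  also have "\<dots> = (\<integral>\<^sup>+y\<in>g ` S. ennreal (H y) \<partial>distr lborel borel \<iota>)"
  proof (rule nn_integral_distr[symmetric])
    show "(\<lambda>y. ennreal (H y) * indicator (g ` S) y) \<in> borel_measurable (distr lborel borel \<iota>)"
      using borel_measurable_ennreal_indicator[OF continuous_on_subset[OF H(1)] borel_closed[OF compact_imp_closed[OF gSc]]] by simp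
  qed (use m\<iota> in simp)
  finally show ?thesis unfolding meas .
qed

lemma plane_real_vec_2:
  assumes U: "(UNIV :: 'n set) = {i, j}" and ij: "i \<noteq> j"
  shows "plane (\<lambda>x::real^'n. \<chi> k. if k = i then - x $ j else x $ i) (\<lambda>P. det (matrix P))"
proof (rule plane.intro)
  let ?perp = "\<lambda>x::real^'n. \<chi> k. if k = i then - x $ j else x $ i"
  have all: "(\<forall>k. Q k) \<longleftrightarrow> Q i \<and> Q j" for Q using U by (metis UNIV_I empty_iff insert_iff)
  have sum: "(\<Sum>k\<in>UNIV. f k) = f i + f j" for f :: "'n \<Rightarrow> real" using ij by (simp add: U)
  have inner: "x \<bullet> y = x $ i * y $ i + x $ j * y $ j" for x y :: "real^'n" by (simp add: inner_vec_def sum)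
  show "linear ?perp" by (rule linearI) (auto simp: vec_eq_iff)
  show "norm (?perp x) = norm x" for x
  proof -
    have "?perp x \<bullet> ?perp x = x \<bullet> x" unfolding inner using ij by simp
    then show ?thesis unfolding norm_eq_sqrt_inner by simp
  qed
  show "(x \<bullet> x) *\<^sub>R p = (x \<bullet> p) *\<^sub>R x + (?perp x \<bullet> p) *\<^sub>R ?perp x" for x p
    unfolding vec_eq_iff all inner using ij by (simp add: algebra_simps)
  show "?perp (P x) \<bullet> P y = det (matrix P) * (?perp x \<bullet> y)" if P: "linear P" for P x y
    unfolding inner det_doubleton[OF U ij] matrix_vector_doubleton[OF U ij P] using ij by (simp add: algebra_simps)
  show "(\<integral>\<^sup>+x\<in>S. ennreal (\<bar>det (matrix (g' x))\<bar> * H (g x)) \<partial>lborel) \<le> (\<integral>\<^sup>+y\<in>g ` S. ennreal (H y) \<partial>lborel)"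
    if "compact S" "inj_on g S" "\<And>x. x \<in> S \<Longrightarrow> (g has_derivative g' x) (at x within S)"
      "continuous_on UNIV H" "\<And>y. 0 \<le> H y" for S :: "(real^'n) set" and g g' and H :: "real^'n \<Rightarrow> real"
    by (rule change_of_variables_doubleton[OF U ij that])
qed

subsection \<open>Strong compactness from a shift modulus\<close>

text \<open>The increments have summable L^1 norms, so their series converges absolutely almost
  everywhere. The constant \<open>W\<close> on the compact set \<open>S\<close> dominates, which
  turns this into convergence in L^1.\<close>

lemma L1_subsequence_limit:
  fixes u :: "nat \<Rightarrow> 'c::euclidean_space \<Rightarrow> 'b::euclidean_space"
  assumes S: "compact S" and c: "\<And>n. continuous_on S (u n)"
    and W: "\<And>n z. z \<in> S \<Longrightarrow> norm (u n z) \<le> W"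
    and small: "\<And>n. (\<integral>\<^sup>+z\<in>S. ennreal (norm (u (Suc n) z - u n z)) \<partial>lborel) \<le> ennreal ((1/2) ^ n)"
  obtains Y where "set_integrable lborel S Y"
    "(\<lambda>k. LINT z:S|lborel. norm (u k z - Y z)) \<longlonglongrightarrow> 0"
proof -
  have Sb: "S \<in> sets borel" using S by (intro borel_closed compact_imp_closed)
  define U where "U n z = indicator S z *\<^sub>R u n z" for n z
  have mU[measurable]: "U n \<in> borel_measurable lborel" for n
    unfolding U_def using borel_measurable_continuous_on_indicator[OF Sb c] by simp
  have UW: "norm (U n z) \<le> W * indicator S z" for n z
    using W[of z n] by (auto simp: U_def indicator_def)
  have eq: "ennreal (norm (U (Suc n) z - U n z)) = ennreal (norm (u (Suc n) z - u n z)) * indicator S z" for n z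
    by (auto simp: U_def indicator_def)
  have "(\<integral>\<^sup>+z. (\<Sum>n. ennreal (norm (U (Suc n) z - U n z))) \<partial>lborel) = (\<Sum>n. (\<integral>\<^sup>+z. ennreal (norm (U (Suc n) z - U n z)) \<partial>lborel))"
    by (rule nn_integral_suminf) measurable
  also have "\<dots> \<le> (\<Sum>n. ennreal ((1/2) ^ n))"
    using small unfolding eq by (intro suminf_le) auto
  also have "\<dots> = ennreal (\<Sum>n. (1/2) ^ n)"
    by (intro suminf_ennreal2) (auto intro: summable_geometric)
  also have "\<dots> < \<infinity>" by simp
  finally have fin: "(\<integral>\<^sup>+z. (\<Sum>n. ennreal (norm (U (Suc n) z - U n z))) \<partial>lborel) \<noteq> \<infinity>" by simp
  have "AE z in lborel. (\<Sum>n. ennreal (norm (U (Suc n) z - U n z))) \<noteq> \<infinity>"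
    by (rule nn_integral_PInf_AE[OF _ fin]) measurable
  then have conv: "AE z in lborel. convergent (\<lambda>n. U n z)"
  proof (rule AE_mp, intro AE_I2 impI)
    fix z assume "(\<Sum>n. ennreal (norm (U (Suc n) z - U n z))) \<noteq> \<infinity>"
    then have "summable (\<lambda>n. norm (U (Suc n) z - U n z))"
      by (intro summable_suminf_not_top) (auto simp: top_ennreal_def infinity_ennreal_def)
    then have "summable (\<lambda>n. U (Suc n) z - U n z)" by (rule summable_norm_cancel)
    then show "convergent (\<lambda>n. U n z)" 
      unfolding summable_iff_convergent sum_lessThan_telescope[of "\<lambda>n. U n z"] convergent_diff_const_right_iff .
  qed
  define Y where "Y z = lim (\<lambda>n. U n z)" for z
  have mY[measurable]: "Y \<in> borel_measurable lborel" unfolding Y_def by measurable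
  have limY: "AE z in lborel. (\<lambda>n. U n z) \<longlonglongrightarrow> Y z"
    using conv by eventually_elim (simp add: Y_def convergent_LIMSEQ_iff)
  have iW: "integrable lborel (\<lambda>z. W * indicator S z)"
    using emeasure_compact_finite[OF S] Sb by (intro integrable_mult_right integrable_real_indicator) auto
  have iY: "integrable lborel Y"
    by (rule integrable_dominated_convergence[OF _ _ iW limY]) (auto simp: UW)
  have iYS: "set_integrable lborel S Y"
    unfolding set_integrable_def using iY Sb by (intro integrable_mult_indicator) auto
  have YW: "AE z in lborel. norm (Y z) \<le> W * indicator S z"
    using limY
  proof eventually_elim
    case (elim z)
    show ?case by (rule tendsto_upperbound[OF tendsto_norm[OF elim]]) (auto simp: UW)
  qed
  define D where "D k z = indicator S z * norm (U k z - Y z)" for k z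
  have [measurable]: "S \<in> sets lborel" using Sb by simp
  have D1: "D k \<in> borel_measurable lborel" for k unfolding D_def by measurable
  have D2: "AE z in lborel. (\<lambda>k. D k z) \<longlonglongrightarrow> 0"
    using limY
  proof eventually_elim
    case (elim z)
    have "(\<lambda>k. norm (U k z - Y z)) \<longlonglongrightarrow> 0" using elim by (simp add: tendsto_norm_zero LIM_zero)
    then show ?case unfolding D_def by (rule tendsto_mult_right_zero)
  qed
  have D3: "AE z in lborel. norm (D k z) \<le> 2 * (W * indicator S z)" for k
    using YW
  proof eventually_elim
    case (elim z)
    have "norm (U k z - Y z) \<le> 2 * (W * indicator S z)"
      using UW[of k z] elim norm_triangle_ineq4[of "U k z" "Y z"] by simp
    then show ?case unfolding D_def by (auto simp: indicator_def)
  qed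
  have "integrable lborel (\<lambda>z. 2 * (W * indicator S z))" using iW by simp
  from integral_dominated_convergence[OF borel_measurable_const D1 this D2 D3]
  have "(\<lambda>k. integral\<^sup>L lborel (D k)) \<longlonglongrightarrow> 0" by simp
  moreover have "D k = (\<lambda>z. indicator S z *\<^sub>R norm (u k z - Y z))" for k
    by (auto simp: D_def U_def indicator_def fun_eq_iff)
  ultimately show ?thesis using that[OF iYS] by (simp add: set_lebesgue_integral_def)
qed

text \<open>Total boundedness in L^1 by approximation: for each \<open>e\<close> the theorem of
  Arzela and Ascoli is applied to the equi-Lipschitz \<open>g n\<close>, and the selected
  \<open>f n\<close> are mutually within \<open>e\<close>. Diagonalizing over the values
  \<open>(1/2) ^ n\<close> produces summable increments.\<close>

lemma L1_compact_sequence: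
  fixes f :: "nat \<Rightarrow> 'c::euclidean_space \<Rightarrow> 'b::euclidean_space"
  assumes S: "compact S" and c: "\<And>n. continuous_on S (f n)"
    and W: "\<And>n z. z \<in> S \<Longrightarrow> norm (f n z) \<le> W"
    and approx: "\<And>e. 0 < e \<Longrightarrow> \<exists>g B L. (\<forall>n. \<forall>z\<in>S. norm (g n z) \<le> B) \<and> 0 \<le> L
       \<and> (\<forall>n. \<forall>z\<in>S. \<forall>z'\<in>S. norm (g n z - g n z') \<le> L * norm (z - z'))
       \<and> (\<forall>n. (\<integral>\<^sup>+z\<in>S. ennreal (norm (f n z - g n z)) \<partial>lborel) \<le> ennreal e)"
  shows "\<exists>r Y. strict_mono (r :: nat \<Rightarrow> nat) \<and> set_integrable lborel S Y
      \<and> (\<lambda>k. LINT z:S|lborel. norm (f (r k) z - Y z)) \<longlonglongrightarrow> 0"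
proof -
  have Sb: "S \<in> sets borel" using S by (intro borel_closed compact_imp_closed)
  have sub: "\<exists>r'::nat \<Rightarrow> nat. strict_mono r' \<and> (\<forall>j k. (\<integral>\<^sup>+z\<in>S. ennreal (norm (f ((r \<circ> r') j) z - f ((r \<circ> r') k) z)) \<partial>lborel) \<le> ennreal e)"
    if e: "0 < e" for e and r :: "nat \<Rightarrow> nat"
  proof -
    define V where "V = measure lborel S"
    have vol: "emeasure lborel S = ennreal V"
      unfolding V_def using emeasure_compact_finite[OF S]
      by (intro emeasure_eq_ennreal_measure) (auto simp: less_top)
    have V0: "0 \<le> V" by (simp add: V_def)
    \<comment> \<open>Each of the two compared functions is replaced by its approximation at cost
      \<open>e / 4\<close>; the remaining \<open>e / 2\<close> is for the uniform distance
      \<open>2 * \<eta>\<close> of the approximations.\<close>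
    have "0 < e / 4" using e by simp
    from approx[OF this] obtain g B L where gBL: "\<forall>n. \<forall>z\<in>S. norm (g n z) \<le> B" and L: "0 \<le> L"
      and gLL: "\<forall>n. \<forall>z\<in>S. \<forall>z'\<in>S. norm (g n z - g n z') \<le> L * norm (z - z')"
      and fgL: "\<forall>n. (\<integral>\<^sup>+z\<in>S. ennreal (norm (f n z - g n z)) \<partial>lborel) \<le> ennreal (e / 4)"
      by (elim exE conjE)
    note gB = gBL[rule_format] and gL = gLL[rule_format] and fg = fgL[rule_format]
    have cg: "continuous_on S (g n)" for n
      using gL L by (intro lipschitz_on_continuous_on[of L]) (auto simp: lipschitz_on_def dist_norm)
    define \<eta> where "\<eta> = e / (4 * (V + 1))"
    have \<eta>: "0 < \<eta>" using e V0 by (simp add: \<eta>_def)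
    obtain G k where k: "strict_mono (k :: nat \<Rightarrow> nat)"
      and conv: "\<And>e. 0 < e \<Longrightarrow> \<exists>N. \<forall>n x. n \<ge> N \<and> x \<in> S \<longrightarrow> norm (g (r (k n)) x - G x) < e"
    proof (rule Arzela_Ascoli[OF S, of "\<lambda>n. g (r n)" B])
      fix x and e :: real assume x: "x \<in> S" and e: "0 < e"
      show "\<exists>d>0. \<forall>n y. y \<in> S \<and> norm (x - y) < d \<longrightarrow> norm (g (r n) x - g (r n) y) < e"
      proof (intro exI[of _ "e / (L + 1)"] conjI allI impI)
        show "0 < e / (L + 1)" using e L by simp
        fix n y assume y: "y \<in> S \<and> norm (x - y) < e / (L + 1)"
        have "norm (g (r n) x - g (r n) y) \<le> L * norm (x - y)" using gL x y by blast
        also have "\<dots> \<le> L * (e / (L + 1))" using y L by (intro mult_left_mono) auto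
        also have "\<dots> < e" using e L by (simp add: field_simps)
        finally show "norm (g (r n) x - g (r n) y) < e" .
      qed
    qed (use gB in auto)
    obtain N where N: "\<And>n x. n \<ge> N \<Longrightarrow> x \<in> S \<Longrightarrow> norm (g (r (k n)) x - G x) < \<eta>" using conv[OF \<eta>] by blast
    \<comment> \<open>Dropping the first members makes the bound hold for all pairs of indices, a
      property that passes to every further subsequence, as diagonalization requires.\<close>
    define r' where "r' n = k (n + N)" for n
    have mono: "strict_mono r'" using k by (auto simp: r'_def strict_mono_def)
    have gg: "norm (g (r (r' i)) z - g (r (r' j)) z) \<le> 2 * \<eta>" if "z \<in> S" for i j z
      using N[of "i + N" z] N[of "j + N" z] that norm_triangle_ineq4[of "g (r (r' i)) z - G z" "g (r (r' j)) z - G z"]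
      by (simp add: r'_def)
    have "(\<integral>\<^sup>+z\<in>S. ennreal (norm (f ((r \<circ> r') i) z - f ((r \<circ> r') j) z)) \<partial>lborel) \<le> ennreal e" for i j
    proof -
      let ?i = "r (r' i)" and ?j = "r (r' j)"
      have "(\<integral>\<^sup>+z\<in>S. ennreal (norm (f ?i z - f ?j z)) \<partial>lborel)
        \<le> (\<integral>\<^sup>+z. ennreal (2 * \<eta>) * indicator S z + (ennreal (norm (f ?i z - g ?i z)) * indicator S z + ennreal (norm (f ?j z - g ?j z)) * indicator S z) \<partial>lborel)"
      proof (intro nn_integral_mono)
        fix z
        show "ennreal (norm (f ?i z - f ?j z)) * indicator S z \<le> ennreal (2 * \<eta>) * indicator S z
          + (ennreal (norm (f ?i z - g ?i z)) * indicator S z + ennreal (norm (f ?j z - g ?j z)) * indicator S z)"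
        proof (cases "z \<in> S")
          case True
          have "f ?i z - f ?j z = (g ?i z - g ?j z) + ((f ?i z - g ?i z) - (f ?j z - g ?j z))" by simp
          then have "norm (f ?i z - f ?j z) \<le> 2 * \<eta> + (norm (f ?i z - g ?i z) + norm (f ?j z - g ?j z))"
            using gg[OF True, of i j] by (metis add_mono norm_triangle_ineq4 norm_triangle_le)
          then have "ennreal (norm (f ?i z - f ?j z)) \<le> ennreal (2 * \<eta> + (norm (f ?i z - g ?i z) + norm (f ?j z - g ?j z)))"
            by (rule ennreal_leI)
          then show ?thesis using True \<eta> by simp
        qed simp
      qed
      also have "\<dots> = ennreal (2 * \<eta>) * ennreal V + ((\<integral>\<^sup>+z\<in>S. ennreal (norm (f ?i z - g ?i z)) \<partial>lborel) + (\<integral>\<^sup>+z\<in>S. ennreal (norm (f ?j z - g ?j z)) \<partial>lborel))"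
      proof -
        have m[measurable]: "(\<lambda>z. ennreal (norm (f n z - g n z)) * indicator S z) \<in> borel_measurable lborel" for n
        proof -
          have "(\<lambda>z. ennreal (indicator S z *\<^sub>R norm (f n z - g n z))) \<in> borel_measurable lborel"
            using borel_measurable_continuous_on_indicator[OF Sb, of "\<lambda>z. norm (f n z - g n z)"]
            by (simp add: continuous_on_norm continuous_on_diff c cg)
          also have "(\<lambda>z. ennreal (indicator S z *\<^sub>R norm (f n z - g n z))) = (\<lambda>z. ennreal (norm (f n z - g n z)) * indicator S z)"
            by (auto simp: fun_eq_iff indicator_def)
          finally show ?thesis .
        qed
        have [measurable]: "S \<in> sets lborel" using Sb by simp
        have "(\<integral>\<^sup>+z. ennreal (2 * \<eta>) * indicator S z + (ennreal (norm (f ?i z - g ?i z)) * indicator S z + ennreal (norm (f ?j z - g ?j z)) * indicator S z) \<partial>lborel)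
          = (\<integral>\<^sup>+z. ennreal (2 * \<eta>) * indicator S z \<partial>lborel) + (\<integral>\<^sup>+z. ennreal (norm (f ?i z - g ?i z)) * indicator S z + ennreal (norm (f ?j z - g ?j z)) * indicator S z \<partial>lborel)"
          by (rule nn_integral_add) measurable
        also have "(\<integral>\<^sup>+z. ennreal (norm (f ?i z - g ?i z)) * indicator S z + ennreal (norm (f ?j z - g ?j z)) * indicator S z \<partial>lborel)
          = (\<integral>\<^sup>+z\<in>S. ennreal (norm (f ?i z - g ?i z)) \<partial>lborel) + (\<integral>\<^sup>+z\<in>S. ennreal (norm (f ?j z - g ?j z)) \<partial>lborel)"
          by (rule nn_integral_add) measurable
        also have "(\<integral>\<^sup>+z. ennreal (2 * \<eta>) * indicator S z \<partial>lborel) = ennreal (2 * \<eta>) * ennreal V"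
          unfolding vol[symmetric] by (rule nn_integral_cmult_indicator) measurable
        finally show ?thesis .
      qed
      also have "\<dots> \<le> ennreal (2 * \<eta>) * ennreal V + (ennreal (e / 4) + ennreal (e / 4))" by (intro add_mono order_refl fg)
      also have "\<dots> = ennreal (2 * \<eta> * V + (e / 4 + e / 4))"
        using \<eta> e V0 by (simp only: ennreal_plus ennreal_mult mult_nonneg_nonneg add_nonneg_nonneg less_imp_le zero_le_numeral divide_nonneg_nonneg)
      also have "\<dots> \<le> ennreal e"
      proof (rule ennreal_leI)
        have "\<eta> * V \<le> \<eta> * (V + 1)" using \<eta> by simp
        also have "\<dots> = e / 4" using V0 by (simp add: \<eta>_def divide_simps)
        finally show "2 * \<eta> * V + (e / 4 + e / 4) \<le> e" by linarith
      qed
      finally show ?thesis by simp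
    qed
    note small = this
    show ?thesis by (intro exI[of _ r'] conjI allI mono small)
  qed
  interpret subseqs "\<lambda>n r. \<forall>j k. (\<integral>\<^sup>+z\<in>S. ennreal (norm (f (r j) z - f (r k) z)) \<partial>lborel) \<le> ennreal ((1/2) ^ n)"
    by unfold_locales (rule sub, simp)
  \<comment> \<open>The diagonal sequence has the property of stage \<open>n\<close> only from index
    \<open>Suc n\<close> on. With the shift by one, the increment from \<open>d n\<close> to
    \<open>d (Suc n)\<close> obeys the bound of stage \<open>n\<close>.\<close>
  define d where "d = (\<lambda>k. diagseq (Suc k))"
  have dm: "strict_mono d" using subseq_diagseq by (auto simp: d_def strict_mono_def)
  have "(\<integral>\<^sup>+z\<in>S. ennreal (norm (f (d (Suc n)) z - f (d n) z)) \<partial>lborel) \<le> ennreal ((1/2) ^ n)" for n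
  proof -
    have "\<forall>j k. (\<integral>\<^sup>+z\<in>S. ennreal (norm (f ((diagseq \<circ> (+) (Suc n)) j) z - f ((diagseq \<circ> (+) (Suc n)) k) z)) \<partial>lborel) \<le> ennreal ((1/2) ^ n)"
      by (rule diagseq_holds) auto
    from this[rule_format, of 1 0] show ?thesis by (simp add: d_def)
  qed
  from L1_subsequence_limit[of S "\<lambda>n. f (d n)" W, OF S c W this] obtain Y where
    "set_integrable lborel S Y" "(\<lambda>k. LINT z:S|lborel. norm (f (d k) z - Y z)) \<longlonglongrightarrow> 0" by blast
  with dm show ?thesis by blast
qed

section \<open>Mollification by a tent kernel\<close>

definition tent :: "real \<Rightarrow> 'a::real_normed_vector \<Rightarrow> real" where
  "tent \<delta> h = max 0 (1 - norm h / \<delta>)"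

lemma tent_bounds: "0 < \<delta> \<Longrightarrow> 0 \<le> tent \<delta> h" "0 < \<delta> \<Longrightarrow> tent \<delta> h \<le> 1"
  by (auto simp: tent_def)

lemma tent_eq_0: "0 < \<delta> \<Longrightarrow> \<delta> \<le> norm h \<Longrightarrow> tent \<delta> h = 0"
  by (auto simp: tent_def)

lemma tent_lipschitz: assumes "0 < \<delta>" shows "\<bar>tent \<delta> a - tent \<delta> b\<bar> \<le> norm (a - b) / \<delta>"
proof -
  have "\<bar>tent \<delta> a - tent \<delta> b\<bar> \<le> \<bar>norm a / \<delta> - norm b / \<delta>\<bar>" by (auto simp: tent_def max_def)
  also have "\<dots> = \<bar>norm a - norm b\<bar> / \<delta>" using assms by (simp flip: diff_divide_distrib)
  also have "\<dots> \<le> norm (a - b) / \<delta>" using assms by (intro divide_right_mono norm_triangle_ineq3) auto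
  finally show ?thesis .
qed

lemma continuous_tent: "continuous_on A (tent \<delta>)"
  unfolding tent_def divide_inverse by (intro continuous_intros)

lemma integrable_tent: "0 < \<delta> \<Longrightarrow> integrable lborel (tent \<delta> :: 'a::euclidean_space \<Rightarrow> real)"
proof -
  assume \<delta>: "0 < \<delta>"
  have "integrable lborel (\<lambda>h::'a. indicator (cball 0 \<delta>) h *\<^sub>R tent \<delta> h)"
    by (intro borel_integrable_compact continuous_tent) auto
  also have "(\<lambda>h::'a. indicator (cball 0 \<delta>) h *\<^sub>R tent \<delta> h) = tent \<delta>"
    using tent_eq_0[OF \<delta>] by (force simp: fun_eq_iff indicator_def)
  finally show ?thesis .
qed

lemma integral_tent_pos: assumes \<delta>: "0 < \<delta>" shows "0 < integral\<^sup>L lborel (tent \<delta> :: 'a::euclidean_space \<Rightarrow> real)"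
proof -
  have "0 < measure lborel (ball (0::'a) (\<delta> / 2)) * (1/2)"
    using \<delta> content_ball_pos[of "\<delta> / 2" "0 :: 'a"] by simp
  also have "\<dots> = integral\<^sup>L lborel (\<lambda>h::'a. indicator (ball 0 (\<delta> / 2)) h * (1/2))"
    by simp
  also have "\<dots> \<le> integral\<^sup>L lborel (tent \<delta> :: 'a \<Rightarrow> real)"
  proof (rule integral_mono)
    show "integrable lborel (\<lambda>h::'a. indicator (ball 0 (\<delta> / 2)) h * (1/2) :: real)"
      using emeasure_lborel_ball_finite[of "0::'a" "\<delta> / 2"]
      by (intro integrable_mult_left integrable_real_indicator) auto
    show "indicator (ball 0 (\<delta> / 2)) h * (1/2) \<le> tent \<delta> h" for h :: 'a
      using \<delta> tent_bounds(1)[OF \<delta>, of h] by (auto simp: indicator_def tent_def divide_simps)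
  qed (rule integrable_tent[OF \<delta>])
  finally show ?thesis .
qed

lemma integral_translate:
  fixes f :: "'a::euclidean_space \<Rightarrow> real"
  assumes "f \<in> borel_measurable borel"
  shows "integral\<^sup>L lborel (\<lambda>y. f (y - x)) = integral\<^sup>L lborel f"
proof -
  have "integral\<^sup>L lborel f = integral\<^sup>L (distr lborel borel (\<lambda>y. - x + y)) f" by (simp only: lborel_distr_plus)
  also have "\<dots> = integral\<^sup>L lborel (\<lambda>y. f (- x + y))" by (rule integral_distr) (use assms in auto)
  finally show ?thesis by (simp add: add.commute)
qed

text \<open>Convolution with the tent kernel, normalized here, of \<open>f\<close> set to zero
  outside a ball. A Lipschitz kernel is smooth enough, since equicontinuity is all that is wanted;
  the truncation lets bounds of \<open>f\<close> on a single ball suffice.\<close>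

definition mollify :: "real \<Rightarrow> real \<Rightarrow> ('a::euclidean_space \<Rightarrow> 'b::euclidean_space) \<Rightarrow> 'a \<Rightarrow> 'b" where
  "mollify \<delta> R f x = (1 / integral\<^sup>L lborel (tent \<delta> :: 'a \<Rightarrow> real)) *\<^sub>R
     integral\<^sup>L lborel (\<lambda>y. indicator (cball 0 R) y *\<^sub>R (tent \<delta> (y - x) *\<^sub>R f y))"

lemma mollify_integrable:
  fixes f :: "'a::euclidean_space \<Rightarrow> 'b::euclidean_space"
  assumes f: "continuous_on UNIV f"
  shows "integrable lborel (\<lambda>y. indicator (cball 0 R) y *\<^sub>R (tent \<delta> (y - x) *\<^sub>R f y))"
proof (rule borel_integrable_compact)
  have "continuous_on (cball 0 R) (\<lambda>y. tent \<delta> (y - x))"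
    by (rule continuous_on_compose2[OF continuous_tent]) (auto intro!: continuous_intros)
  then show "continuous_on (cball 0 R) (\<lambda>y. tent \<delta> (y - x) *\<^sub>R f y)"
    by (intro continuous_intros continuous_on_subset[OF f]) auto
qed simp

text \<open>Admitting two functions besides two points serves twice: with the flow at two times it
  gives a Lipschitz bound jointly in time and space, and with \<open>g = 0\<close> the uniform
  bound.\<close>

lemma mollify_difference:
  fixes f g :: "'a::euclidean_space \<Rightarrow> 'b::euclidean_space"
  assumes f: "continuous_on UNIV f" and g: "continuous_on UNIV g" and \<delta>: "0 < \<delta>"
    and fW: "\<And>y. y \<in> cball 0 R \<Longrightarrow> norm (f y) \<le> W" and fg: "\<And>y. y \<in> cball 0 R \<Longrightarrow> norm (f y - g y) \<le> D"
  shows "norm (mollify \<delta> R f x - mollify \<delta> R g z)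
    \<le> measure lborel (cball (0::'a) R) / integral\<^sup>L lborel (tent \<delta> :: 'a \<Rightarrow> real) * (W * norm (x - z) / \<delta> + D)"
proof -
  let ?c = "integral\<^sup>L lborel (tent \<delta> :: 'a \<Rightarrow> real)"
  have c: "0 < ?c" by (rule integral_tent_pos[OF \<delta>])
  let ?F = "\<lambda>f x y. indicator (cball 0 R) y *\<^sub>R (tent \<delta> (y - x) *\<^sub>R f y)"
  have "norm (integral\<^sup>L lborel (?F f x) - integral\<^sup>L lborel (?F g z)) = norm (integral\<^sup>L lborel (\<lambda>y. ?F f x y - ?F g z y))"
    by (simp only: Bochner_Integration.integral_diff[OF mollify_integrable[OF f] mollify_integrable[OF g]])
  also have "\<dots> \<le> integral\<^sup>L lborel (\<lambda>y::'a. indicator (cball 0 R) y * (W * norm (x - z) / \<delta> + D))"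
  proof (rule Bochner_Integration.integral_norm_bound_integral)
    show "integrable lborel (\<lambda>y. ?F f x y - ?F g z y)"
      by (intro Bochner_Integration.integrable_diff mollify_integrable f g)
    show "integrable lborel (\<lambda>y::'a. indicator (cball 0 R) y * (W * norm (x - z) / \<delta> + D))"
      using emeasure_lborel_cball_finite[of "0::'a" R]
      by (intro integrable_mult_left integrable_real_indicator) auto
    show "norm (?F f x y - ?F g z y) \<le> indicator (cball 0 R) y * (W * norm (x - z) / \<delta> + D)" for y
    proof (cases "y \<in> cball 0 R")
      case True
      have "?F f x y - ?F g z y = (tent \<delta> (y - x) - tent \<delta> (y - z)) *\<^sub>R f y + tent \<delta> (y - z) *\<^sub>R (f y - g y)"
        using True by (simp add: algebra_simps)
      also have "norm \<dots> \<le> \<bar>tent \<delta> (y - x) - tent \<delta> (y - z)\<bar> * norm (f y) + \<bar>tent \<delta> (y - z)\<bar> * norm (f y - g y)"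
        by (rule norm_triangle_le) simp
      also have "\<dots> \<le> norm ((y - x) - (y - z)) / \<delta> * W + 1 * D"
        using tent_bounds[OF \<delta>, of "y - z"] \<delta>
        by (intro add_mono mult_mono tent_lipschitz[OF \<delta>] fW fg True) auto
      finally show ?thesis using True by (simp add: norm_minus_commute mult.commute)
    qed simp
  qed
  also have "\<dots> = measure lborel (cball (0::'a) R) * (W * norm (x - z) / \<delta> + D)" by simp
  finally have "norm (integral\<^sup>L lborel (?F f x) - integral\<^sup>L lborel (?F g z)) / ?c
      \<le> measure lborel (cball (0::'a) R) * (W * norm (x - z) / \<delta> + D) / ?c" using c by (intro divide_right_mono) auto
  then show ?thesis
    unfolding mollify_def scaleR_diff_right[symmetric] norm_scaleR using c by simp
qed

text \<open>The error at \<open>x\<close> is a weighted mean over \<open>h\<close> of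
  \<open>f x - f (x + h)\<close>; by Tonelli, a bound common to all shifts passes to the mean.
  \<open>R0 + \<delta> \<le> R\<close> keeps the truncation out of reach of the kernel, so that
  constants are reproduced.\<close>

lemma mollify_close:
  fixes f :: "'a::euclidean_space \<Rightarrow> 'b::euclidean_space"
  assumes f: "continuous_on UNIV f" and \<delta>: "0 < \<delta>" and R: "R0 + \<delta> \<le> R"
    and shift: "\<And>h. norm h \<le> \<delta> \<Longrightarrow> (\<integral>\<^sup>+x\<in>cball 0 R0. ennreal (norm (f (x + h) - f x)) \<partial>lborel) \<le> ennreal d" and d: "0 \<le> d"
  shows "(\<integral>\<^sup>+x\<in>cball 0 R0. ennreal (norm (f x - mollify \<delta> R f x)) \<partial>lborel) \<le> ennreal d"
proof -
  let ?c = "integral\<^sup>L lborel (tent \<delta> :: 'a \<Rightarrow> real)"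
  have c: "0 < ?c" by (rule integral_tent_pos[OF \<delta>])
  have mt: "(tent \<delta> :: 'a \<Rightarrow> real) \<in> borel_measurable borel" by (intro borel_measurable_continuous_onI continuous_tent)
  have nt: "(\<integral>\<^sup>+h. ennreal (tent \<delta> (h::'a)) \<partial>lborel) = ennreal ?c"
    using tent_bounds(1)[OF \<delta>] by (intro nn_integral_eq_integral integrable_tent \<delta>) auto
  have in_ball: "y \<in> cball 0 R" if "x \<in> cball 0 R0" "norm (y - x) < \<delta>" for x y :: 'a
    using that R norm_triangle_sub[of y x] by simp
  have pt: "ennreal (norm (f x - mollify \<delta> R f x)) \<le> ennreal (1 / ?c) * (\<integral>\<^sup>+h\<in>cball 0 \<delta>. ennreal (tent \<delta> h * norm (f (x + h) - f x)) \<partial>lborel)"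
    if x: "x \<in> cball 0 R0" for x
  proof -
    let ?F = "\<lambda>g y. indicator (cball 0 R) y *\<^sub>R (tent \<delta> (y - x) *\<^sub>R g y)"
    have "integral\<^sup>L lborel (?F (\<lambda>_. f x)) = integral\<^sup>L lborel (\<lambda>y. tent \<delta> (y - x) *\<^sub>R f x)"
    proof (rule Bochner_Integration.integral_cong)
      show "?F (\<lambda>_. f x) y = tent \<delta> (y - x) *\<^sub>R f x" for y
        using in_ball[OF x, of y] tent_eq_0[OF \<delta>, of "y - x"] by (cases "norm (y - x) < \<delta>") (auto simp: indicator_def)
    qed simp
    also have "\<dots> = integral\<^sup>L lborel (\<lambda>y. tent \<delta> (y - x)) *\<^sub>R f x"
    proof (rule integral_scaleR_left)
      have "integrable (distr lborel borel (\<lambda>y. - x + y)) (tent \<delta>)"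
        using integrable_tent[OF \<delta>] by (simp only: lborel_distr_plus)
      then have "integrable lborel (\<lambda>y. tent \<delta> (- x + y))" by (subst (asm) integrable_distr_eq) (auto intro: mt)
      then show "integrable lborel (\<lambda>y. tent \<delta> (y - x))" by (simp add: add.commute)
    qed
    also have "integral\<^sup>L lborel (\<lambda>y. tent \<delta> (y - x)) = ?c" by (rule integral_translate[OF mt])
    finally have e: "integral\<^sup>L lborel (?F (\<lambda>_. f x)) = ?c *\<^sub>R f x" .
    have i: "integrable lborel (?F (\<lambda>y. f x - f y))" by (intro mollify_integrable continuous_intros f)
    have "f x - mollify \<delta> R f x = (1 / ?c) *\<^sub>R (integral\<^sup>L lborel (?F (\<lambda>_. f x)) - integral\<^sup>L lborel (?F f))"
      unfolding e mollify_def using c by (simp add: scaleR_diff_right)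
    also have "integral\<^sup>L lborel (?F (\<lambda>_. f x)) - integral\<^sup>L lborel (?F f) = integral\<^sup>L lborel (\<lambda>y. ?F (\<lambda>_. f x) y - ?F f y)"
      by (rule Bochner_Integration.integral_diff[symmetric]) (intro mollify_integrable continuous_intros f)+
    also have "(\<lambda>y. ?F (\<lambda>_. f x) y - ?F f y) = ?F (\<lambda>y. f x - f y)" by (simp add: scaleR_diff_right)
    finally have "norm (f x - mollify \<delta> R f x) = 1 / ?c * norm (integral\<^sup>L lborel (?F (\<lambda>y. f x - f y)))"
      using c by simp
    also have "\<dots> \<le> 1 / ?c * integral\<^sup>L lborel (\<lambda>y. norm (?F (\<lambda>y. f x - f y) y))"
      using c by (intro mult_left_mono integral_norm_bound) auto
    finally have "ennreal (norm (f x - mollify \<delta> R f x)) \<le> ennreal (1 / ?c * integral\<^sup>L lborel (\<lambda>y. norm (?F (\<lambda>y. f x - f y) y)))"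
      by (rule ennreal_leI)
    also have "\<dots> = ennreal (1 / ?c) * ennreal (integral\<^sup>L lborel (\<lambda>y. norm (?F (\<lambda>y. f x - f y) y)))"
      using c by (intro ennreal_mult Bochner_Integration.integral_nonneg) auto
    also have "ennreal (integral\<^sup>L lborel (\<lambda>y. norm (?F (\<lambda>y. f x - f y) y))) = (\<integral>\<^sup>+y. ennreal (norm (?F (\<lambda>y. f x - f y) y)) \<partial>lborel)"
      using i by (intro nn_integral_eq_integral[symmetric] integrable_norm) auto
    also have "\<dots> = (\<integral>\<^sup>+h. ennreal (norm (?F (\<lambda>y. f x - f y) (x + h))) \<partial>lborel)"
    proof -
      have m: "?F (\<lambda>y. f x - f y) \<in> borel_measurable borel"
        using borel_measurable_integrable[OF i] by (simp only: measurable_lborel2)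
      have "(\<integral>\<^sup>+y. ennreal (norm (?F (\<lambda>y. f x - f y) y)) \<partial>lborel) = (\<integral>\<^sup>+y. ennreal (norm (?F (\<lambda>y. f x - f y) y)) \<partial>distr lborel borel (\<lambda>h. x + h))"
        by (simp add: lborel_distr_plus)
      also have "\<dots> = (\<integral>\<^sup>+h. ennreal (norm (?F (\<lambda>y. f x - f y) (x + h))) \<partial>lborel)"
      proof (rule nn_integral_distr)
        show "(\<lambda>y. ennreal (norm (?F (\<lambda>y. f x - f y) y))) \<in> borel_measurable (distr lborel borel ((+) x))"
          unfolding measurable_distr_eq1
          by (rule measurable_compose[OF measurable_compose[OF m borel_measurable_norm] measurable_ennreal])
      qed simp
      finally show ?thesis .
    qed
    also have "\<dots> \<le> (\<integral>\<^sup>+h\<in>cball 0 \<delta>. ennreal (tent \<delta> h * norm (f (x + h) - f x)) \<partial>lborel)"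
    proof (intro nn_integral_mono)
      fix h :: 'a
      show "ennreal (norm (?F (\<lambda>y. f x - f y) (x + h))) \<le> ennreal (tent \<delta> h * norm (f (x + h) - f x)) * indicator (cball 0 \<delta>) h"
        using tent_eq_0[OF \<delta>, of h] tent_bounds(1)[OF \<delta>, of h]
        by (cases "norm h \<le> \<delta>") (auto simp: indicator_def norm_minus_commute)
    qed
    finally show ?thesis by (simp add: mult_left_mono)
  qed
  define G where "G h x = tent \<delta> h * norm (f (x + h) - f x)" for h x
  have cG: "continuous_on (cball 0 \<delta> \<times> cball 0 R0) (\<lambda>(h, x). G h x)"
    unfolding G_def split_beta
    by (intro continuous_intros continuous_on_compose2[OF continuous_tent] continuous_on_compose2[OF f]) auto
  have "(\<integral>\<^sup>+x\<in>cball 0 R0. ennreal (norm (f x - mollify \<delta> R f x)) \<partial>lborel)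
    \<le> (\<integral>\<^sup>+x. ennreal (1 / ?c) * ((\<integral>\<^sup>+h\<in>cball 0 \<delta>. ennreal (G h x) \<partial>lborel) * indicator (cball 0 R0) x) \<partial>lborel)"
    using pt by (intro nn_integral_mono) (auto simp: indicator_def G_def)
  also have "\<dots> = ennreal (1 / ?c) * (\<integral>\<^sup>+x\<in>cball 0 R0. (\<integral>\<^sup>+h\<in>cball 0 \<delta>. ennreal (G h x) \<partial>lborel) \<partial>lborel)"
    by (intro nn_integral_cmult nn_integral_swap_continuous_on(2) cG) auto
  also have "(\<integral>\<^sup>+x\<in>cball 0 R0. (\<integral>\<^sup>+h\<in>cball 0 \<delta>. ennreal (G h x) \<partial>lborel) \<partial>lborel)
    = (\<integral>\<^sup>+h\<in>cball 0 \<delta>. (\<integral>\<^sup>+x\<in>cball 0 R0. ennreal (G h x) \<partial>lborel) \<partial>lborel)"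
    by (intro nn_integral_swap_continuous_on(1) cG) auto
  also have "\<dots> \<le> (\<integral>\<^sup>+h. ennreal d * ennreal (tent \<delta> (h::'a)) \<partial>lborel)"
  proof (intro nn_integral_mono)
    fix h :: 'a
    show "(\<integral>\<^sup>+x\<in>cball 0 R0. ennreal (G h x) \<partial>lborel) * indicator (cball 0 \<delta>) h \<le> ennreal d * ennreal (tent \<delta> h)"
    proof (cases "h \<in> cball 0 \<delta>")
      case True
      have cf: "continuous_on (cball 0 R0) (\<lambda>x. norm (f (x + h) - f x))"
        by (intro continuous_intros continuous_on_compose2[OF f]) auto
      have "(\<integral>\<^sup>+x\<in>cball 0 R0. ennreal (G h x) \<partial>lborel) = (\<integral>\<^sup>+x. ennreal (tent \<delta> h) * (ennreal (norm (f (x + h) - f x)) * indicator (cball 0 R0) x) \<partial>lborel)"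
        using tent_bounds(1)[OF \<delta>, of h] by (simp add: G_def ennreal_mult mult.assoc)
      also have "\<dots> = ennreal (tent \<delta> h) * (\<integral>\<^sup>+x\<in>cball 0 R0. ennreal (norm (f (x + h) - f x)) \<partial>lborel)"
        using borel_measurable_ennreal_indicator[OF cf] by (intro nn_integral_cmult) auto
      also have "\<dots> \<le> ennreal (tent \<delta> h) * ennreal d" using True by (intro mult_left_mono shift) auto
      finally show ?thesis using True by (simp add: mult.commute)
    qed simp
  qed
  also have "\<dots> = ennreal d * ennreal ?c" unfolding nt[symmetric] using mt by (intro nn_integral_cmult) auto
  finally have "(\<integral>\<^sup>+x\<in>cball 0 R0. ennreal (norm (f x - mollify \<delta> R f x)) \<partial>lborel) \<le> ennreal (1 / ?c) * (ennreal d * ennreal ?c)"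
    by (simp add: mult_left_mono)
  also have "\<dots> = ennreal d" using c d by (simp flip: ennreal_mult)
  finally show ?thesis .
qed

lemma nn_integral_Times:
  fixes F :: "'a::euclidean_space \<Rightarrow> 'b::euclidean_space \<Rightarrow> real"
  assumes F: "continuous_on (A \<times> B) (\<lambda>(t, x). F t x)" and A: "A \<in> sets borel" and B: "B \<in> sets borel"
  shows "(\<integral>\<^sup>+z\<in>A \<times> B. ennreal (F (fst z) (snd z)) \<partial>lborel) = (\<integral>\<^sup>+t\<in>A. (\<integral>\<^sup>+x\<in>B. ennreal (F t x) \<partial>lborel) \<partial>lborel)"
proof -
  have "(\<integral>\<^sup>+z\<in>A \<times> B. ennreal (F (fst z) (snd z)) \<partial>lborel)
      = (\<integral>\<^sup>+z. (case z of (t, x) \<Rightarrow> ennreal (F t x) * indicator A t * indicator B x) \<partial>(lborel \<Otimes>\<^sub>M lborel))"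
    unfolding lborel_prod by (intro nn_integral_cong) (auto simp: indicator_def split_beta mem_Times_iff)
  also have "\<dots> = (\<integral>\<^sup>+t. (\<integral>\<^sup>+x. ennreal (F t x) * indicator A t * indicator B x \<partial>lborel) \<partial>lborel)"
    by (subst lborel.nn_integral_fst[symmetric, OF borel_measurable_continuous_on_Times[OF F A B]]) simp
  also have "\<dots> = (\<integral>\<^sup>+t\<in>A. (\<integral>\<^sup>+x\<in>B. ennreal (F t x) \<partial>lborel) \<partial>lborel)"
    by (intro nn_integral_cong) (auto simp: indicator_def)
  finally show ?thesis .
qed

text \<open>Mollification acts on \<open>x\<close> only, because the speed bound already gives a
  Lipschitz bound in \<open>t\<close>. The mollified functions are equi-Lipschitz in both variables,
  and at each time the shift modulus makes them close in L^1.\<close>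

lemma L1_compact_of_shift_modulus:
  fixes X :: "nat \<Rightarrow> real \<Rightarrow> 'a::euclidean_space \<Rightarrow> 'b::euclidean_space"
  assumes T: "0 \<le> T" and M: "0 \<le> M"
    and cX: "\<And>n. continuous_on ({0..T} \<times> UNIV) (\<lambda>(t, x). X n t x)"
    and W: "\<And>n t x. t \<in> {0..T} \<Longrightarrow> x \<in> cball 0 (R0 + 1) \<Longrightarrow> norm (X n t x) \<le> W"
    and time: "\<And>n s t x. s \<in> {0..T} \<Longrightarrow> t \<in> {0..T} \<Longrightarrow> norm (X n s x - X n t x) \<le> M * \<bar>s - t\<bar>"
    and shift: "\<And>e. 0 < e \<Longrightarrow> \<exists>K\<ge>0. \<forall>n. \<forall>t\<in>{0..T}. \<forall>h. norm h \<le> 1 \<longrightarrow>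
       (\<integral>\<^sup>+x\<in>cball 0 R0. ennreal (norm (X n t (x + h) - X n t x)) \<partial>lborel) \<le> ennreal (e + K * norm h)"
    and K: "compact K" "K \<subseteq> cball 0 R0"
  shows "\<exists>r Y. strict_mono (r :: nat \<Rightarrow> nat) \<and> set_integrable lborel ({0..T} \<times> K) Y
      \<and> (\<lambda>k. LINT z:({0..T} \<times> K)|lborel. norm (X (r k) (fst z) (snd z) - Y z)) \<longlonglongrightarrow> 0"
proof (cases "K = {}")
  case True
  show ?thesis by (rule exI[of _ "\<lambda>n. n"]) (simp add: True strict_mono_def set_integrable_def set_lebesgue_integral_def)
next
  case False
  \<comment> \<open>A point of \<open>K\<close> is what shows that \<open>W\<close> is
    nonnegative.\<close>
  then obtain x0 where "x0 \<in> K" by blast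
  have "norm (X 0 0 x0) \<le> W" using \<open>x0 \<in> K\<close> K(2) T by (intro W) auto
  then have W0: "0 \<le> W" by (rule order_trans[OF norm_ge_zero])
  have Kb: "K \<in> sets borel" using K(1) by (intro borel_closed compact_imp_closed)
  have cXt: "continuous_on UNIV (X n t)" if "t \<in> {0..T}" for n t
  proof -
    have "continuous_on UNIV (\<lambda>x. case (t, x) of (t, x) \<Rightarrow> X n t x)"
      by (rule continuous_on_compose2[OF cX]) (use that in \<open>auto intro!: continuous_intros\<close>)
    then show ?thesis by simp
  qed
  have cX2: "continuous_on ({0..T} \<times> K) (\<lambda>z. X n (fst z) (snd z))" for n
    using continuous_on_subset[OF cX[of n], of "{0..T} \<times> K"] by (simp add: split_beta subset_iff)
  show ?thesis
  proof (rule L1_compact_sequence)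
    show "compact ({0..T} \<times> K)" by (intro compact_Times K) auto
    show "continuous_on ({0..T} \<times> K) (\<lambda>z. X n (fst z) (snd z))" for n by (rule cX2)
    show "norm (X n (fst z) (snd z)) \<le> W" if "z \<in> {0..T} \<times> K" for n z
      using that K(2) by (intro W) (auto simp: subset_iff intro: order_trans)
    fix e :: real assume e: "0 < e"
    \<comment> \<open>At each time the error is at most \<open>e'\<close> from the modulus plus
      \<open>Q * \<delta> \<le> e'\<close>; integration over \<open>{0..T}\<close> then stays below
      \<open>e\<close>.\<close>
    define e' where "e' = e / (2 * (T + 1))"
    have e': "0 < e'" using e T by (simp add: e'_def)
    obtain Q where Q: "0 \<le> Q" and sh: "\<And>n t h. t \<in> {0..T} \<Longrightarrow> norm h \<le> 1 \<Longrightarrow>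
       (\<integral>\<^sup>+x\<in>cball 0 R0. ennreal (norm (X n t (x + h) - X n t x)) \<partial>lborel) \<le> ennreal (e' + Q * norm h)"
      using shift[OF e'] by blast
    define \<delta> where "\<delta> = min 1 (e' / (Q + 1))"
    have \<delta>: "0 < \<delta>" "\<delta> \<le> 1" using e' Q by (auto simp: \<delta>_def)
    have Q\<delta>: "Q * \<delta> \<le> e'"
    proof -
      have "Q * \<delta> \<le> (Q + 1) * (e' / (Q + 1))" using Q e' by (intro mult_mono) (auto simp: \<delta>_def)
      also have "\<dots> = e'" using Q by simp
      finally show ?thesis .
    qed
    let ?c = "measure lborel (cball (0::'a) (R0 + 1)) / integral\<^sup>L lborel (tent \<delta> :: 'a \<Rightarrow> real)"
    have c: "0 \<le> ?c" using integral_tent_pos[OF \<delta>(1), where ?'a = 'a] by simp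
    define g where "g n z = mollify \<delta> (R0 + 1) (X n (fst z)) (snd z)" for n z
    define L where "L = ?c * (W / \<delta> + M)"
    have L0: "0 \<le> L" unfolding L_def using W0 M \<delta> by (intro mult_nonneg_nonneg[OF c]) auto
    have gL: "norm (g n z - g n z') \<le> L * norm (z - z')" if z: "z \<in> {0..T} \<times> K" "z' \<in> {0..T} \<times> K" for n z z'
    proof -
      have t: "fst z \<in> {0..T}" "fst z' \<in> {0..T}" using z by auto
      have "norm (g n z - g n z') \<le> ?c * (W * norm (snd z - snd z') / \<delta> + M * \<bar>fst z - fst z'\<bar>)"
        unfolding g_def by (intro mollify_difference cXt t \<delta> W time)
      also have "\<dots> \<le> ?c * (W * norm (z - z') / \<delta> + M * norm (z - z'))"
      proof (intro mult_left_mono add_mono divide_right_mono c)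
        show "norm (snd z - snd z') \<le> norm (z - z')" by (metis norm_snd_le prod.collapse snd_diff)
        show "\<bar>fst z - fst z'\<bar> \<le> norm (z - z')" by (metis norm_fst_le prod.collapse fst_diff real_norm_def)
      qed (use W0 M \<delta> in auto)
      also have "\<dots> = L * norm (z - z')" unfolding L_def by (simp only: distrib_right times_divide_eq_left mult.assoc)
      finally show ?thesis .
    qed
    have gB: "norm (g n z) \<le> ?c * W" if z: "z \<in> {0..T} \<times> K" for n z
    proof -
      have t: "fst z \<in> {0..T}" using z by auto
      have "norm (mollify \<delta> (R0 + 1) (X n (fst z)) (snd z) - mollify \<delta> (R0 + 1) (\<lambda>_. 0) (snd z))
        \<le> ?c * (W * norm (snd z - snd z) / \<delta> + W)"
      proof (rule mollify_difference)
        fix y :: 'a assume "y \<in> cball 0 (R0 + 1)"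
        from W[OF t this] show "norm (X n (fst z) y) \<le> W" "norm (X n (fst z) y - 0) \<le> W" by simp_all
      qed (use cXt[OF t] \<delta> in auto)
      then show ?thesis by (simp add: g_def mollify_def)
    qed
    have close: "(\<integral>\<^sup>+z\<in>{0..T} \<times> K. ennreal (norm (X n (fst z) (snd z) - g n z)) \<partial>lborel) \<le> ennreal e" for n
    proof -
      have cg: "continuous_on ({0..T} \<times> K) (g n)"
        using gL L0 by (intro lipschitz_on_continuous_on[of L]) (auto simp: lipschitz_on_def dist_norm)
      have "(\<integral>\<^sup>+z\<in>{0..T} \<times> K. ennreal (norm (X n (fst z) (snd z) - g n z)) \<partial>lborel)
        = (\<integral>\<^sup>+z\<in>{0..T} \<times> K. ennreal (norm (X n (fst z) (snd z) - g n (fst z, snd z))) \<partial>lborel)" by simp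
      also have "\<dots> = (\<integral>\<^sup>+t\<in>{0..T}. (\<integral>\<^sup>+x\<in>K. ennreal (norm (X n t x - g n (t, x))) \<partial>lborel) \<partial>lborel)"
      proof (rule nn_integral_Times)
        show "continuous_on ({0..T} \<times> K) (\<lambda>(t, x). norm (X n t x - g n (t, x)))"
          unfolding split_beta prod.collapse by (intro continuous_intros cX2 cg)
      qed (use Kb in auto)
      also have "\<dots> \<le> (\<integral>\<^sup>+t\<in>{0..T}. ennreal (2 * e') \<partial>lborel)"
      proof (intro nn_integral_mono)
        fix t :: real
        have "(\<integral>\<^sup>+x\<in>K. ennreal (norm (X n t x - g n (t, x))) \<partial>lborel) \<le> ennreal (2 * e')" if t: "t \<in> {0..T}"
        proof -
          have "(\<integral>\<^sup>+x\<in>K. ennreal (norm (X n t x - g n (t, x))) \<partial>lborel)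
            \<le> (\<integral>\<^sup>+x\<in>cball 0 R0. ennreal (norm (X n t x - mollify \<delta> (R0 + 1) (X n t) x)) \<partial>lborel)"
            using K(2) by (intro nn_integral_mono) (auto simp: g_def indicator_def subset_iff)
          also have "\<dots> \<le> ennreal (2 * e')"
          proof (rule mollify_close[OF cXt[OF t] \<delta>(1)])
            fix h :: 'a assume h: "norm h \<le> \<delta>"
            have "e' + Q * norm h \<le> 2 * e'" using mult_left_mono[OF h Q] Q\<delta> by linarith
            then show "(\<integral>\<^sup>+x\<in>cball 0 R0. ennreal (norm (X n t (x + h) - X n t x)) \<partial>lborel) \<le> ennreal (2 * e')"
              using sh[OF t, of h n] h \<delta> by (meson ennreal_leI order_trans)
          qed (use e' \<delta> in auto)
          finally show ?thesis .
        qed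
        then show "(\<integral>\<^sup>+x\<in>K. ennreal (norm (X n t x - g n (t, x))) \<partial>lborel) * indicator {0..T} t \<le> ennreal (2 * e') * indicator {0..T} t"
          by (auto simp: indicator_def)
      qed
      also have "\<dots> = ennreal (2 * e') * ennreal T" using T by (subst nn_integral_cmult_indicator) auto
      also have "\<dots> = ennreal (2 * e' * T)" using e' T by (simp add: ennreal_mult)
      also have "\<dots> \<le> ennreal e"
      proof (rule ennreal_leI)
        have "2 * e' * T \<le> 2 * e' * (T + 1)" using e' by simp
        also have "\<dots> = e" using T by (simp add: e'_def divide_simps)
        finally show "2 * e' * T \<le> e" .
      qed
      finally show ?thesis .
    qed
    show "\<exists>g B L. (\<forall>n. \<forall>z\<in>{0..T} \<times> K. norm (g n z) \<le> B) \<and> 0 \<le> L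
       \<and> (\<forall>n. \<forall>z\<in>{0..T} \<times> K. \<forall>z'\<in>{0..T} \<times> K. norm (g n z - g n z') \<le> L * norm (z - z'))
       \<and> (\<forall>n. (\<integral>\<^sup>+z\<in>{0..T} \<times> K. ennreal (norm (X n (fst z) (snd z) - g n z)) \<partial>lborel) \<le> ennreal e)"
      by (intro exI[of _ g] exI[of _ "?c * W"] exI[of _ L] conjI allI ballI gB gL L0 close)
  qed
qed

subsection \<open>Compactness of the flows\<close>

text \<open>\<open>Ck\<close> provides continuity of the derivative in each fixed direction; in
  finite dimension this is continuity in the operator norm.\<close>

lemma smooth_derivative:
  fixes f :: "'a::euclidean_space \<Rightarrow> 'b::real_normed_vector"
  assumes "smooth f"
  obtains Df where "\<And>x. (f has_derivative blinfun_apply (Df x)) (at x)" "continuous_on UNIV Df"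
proof -
  have "Ck (Suc 0) f" using assms by (simp only: smooth_def)
  then obtain f' where f': "\<And>x. (f has_derivative f' x) (at x)" "\<And>v. continuous_on UNIV (\<lambda>x. f' x v)" by auto
  have eq: "blinfun_apply (Blinfun (f' x)) = f' x" for x
    by (rule bounded_linear_Blinfun_apply[OF has_derivative_bounded_linear[OF f'(1)]])
  show ?thesis
  proof (rule that[of "\<lambda>x. Blinfun (f' x)"])
    show "continuous_on UNIV (\<lambda>x. Blinfun (f' x))" by (rule continuous_on_blinfun_componentwise) (simp add: eq f'(2))
  qed (simp add: eq f'(1))
qed

lemma nn_integral_norm_derivative_le:
  fixes f :: "'a::euclidean_space \<Rightarrow> 'b::euclidean_space"
  assumes df: "\<And>x. (f has_derivative blinfun_apply (Df x)) (at x)"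
    and i: "integrable lebesgue (\<lambda>x. onorm (frechet_derivative f (at x)))"
    and M: "(LINT x|lebesgue. onorm (frechet_derivative f (at x))) \<le> M"
  shows "(\<integral>\<^sup>+x. ennreal (norm (Df x)) \<partial>lborel) \<le> ennreal M"
proof -
  have eq: "onorm (frechet_derivative f (at x)) = norm (Df x)" for x
    by (simp add: frechet_derivative_at[OF df, symmetric] norm_blinfun.rep_eq)
  have "(\<integral>\<^sup>+x. ennreal (norm (Df x)) \<partial>lborel) = (\<integral>\<^sup>+x. ennreal (norm (Df x)) \<partial>lebesgue)"
    by (rule nn_integral_completion[symmetric])
  also have "\<dots> = ennreal (LINT x|lebesgue. norm (Df x))"
    using i unfolding eq by (intro nn_integral_eq_integral) auto
  also have "\<dots> \<le> ennreal M" using M unfolding eq by (rule ennreal_leI)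
  finally show ?thesis .
qed

lemma norm_le_det_if_singleton_index:
  fixes D :: "real^'n \<Rightarrow> real^'n"
  assumes U: "(UNIV :: 'n set) = {i}" and D: "linear D"
  shows "norm (D u) \<le> \<bar>det (matrix D)\<bar> * norm u"
proof -
  have all: "k = i" for k :: 'n using U by blast
  have vec: "v = v $ i *\<^sub>R axis i 1" for v :: "real^'n"
  proof (rule vec_eq_iff[THEN iffD2], rule allI)
    show "v $ k = (v $ i *\<^sub>R axis i 1) $ k" for k using all[of k] by (simp add: axis_def)
  qed
  have nrm: "norm v = \<bar>v $ i\<bar>" for v :: "real^'n" by (subst vec) (simp add: norm_axis_1)
  have "det (matrix D) = prod (\<lambda>k. matrix D $ k $ k) UNIV" by (rule det_diagonal) (metis all)
  then have d: "det (matrix D) = D (axis i 1) $ i" by (simp add: U matrix_def)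
  have "D u = u $ i *\<^sub>R D (axis i 1)" by (subst vec[of u]) (simp add: linear_scale[OF D])
  then show ?thesis unfolding nrm d by (simp add: abs_mult)
qed

theorem theorem2:
  fixes T :: real and C :: real
    and b :: "real^'n \<Rightarrow> real^'n"
    and bn :: "nat \<Rightarrow> real^'n \<Rightarrow> real^'n"
    and B :: "real^'n \<Rightarrow> real^'n"
    and X :: "nat \<Rightarrow> real \<Rightarrow> real^'n \<Rightarrow> real^'n"
  assumes dim: "CARD('n) \<le> 2"
    and T: "T > 0"
    and bBV: "BV_loc b"
    and bn_smooth: "\<forall>n. smooth (bn n)"
    and bn_conv: "\<forall>K. compact K \<longrightarrow> (\<lambda>n. LINT x:K|lebesgue. norm (bn n x - b x)) \<longlonglongrightarrow> 0"
    and bn_bdd: "\<exists>M. \<forall>n. (\<forall>x. norm (bn n x) \<le> M)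
                 \<and> integrable lebesgue (\<lambda>x. norm (bn n x))
                 \<and> (LINT x|lebesgue. norm (bn n x)) \<le> M
                 \<and> integrable lebesgue (\<lambda>x. onorm (frechet_derivative (bn n) (at x)))
                 \<and> (LINT x|lebesgue. onorm (frechet_derivative (bn n) (at x))) \<le> M"
    and BW: "W1inf B"
    and transv: "\<forall>n K. compact K \<longrightarrow> (\<exists>c>0. \<forall>x\<in>K. c \<le> bn n x \<bullet> B x)"
    and XC1: "\<forall>n. C1_on ({0..T} \<times> UNIV) (\<lambda>(t, x). X n t x)"
    and ode: "\<forall>n x t. t \<in> {0..T} \<longrightarrow>
                ((\<lambda>s. X n s x) has_vector_derivative bn n (X n t x)) (at t within {0..T})"
    and init: "\<forall>n x. X n 0 x = x"
    and C: "C \<ge> 1"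
    and jac: "\<forall>n t x. t \<in> {0..T} \<longrightarrow> (\<exists>D. (X n t has_derivative D) (at x)
                 \<and> 1 / C \<le> det (matrix D) \<and> det (matrix D) \<le> C)"
  shows "\<forall>K::(real^'n) set. compact K \<longrightarrow>
           (\<forall>s::nat \<Rightarrow> nat. \<exists>r Y. strict_mono r
              \<and> set_integrable lborel ({0..T} \<times> K) (Y :: real \<times> (real^'n) \<Rightarrow> real^'n)
              \<and> (\<lambda>k. LINT z:({0..T} \<times> K)|lborel. norm (X (s (r k)) (fst z) (snd z) - Y z))
                   \<longlonglongrightarrow> 0)"
proof (intro allI impI)
  fix K :: "(real^'n) set" and s :: "nat \<Rightarrow> nat"
  assume K: "compact K"
  obtain M where bM: "\<And>n x. norm (bn n x) \<le> M"
    and M: "\<And>n. integrable lebesgue (\<lambda>x. onorm (frechet_derivative (bn n) (at x)))"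
      "\<And>n. (LINT x|lebesgue. onorm (frechet_derivative (bn n) (at x))) \<le> M"
    using bn_bdd by blast
  have M0: "0 \<le> M" using order_trans[OF norm_ge_zero bM] .
  have "\<exists>D. (\<forall>x. (bn n has_derivative blinfun_apply (D x)) (at x)) \<and> continuous_on UNIV D" for n
    using smooth_derivative[OF bn_smooth[rule_format, of n]] by metis
  then obtain Db where Db: "\<And>n x. (bn n has_derivative blinfun_apply (Db n x)) (at x)"
    and cDb: "\<And>n. continuous_on UNIV (Db n)" by metis
  have IDb: "(\<integral>\<^sup>+x. ennreal (norm (Db n x)) \<partial>lborel) \<le> ennreal M" for n
    by (rule nn_integral_norm_derivative_le[OF Db M])
  \<comment> \<open>A one-point compact set. Where a minimal speed on a ball is wanted, it is
    derived from the continuity of \<open>bn 0\<close>.\<close>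
  have bB: "0 < bn n x \<bullet> B x" for n x
    using transv[rule_format, of "{x}" n] by force
  have cX: "continuous_on ({0..T} \<times> UNIV) (\<lambda>(t, x). X n t x)" for n
    using XC1[rule_format, of n] has_derivative_continuous_on unfolding C1_on_def by blast
  have ode': "((\<lambda>s. X n s x) has_vector_derivative bn n (X n t x)) (at t within {0..T})" if "t \<in> {0..T}" for n t x
    using ode that by blast
  \<comment> \<open>\<open>jac\<close> provides a derivative point by point; by uniqueness it is
    \<open>frechet_derivative\<close>, which names it simultaneously for all \<open>n\<close>,
    \<open>t\<close> and \<open>x\<close>.\<close>
  have DX: "(X n t has_derivative frechet_derivative (X n t) (at x)) (at x)"
    and DXl: "1 / C \<le> det (matrix (frechet_derivative (X n t) (at x)))"
    and DXu: "det (matrix (frechet_derivative (X n t) (at x))) \<le> C" if t: "t \<in> {0..T}" for n t x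
  proof -
    obtain D where D: "(X n t has_derivative D) (at x)" "1 / C \<le> det (matrix D)" "det (matrix D) \<le> C"
      using jac t by blast
    then show "(X n t has_derivative frechet_derivative (X n t) (at x)) (at x)"
      "1 / C \<le> det (matrix (frechet_derivative (X n t) (at x)))"
      "det (matrix (frechet_derivative (X n t) (at x))) \<le> C"
      by (simp_all add: frechet_derivative_at[OF D(1), symmetric])
  qed
  obtain R0 where R0: "0 < R0" "\<And>x. x \<in> K \<Longrightarrow> norm x \<le> R0"
    using bounded_pos[THEN iffD1, OF compact_imp_bounded[OF K]] by blast
  have speed: "norm (X n r x - X n t x) \<le> M * \<bar>r - t\<bar>" if "r \<in> {0..T}" "t \<in> {0..T}" for n r t x
    by (rule solution_speed_bound[where b = "bn n"]) (use ode' bM that in auto)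
  have shift: "\<exists>Q\<ge>0. \<forall>n. \<forall>t\<in>{0..T}. \<forall>h. norm h \<le> 1 \<longrightarrow>
      (\<integral>\<^sup>+x\<in>cball 0 R0. ennreal (norm (X n t (x + h) - X n t x)) \<partial>lborel) \<le> ennreal (e + Q * norm h)"
    if e: "0 < e" for e
  proof (cases "CARD('n) = 2")
    case True
    then obtain i j :: 'n where U: "UNIV = {i, j}" and ij: "i \<noteq> j" by (auto simp: card_2_iff)
    interpret plane "\<lambda>x::real^'n. \<chi> k. if k = i then - x $ j else x $ i" "\<lambda>P. det (matrix P)"
      by (rule plane_real_vec_2[OF U ij])
    show ?thesis
    \<comment> \<open>\<open>bn 0\<close> acts as the reference field far out; it obeys the same
      bounds as the whole sequence.\<close>
    proof (rule flow_shift_modulus[OF Db[of 0] cDb[of 0] bM[of 0] IDb[of 0] bB[of 0] T _ less_imp_le[OF R0(1)] e, where C = C])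
      show "0 < C" using C by simp
    next
      fix Q assume Q: "0 \<le> Q" and shiftQ: "\<And>b Db X DX t h. \<lbrakk>
       \<And>x. (b has_derivative blinfun_apply (Db x)) (at x); continuous_on UNIV Db;
       \<And>x. norm (b x) \<le> M; (\<integral>\<^sup>+x. ennreal (norm (Db x)) \<partial>lborel) \<le> ennreal M; \<And>x. 0 < b x \<bullet> B x;
       continuous_on ({0..T} \<times> UNIV) (\<lambda>(t, x). X t x);
       \<And>t x. t \<in> {0..T} \<Longrightarrow> ((\<lambda>t. X t x) has_vector_derivative b (X t x)) (at t within {0..T});
       \<And>x. X 0 x = x;
       \<And>t x. t \<in> {0..T} \<Longrightarrow> (X t has_derivative DX t x) (at x);
       \<And>t x. t \<in> {0..T} \<Longrightarrow> 1 / C \<le> det (matrix (DX t x));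
       t \<in> {0..T}; norm h \<le> 1\<rbrakk> \<Longrightarrow>
     (\<integral>\<^sup>+x\<in>cball 0 R0. ennreal (norm (X t (x + h) - X t x)) \<partial>lborel) \<le> ennreal (e + Q * norm h)"
      show ?thesis
        by (intro exI[of _ Q] conjI Q allI ballI impI)
           (rule shiftQ[OF Db cDb bM IDb bB cX ode' init[rule_format] DX DXl])
    qed
  next
    case False
    moreover have "0 < CARD('n)" by (rule zero_less_card_finite)
    ultimately have "CARD('n) = 1" using dim by linarith
    then obtain i :: 'n where U: "UNIV = {i}" by (auto simp: card_1_singleton_iff)
    let ?V = "measure lborel (cball (0 :: real^'n) R0)"
    have lip: "norm (X n t (x + h) - X n t x) \<le> C * norm h" if t: "t \<in> {0..T}" for n t x h
    proof -
      have "norm (X n t (x + h) - X n t x) \<le> C * norm (x + h - x)"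
      proof (rule differentiable_bound[of UNIV "X n t" "\<lambda>x. frechet_derivative (X n t) (at x)"])
        show "onorm (frechet_derivative (X n t) (at x)) \<le> C" for x
        proof (rule onorm_le)
          fix u
          have "0 \<le> 1 / C" using C by simp
          then have "\<bar>det (matrix (frechet_derivative (X n t) (at x)))\<bar> \<le> C"
            using DXl[OF t, of n x] DXu[OF t, of n x] by linarith
          then show "norm (frechet_derivative (X n t) (at x) u) \<le> C * norm u"
            using norm_le_det_if_singleton_index[OF U has_derivative_linear[OF DX[OF t, of n x]], of u]
            by (meson mult_right_mono norm_ge_zero order_trans)
        qed
      qed (use DX[OF t] in auto)
      then show ?thesis by simp
    qed
    have "(\<integral>\<^sup>+x\<in>cball 0 R0. ennreal (norm (X n t (x + h) - X n t x)) \<partial>lborel) \<le> ennreal (e + C * ?V * norm h)"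
      if t: "t \<in> {0..T}" for n t h
    proof -
      have "(\<integral>\<^sup>+x\<in>cball 0 R0. ennreal (norm (X n t (x + h) - X n t x)) \<partial>lborel)
        \<le> (\<integral>\<^sup>+x\<in>cball (0 :: real^'n) R0. ennreal (C * norm h) \<partial>lborel)"
        using lip[OF t] by (intro nn_integral_mono mult_right_mono ennreal_leI) auto
      also have "\<dots> = ennreal (C * norm h) * ennreal ?V"
        using emeasure_lborel_cball_finite[of "0 :: real^'n" R0]
        by (subst nn_integral_cmult_indicator) (auto simp: emeasure_eq_ennreal_measure)
      also have "\<dots> = ennreal (C * ?V * norm h)" using C by (simp add: ac_simps flip: ennreal_mult)
      also have "\<dots> \<le> ennreal (e + C * ?V * norm h)" using e by (intro ennreal_leI) simp
      finally show ?thesis .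
    qed
    then show ?thesis using C by (intro exI[of _ "C * ?V"]) auto
  qed
  show "\<exists>r Y. strict_mono r \<and> set_integrable lborel ({0..T} \<times> K) (Y :: real \<times> (real^'n) \<Rightarrow> real^'n)
      \<and> (\<lambda>k. LINT z:({0..T} \<times> K)|lborel. norm (X (s (r k)) (fst z) (snd z) - Y z)) \<longlonglongrightarrow> 0"
  \<comment> \<open>\<open>s\<close> is an arbitrary sequence of indices, not necessarily
    increasing, and the shift modulus holds along it because it is uniform in \<open>n\<close>. The
    bound \<open>W\<close> admits starting points up to radius \<open>R0 + 1\<close>, since
    mollification reads the flow beyond \<open>cball 0 R0\<close>.\<close>
  proof (rule L1_compact_of_shift_modulus[where X = "\<lambda>k. X (s k)" and M = M and ?R0.0 = R0 and W = "R0 + 1 + M * T"])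
    fix n t and x :: "real^'n" assume t: "t \<in> {0..T}" and x: "x \<in> cball 0 (R0 + 1)"
    have "norm (X (s n) t x - X (s n) 0 x) \<le> M * \<bar>t - 0\<bar>" using t T by (intro speed) auto
    also have "\<dots> \<le> M * T" using t M0 by (intro mult_left_mono) auto
    finally have "norm (X (s n) t x - x) \<le> M * T" by (simp add: init)
    then show "norm (X (s n) t x) \<le> R0 + 1 + M * T"
      using norm_triangle_sub[of "X (s n) t x" x] x by simp
  next
    fix e :: real assume "0 < e"
    from shift[OF this] show "\<exists>Q\<ge>0. \<forall>n. \<forall>t\<in>{0..T}. \<forall>h. norm h \<le> 1 \<longrightarrow>
      (\<integral>\<^sup>+x\<in>cball 0 R0. ennreal (norm (X (s n) t (x + h) - X (s n) t x)) \<partial>lborel) \<le> ennreal (e + Q * norm h)"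
      by blast
  qed (use T M0 cX speed K R0 in auto)
qed

end
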